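(* Let $k\in\mathbb R\setminus\{0\}$ and consider the Euler-Poisson-Alignment system \[ \partial_t \rho + \partial_x(\rho u)=0,\qquad \partial_t u+u\,\partial_x u=-k\,\partial_x\phi+\int_{\mathbb R}\psi(x-y)\,(u(y,t)-u(x,t))\,\rho(y,t)\,dy,\qquad \partial_x^2\phi=\rho, \] for $x\in\mathbb R$, $t>0$, with initial data $(\rho,u)|_{t=0}=(\rho_0,u_0)$. (1) Attractive Poisson forcing, $k>0$: the solution blows up in finite time, for all initial configurations. (2) Repulsive Poisson forcing, $k<0$: (a) [Subcritical region] If $\partial_x u_0(x)>-(\psi\star\rho_0)(x)+\sigma_+(x)$ for all $x\in\mathbb R$, then the system has a global classical solution. Here $\sigma_+(x)=0$ whenever $\rho_0(x)=0$, and, where $\rho_0(x)>0$, $\sigma_+(x)$ is the (unique) negative root of the equation \[ \frac{1}{\rho_0(x)}-\frac{1}{\psi_M^2}\left(k+\psi_M\,\frac{\sigma_+(x)}{\rho_0(x)}-k\,e^{\psi_M\sigma_+(x)/(k\rho_0(x))}\right)=0 . \] (b) [Supercritical region] If there exists an $x\in\mathbb R$ such that \[ \partial_x u_0(x)<-(\psi\star\rho_0)(x)+\sigma_-(x),\qquad \sigma_-(x):=-\sqrt{-2k\rho_0(x)}, \] then the solution blows up in a finite time.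
   Context: Standing assumptions: the influence function $\psi\in W^{1,\infty}(\mathbb R)$ is symmetric and bounded, $0\le\psi_m\le\psi(x)=\psi(-x)\le\psi_M$ for constants $\psi_m,\psi_M$, with $\psi_M>0$. The density $\rho\ge0$ is a probability density, $\|\rho(\cdot,t)\|_{L^1}=1$. $\star$ is convolution in $x$. The Poisson force corresponds to the interaction potential $K(x)=\frac{k}{2}|x|$ (so $\partial_x^2K=k\delta_0$), i.e. $k\,\partial_x\phi=\partial_xK\star\rho$, $\partial_x\phi(x)=\frac12\int_{\mathbb R}\mathrm{sgn}(x-y)\rho(y)\,dy$. The initial data are regular enough that a classical solution (with $\rho,\partial_xu$ bounded) exists locally in time. "Blows up in finite time" means that the classical solution cannot be continued for all time ($\rho$ and/or $|\partial_xu|$ become unbounded in finite time).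
   Formalization: The initial density ρ_0 is additionally assumed uniformly continuous (true for H^s, s>1/2, or bounded C^1 data); without it (2a) can fail, for densities with infinitely many ever narrower peaks whose threshold gaps tend to 0. *)

theory Defs
  imports "HOL-Analysis.Analysis"
begin

text \<open>Functions of time and space are curried, time first: \<open>rho t x\<close>, \<open>u t x\<close>.\<close>

text \<open>
  The Sobolev space \<open>W^{1,\<infinity>}\<close> on the real line, for the continuous representative:
  \<open>f\<close> is bounded and is a primitive of a bounded function \<open>g\<close>, its weak derivative (an
  essentially bounded weak derivative can be modified on a null set to be bounded everywhere).
\<close>
definition W1infty :: "(real \<Rightarrow> real) \<Rightarrow> bool" where
  "W1infty f \<longleftrightarrow> bounded (range f) \<and>
     (\<exists>g. g \<in> borel_measurable borel \<and> bounded (range g) \<and>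
          (\<forall>a b. a \<le> b \<longrightarrow> f b - f a = (LINT y:{a..b}|lborel. g y)))"

definition conv :: "(real \<Rightarrow> real) \<Rightarrow> (real \<Rightarrow> real) \<Rightarrow> real \<Rightarrow> real" where
  "conv f g x = (LINT y|lborel. f (x - y) * g y)"

definition prob_density :: "(real \<Rightarrow> real) \<Rightarrow> bool" where
  "prob_density r \<longleftrightarrow>
     (\<forall>x. 0 \<le> r x) \<and> integrable lborel r \<and> (LINT x|lborel. r x) = 1"

text \<open>
  A potential \<open>f\<close> of the density \<open>r\<close>: \<open>f'' = r\<close>, with the force \<open>f'\<close> normalized
  as the one generated by the kernel \<open>|x|/2\<close>. The potential itself is determined only up to a
  constant; \<open>|x|/2 \<star> r\<close> need not be defined, since \<open>r\<close> may have no first moment.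
\<close>
definition poisson_potential :: "(real \<Rightarrow> real) \<Rightarrow> (real \<Rightarrow> real) \<Rightarrow> bool" where
  "poisson_potential r f \<longleftrightarrow>
     (\<forall>x. (f has_real_derivative (1/2 * (LINT y|lborel. sgn (x - y) * r y))) (at x)) \<and>
     (\<forall>x. (deriv f has_real_derivative r x) (at x))"

definition time_dom :: "ereal \<Rightarrow> real set" where
  "time_dom T = {t. 0 \<le> t \<and> ereal t < T}"

text \<open>\<open>C\<^sup>1\<close> on \<open>[0,T) \<times> \<real>\<close>; the time derivative is one-sided at \<open>t = 0\<close>.\<close>
definition C1_slab :: "ereal \<Rightarrow> (real \<Rightarrow> real \<Rightarrow> real) \<Rightarrow> bool" where
  "C1_slab T f \<longleftrightarrow>
     (\<exists>ft fx. continuous_on (time_dom T \<times> UNIV) (\<lambda>(t, x). ft t x) \<and>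
              continuous_on (time_dom T \<times> UNIV) (\<lambda>(t, x). fx t x) \<and>
              (\<forall>t\<in>time_dom T. \<forall>x.
                 ((\<lambda>s. f s x) has_real_derivative ft t x) (at t within time_dom T) \<and>
                 (f t has_real_derivative fx t x) (at x)))"

text \<open>
  Classical solution on \<open>[0,T)\<close>, with \<open>T = \<infinity>\<close> for a global one. The quantities \<open>rho\<close>
  and \<open>\<partial>\<^sub>x u\<close> are bounded on every strip \<open>[0,\<tau>] \<times> \<real>\<close> with \<open>\<tau> < T\<close>, but not
  necessarily up to time \<open>T\<close>. The momentum \<open>u rho\<close> is in \<open>L\<^sup>1\<close>, locally uniformly in
  time, because the alignment integral has to make sense; \<open>u\<close> itself may be unbounded.
\<close>
definition classical_solution ::
  "(real \<Rightarrow> real) \<Rightarrow> real \<Rightarrow> (real \<Rightarrow> real) \<Rightarrow> (real \<Rightarrow> real) \<Rightarrow> ereal \<Rightarrow>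
   (real \<Rightarrow> real \<Rightarrow> real) \<Rightarrow> (real \<Rightarrow> real \<Rightarrow> real) \<Rightarrow> bool" where
  "classical_solution psi k rho0 u0 T rho u \<longleftrightarrow>
     C1_slab T rho \<and> C1_slab T u \<and>
     rho 0 = rho0 \<and> u 0 = u0 \<and>
     (\<forall>t\<in>time_dom T. prob_density (rho t) \<and> integrable lborel (\<lambda>y. u t y * rho t y)) \<and>
     (\<forall>\<tau>\<in>time_dom T. \<exists>C. \<forall>t\<in>{0..\<tau>}.
        (\<forall>x. rho t x \<le> C \<and> \<bar>deriv (u t) x\<bar> \<le> C) \<and>
        (LINT y|lborel. \<bar>u t y\<bar> * rho t y) \<le> C) \<and>
     (\<exists>phi. \<forall>t\<in>time_dom T. t > 0 \<longrightarrow>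
        poisson_potential (rho t) (phi t) \<and>
        (\<forall>x. deriv (\<lambda>s. rho s x) t + deriv (\<lambda>y. rho t y * u t y) x = 0 \<and>
             deriv (\<lambda>s. u s x) t + u t x * deriv (u t) x =
               - k * deriv (phi t) x
               + (LINT y|lborel. psi (x - y) * (u t y - u t x) * rho t y)))"

text \<open>
  Initial data regular enough for a local classical solution. Uniform continuity of \<open>rho0\<close>
  (for an integrable continuous function the same as vanishing at infinity) holds in the Sobolev
  and \<open>C\<^sup>1\<close>-bounded classes in which local existence is usually stated. It excludes densities
  with infinitely many ever narrower peaks of fixed height: for these a strict pointwise threshold
  condition need not keep \<open>rho\<close> bounded uniformly in \<open>x\<close>.
\<close>
definition regular_data ::
  "(real \<Rightarrow> real) \<Rightarrow> real \<Rightarrow> (real \<Rightarrow> real) \<Rightarrow> (real \<Rightarrow> real) \<Rightarrow> bool" where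
  "regular_data psi k rho0 u0 \<longleftrightarrow>
     uniformly_continuous_on UNIV rho0 \<and>
     (\<exists>T>0. \<exists>rho u. classical_solution psi k rho0 u0 T rho u)"

definition global_classical_solution_exists ::
  "(real \<Rightarrow> real) \<Rightarrow> real \<Rightarrow> (real \<Rightarrow> real) \<Rightarrow> (real \<Rightarrow> real) \<Rightarrow> bool" where
  "global_classical_solution_exists psi k rho0 u0 \<longleftrightarrow>
     (\<exists>rho u. classical_solution psi k rho0 u0 \<infinity> rho u)"

text \<open>
  There is a finite maximal time of existence \<open>\<tau>\<close>, and \<open>rho\<close> or \<open>\<bar>\<partial>\<^sub>x u\<bar>\<close> is unbounded
  on \<open>[0,\<tau>) \<times> \<real>\<close>.
\<close>
definition blows_up_in_finite_time ::
  "(real \<Rightarrow> real) \<Rightarrow> real \<Rightarrow> (real \<Rightarrow> real) \<Rightarrow> (real \<Rightarrow> real) \<Rightarrow> bool" where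
  "blows_up_in_finite_time psi k rho0 u0 \<longleftrightarrow>
     (\<exists>\<tau>::real. \<tau> > 0 \<and>
        (\<exists>rho u. classical_solution psi k rho0 u0 (ereal \<tau>) rho u \<and>
           (\<forall>C. \<exists>t\<in>time_dom (ereal \<tau>). \<exists>x. rho t x > C \<or> \<bar>deriv (u t) x\<bar> > C)) \<and>
        (\<forall>T > ereal \<tau>. \<nexists>rho u. classical_solution psi k rho0 u0 T rho u))"

text \<open>\<open>s\<close> is a negative root of the threshold equation for the density value \<open>r > 0\<close>.\<close>
definition threshold_root :: "real \<Rightarrow> real \<Rightarrow> real \<Rightarrow> real \<Rightarrow> bool" where
  "threshold_root k psi_M r s \<longleftrightarrow> s < 0 \<and>
     1 / r - 1 / psi_M\<^sup>2 * (k + psi_M * (s / r) - k * exp (psi_M * s / (k * r))) = 0"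

definition sigma_plus :: "real \<Rightarrow> real \<Rightarrow> real \<Rightarrow> real" where
  "sigma_plus k psi_M r = (if r = 0 then 0 else (THE s. threshold_root k psi_M r s))"

definition sigma_minus :: "real \<Rightarrow> real \<Rightarrow> real" where
  "sigma_minus k r = - sqrt (- 2 * k * r)"

end

theory Submission
  imports Defs
begin

text \<open>
  In one space dimension the alignment force is a time derivative along particle paths: if
  \<open>\<Psi>' = \<psi>\<close>, the Lagrangian flow \<open>X\<close> satisfies the first-order equation
  \<open>\<partial>\<^sub>t X(a) = u\<^sub>0(a) + t F(a) - \<integral> (\<Psi>(X(a) - X(c)) - \<Psi>(a - c)) \<rho>\<^sub>0(c) dc\<close>, where the Poisson
  force \<open>F(a) = -(k/2) \<integral> sgn(a - c) \<rho>\<^sub>0(c) dc\<close> does not depend on time because particles keep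
  their order. Its right-hand side is globally Lipschitz, so \<open>X\<close> exists for all times, and
  \<open>G = \<partial>\<^sub>a X\<close> solves \<open>\<partial>\<^sub>t G = e\<^sub>0 - k t \<rho>\<^sub>0 - q G\<close> with \<open>e\<^sub>0 = \<partial>\<^sub>x u\<^sub>0 + \<psi> \<star> \<rho>\<^sub>0\<close> and
  \<open>0 \<le> q = (\<psi> \<star> \<rho>)(X) \<le> \<psi>\<^sub>M\<close>. A classical solution exists on \<open>[0,T)\<close> if and only if \<open>G\<close> is
  bounded below by a positive constant on every strip \<open>[0,\<tau>] \<times> \<real>\<close> with \<open>\<tau> < T\<close>, and then
  \<open>\<rho>(X) = \<rho>\<^sub>0 / G\<close> and \<open>\<partial>\<^sub>x u(X) = \<partial>\<^sub>t G / G\<close>. The thresholds come from comparing \<open>G\<close> with the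
  solutions of the same linear equation for \<open>q = 0\<close> (blow-up) and \<open>q = \<psi>\<^sub>M\<close> (global existence).
\<close>

section \<open>Ordinary differential inequalities and Picard iteration\<close>

text \<open>The Lagrangian equation keeps its meaning after \<open>G\<close> has reached zero, so no
  continuation theory is needed: the maximal time is the first time at which the lower bound on
  \<open>G\<close> fails. Nonexistence beyond it speaks of arbitrary classical solutions, so each of
  them must be shown to follow this one flow. Uniformity in the label is the other obstacle:
  \<open>u0\<close> may be unbounded, which calls for a weighted norm, and \<open>G > 0\<close> at
  every label is weaker than a common lower bound, which far out comes from the decay of
  \<open>rho0\<close>. The two thresholds are conditions at the worst time. For
  \<open>k < 0 < rho0\<close> and \<open>q = 0\<close> the solution is a parabola whose minimum over
  positive times is negative exactly when \<open>e0\<close> lies below \<open>sigma_minus\<close>.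
  For \<open>q = \<psi>\<^sub>M\<close> and negative \<open>k\<close> and \<open>e0\<close> the
  source \<open>e0 - k t rho0\<close> changes sign at \<open>t = e0 / (k rho0)\<close>; only this
  time matters, and the threshold equation says that the comparison solution vanishes there.\<close>

lemma at_within_atLeastAtMost_eq:
  fixes t b :: real
  assumes "0 \<le> t" "t < b"
  shows "at t within {0..b} = at t within {0..}"
  by (rule at_within_nhd[of t "{..<b}"]) (use assms in auto)

lemma time_dom_dense:
  assumes "t \<in> time_dom T"
  obtains b where "t < b" "b \<in> time_dom T"
proof (cases "T = \<infinity>")
  case True then show ?thesis using that[of "t+1"] assms by (auto simp: time_dom_def)
next
  case False
  obtain z where "ereal t < ereal z" "ereal z < T"
    using assms ereal_dense2[of "ereal t" T] unfolding time_dom_def by blast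
  then show ?thesis using that[of z] assms by (auto simp: time_dom_def)
qed

lemma time_dom_downward: "b \<in> time_dom T \<Longrightarrow> 0 \<le> s \<Longrightarrow> s \<le> b \<Longrightarrow> s \<in> time_dom T"
  by (auto simp: time_dom_def intro: le_less_trans[of "ereal s" "ereal b"])

lemma at_within_time_dom:
  assumes "t \<in> time_dom T"
  shows "at t within time_dom T = at t within {0..}"
proof -
  obtain b where "t < b" "b \<in> time_dom T" using time_dom_dense[OF assms] .
  then show ?thesis
    using assms time_dom_downward[of b T]
    by (intro at_within_nhd[of t "{..<b}"]) (auto simp: time_dom_def[of T])
qed

text \<open>Time derivatives are taken within \<open>{0..}\<close> throughout, hence one-sided at 0
  only. The sign is required only strictly between the end points, because the differential
  equations of a classical solution hold only for positive times.\<close>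

lemma nonincreasing_between:
  fixes h h' :: "real \<Rightarrow> real"
  assumes d: "\<And>r. r \<in> {s..t} \<Longrightarrow> (h has_real_derivative h' r) (at r within {0..})"
    and neg: "\<And>r. s < r \<Longrightarrow> r < t \<Longrightarrow> h' r \<le> 0"
    and t: "0 \<le> s" "s \<le> t"
  shows "h t \<le> h s"
proof (rule DERIV_nonpos_imp_decreasing_open[OF t(2)])
  fix x assume x: "s < x" "x < t"
  have "at x within {0..} = at x" using x t by (intro at_within_interior) auto
  then show "\<exists>y. (h has_real_derivative y) (at x) \<and> y \<le> 0"
    using d[of x] neg[of x] x t by auto
next
  show "continuous_on {s..t} h"
    unfolding continuous_on_eq_continuous_within
  proof
    fix x assume "x \<in> {s..t}"
    then have "continuous (at x within {0..}) h" using d[of x] by (auto intro: DERIV_continuous)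
    then show "continuous (at x within {s..t}) h"
      by (rule continuous_within_subset) (use t in auto)
  qed
qed

lemma nonincreasing_within:
  fixes h h' :: "real \<Rightarrow> real"
  assumes d: "\<And>s. s \<in> {0..\<tau>} \<Longrightarrow> (h has_real_derivative h' s) (at s within {0..})"
    and neg: "\<And>s. 0 < s \<Longrightarrow> s < \<tau> \<Longrightarrow> h' s \<le> 0"
    and t: "0 \<le> s" "s \<le> t" "t \<le> \<tau>"
  shows "h t \<le> h s"
  by (rule nonincreasing_between[where h'=h']) (use assms in auto)

text \<open>With \<open>p\<close> constant this is a conservation principle, with \<open>p\<close>
  linear or exponential a growth bound; it is monotonicity of \<open>h - p\<close> and
  \<open>- h - p\<close>.\<close>

lemma real_derivative_bound:
  fixes h h' p p' :: "real \<Rightarrow> real"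
  assumes d: "\<And>s. s \<in> {0..\<tau>} \<Longrightarrow> (h has_real_derivative h' s) (at s within {0..})"
    and p: "\<And>s. s \<in> {0..\<tau>} \<Longrightarrow> (p has_real_derivative p' s) (at s within {0..})"
    and b: "\<And>s. 0 < s \<Longrightarrow> s < \<tau> \<Longrightarrow> \<bar>h' s\<bar> \<le> p' s"
    and t: "0 \<le> s" "s \<le> t" "t \<le> \<tau>"
  shows "\<bar>h t - h s\<bar> \<le> p t - p s"
proof -
  have 1: "(\<lambda>r. h r - p r) t \<le> (\<lambda>r. h r - p r) s"
  proof (rule nonincreasing_within[where \<tau>=\<tau> and h="\<lambda>r. h r - p r" and h'="\<lambda>r. h' r - p' r"])
    show "((\<lambda>r. h r - p r) has_real_derivative h' r - p' r) (at r within {0..})" if "r \<in> {0..\<tau>}" for r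
      using that by (intro DERIV_diff d p)
    show "h' r - p' r \<le> 0" if "0 < r" "r < \<tau>" for r
      using b[OF that] by linarith
  qed (use t in auto)
  have 2: "(\<lambda>r. - h r - p r) t \<le> (\<lambda>r. - h r - p r) s"
  proof (rule nonincreasing_within[where \<tau>=\<tau> and h="\<lambda>r. - h r - p r" and h'="\<lambda>r. - h' r - p' r"])
    show "((\<lambda>r. - h r - p r) has_real_derivative - h' r - p' r) (at r within {0..})" if "r \<in> {0..\<tau>}" for r
      using that by (intro DERIV_diff DERIV_minus d p)
    show "- h' r - p' r \<le> 0" if "0 < r" "r < \<tau>" for r
      using b[OF that] by linarith
  qed (use t in auto)
  from 1 2 show ?thesis by auto
qed

text \<open>Squaring avoids differentiating the absolute value. The rate \<open>2*C+1\<close> is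
  \<open>2*C\<close> from the derivative of the square plus 1 from absorbing \<open>2 * \<epsilon> *
  \<bar>y\<bar> \<le> \<epsilon>\<^sup>2 + y\<^sup>2\<close>.\<close>

lemma gronwall_sq:
  fixes y y' :: "real \<Rightarrow> real"
  assumes d: "\<And>s. s \<in> {0..\<tau>} \<Longrightarrow> (y has_real_derivative y' s) (at s within {0..})"
    and b: "\<And>s. 0 < s \<Longrightarrow> s < \<tau> \<Longrightarrow> y s * y' s \<le> C * (y s)\<^sup>2 + \<epsilon> * \<bar>y s\<bar>"
    and C: "0 \<le> C" and t: "0 \<le> t" "t \<le> \<tau>"
  shows "(y t)\<^sup>2 \<le> ((y 0)\<^sup>2 + \<epsilon>\<^sup>2 * t) * exp ((2*C+1)*t)"
proof -
  define c where "c = 2*C+1"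
  define h where "h s = (y s)\<^sup>2 * exp (- (c * s)) - \<epsilon>\<^sup>2 * s" for s
  define h' where "h' s = (2 * y s * y' s - c * (y s)\<^sup>2) * exp (- (c * s)) - \<epsilon>\<^sup>2" for s
  have "(h has_real_derivative h' s) (at s within {0..})" if "s \<in> {0..\<tau>}" for s
    unfolding h_def h'_def
    by (rule derivative_eq_intros d[OF that] refl)+ (simp add: algebra_simps power2_eq_square)
  moreover have "h' s \<le> 0" if "0 < s" "s < \<tau>" for s
  proof -
    have "2 * \<epsilon> * \<bar>y s\<bar> \<le> \<epsilon>\<^sup>2 + (y s)\<^sup>2"
      using zero_le_power2[of "\<epsilon> - \<bar>y s\<bar>"] by (simp add: power2_diff)
    then have 1: "2 * y s * y' s - c * (y s)\<^sup>2 \<le> \<epsilon>\<^sup>2"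
      using b[OF that] unfolding c_def by (simp add: algebra_simps)
    have "(2 * y s * y' s - c * (y s)\<^sup>2) * exp (- (c * s)) \<le> \<epsilon>\<^sup>2 * exp (- (c * s))"
      using 1 by (intro mult_right_mono) auto
    also have "\<dots> \<le> \<epsilon>\<^sup>2 * 1"
      using that C by (intro mult_left_mono) (auto simp: c_def)
    finally show ?thesis by (simp add: h'_def)
  qed
  ultimately have "h t \<le> h 0"
    using t by (intro nonincreasing_within[where \<tau>=\<tau> and h=h and h'=h']) auto
  then have "(y t)\<^sup>2 * exp (- (c * t)) \<le> (y 0)\<^sup>2 + \<epsilon>\<^sup>2 * t" by (simp add: h_def)
  then have "(y t)\<^sup>2 * exp (- (c * t)) * exp (c * t) \<le> ((y 0)\<^sup>2 + \<epsilon>\<^sup>2 * t) * exp (c * t)"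
    by (intro mult_right_mono) auto
  also have "(y t)\<^sup>2 * exp (- (c * t)) * exp (c * t) = (y t)\<^sup>2" by (simp add: exp_minus)
  finally show ?thesis by (simp add: c_def)
qed

text \<open>The exponent is coarse so that the bound does not depend on \<open>t\<close> and is
  linear in \<open>\<bar>y 0\<bar> + \<epsilon>\<close>. Linearity is what the difference quotients
  of a flow require later.\<close>

lemma gronwall_abs:
  fixes y y' :: "real \<Rightarrow> real"
  assumes d: "\<And>s. s \<in> {0..\<tau>} \<Longrightarrow> (y has_real_derivative y' s) (at s within {0..})"
    and b: "\<And>s. 0 < s \<Longrightarrow> s < \<tau> \<Longrightarrow> \<bar>y' s\<bar> \<le> C * \<bar>y s\<bar> + \<epsilon>"
    and C: "0 \<le> C" and t: "0 \<le> t" "t \<le> \<tau>" and \<epsilon>: "0 \<le> \<epsilon>"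
  shows "\<bar>y t\<bar> \<le> (\<bar>y 0\<bar> + \<epsilon>) * exp ((C+1)*(\<tau>+1))"
proof -
  have "(y t)\<^sup>2 \<le> ((y 0)\<^sup>2 + \<epsilon>\<^sup>2 * t) * exp ((2*C+1)*t)"
  proof (rule gronwall_sq[OF d _ C t])
    fix s assume s: "0 < s" "s < \<tau>"
    have "y s * y' s \<le> \<bar>y s\<bar> * \<bar>y' s\<bar>" by (metis abs_ge_self abs_mult)
    also have "\<dots> \<le> \<bar>y s\<bar> * (C * \<bar>y s\<bar> + \<epsilon>)" by (intro mult_left_mono b s) auto
    finally show "y s * y' s \<le> C * (y s)\<^sup>2 + \<epsilon> * \<bar>y s\<bar>"
      by (simp add: algebra_simps power2_eq_square)
  qed
  also have "\<dots> \<le> ((\<bar>y 0\<bar> + \<epsilon>)\<^sup>2 * exp \<tau>) * exp ((2*C+1)*t)"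
  proof (intro mult_right_mono)
    have "t \<le> exp \<tau>" "1 \<le> exp \<tau>" using t exp_ge_add_one_self[of \<tau>] by linarith+
    then have "(y 0)\<^sup>2 * 1 + \<epsilon>\<^sup>2 * t \<le> (y 0)\<^sup>2 * exp \<tau> + \<epsilon>\<^sup>2 * exp \<tau>"
      by (intro add_mono mult_left_mono) auto
    also have "\<dots> \<le> (\<bar>y 0\<bar> + \<epsilon>)\<^sup>2 * exp \<tau>"
    proof -
      have "(y 0)\<^sup>2 + \<epsilon>\<^sup>2 \<le> (\<bar>y 0\<bar> + \<epsilon>)\<^sup>2" using \<epsilon> by (simp add: power2_sum)
      then show ?thesis by (simp flip: distrib_right)
    qed
    finally show "(y 0)\<^sup>2 + \<epsilon>\<^sup>2 * t \<le> (\<bar>y 0\<bar> + \<epsilon>)\<^sup>2 * exp \<tau>" by simp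
  qed auto
  also have "\<dots> = (\<bar>y 0\<bar> + \<epsilon>)\<^sup>2 * exp (\<tau> + (2*C+1)*t)" by (simp add: exp_add)
  also have "\<dots> \<le> (\<bar>y 0\<bar> + \<epsilon>)\<^sup>2 * exp (2*((C+1)*(\<tau>+1)))"
  proof -
    have "(2*C+1)*t \<le> (2*C+1)*\<tau>" using C t by (intro mult_left_mono) auto
    then have "\<tau> + (2*C+1)*t \<le> 2*((C+1)*(\<tau>+1))" using C t by (simp add: algebra_simps)
    then show ?thesis by (intro mult_left_mono) auto
  qed
  also have "\<dots> = ((\<bar>y 0\<bar> + \<epsilon>) * exp ((C+1)*(\<tau>+1)))\<^sup>2"
    by (simp add: power_mult_distrib exp_double)
  finally show ?thesis
    using \<epsilon> by (simp add: abs_le_square_iff[symmetric])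
qed

section \<open>Global solutions of Lipschitz equations in a Banach space\<close>

lemma integral_half_line_deriv:
  fixes h :: "real \<Rightarrow> 'a::banach"
  assumes "continuous_on {0..} h" "0 \<le> t"
  shows "((\<lambda>t. integral {0..t} h) has_vector_derivative h t) (at t within {0..})"
proof -
  have "((\<lambda>t. integral {0..t} h) has_vector_derivative h t) (at t within {0..t+1})"
    using assms by (intro integral_has_vector_derivative continuous_on_subset[OF assms(1)]) auto
  then show ?thesis using assms by (simp add: at_within_atLeastAtMost_eq)
qed

text \<open>Bielecki's weighted norm: with \<open>y t = exp (c * t) *\<^sub>R z t\<close> and
  \<open>c > L\<close> the integral operator contracts bounded continuous functions \<open>z\<close>
  with the factor \<open>L / c\<close> on the whole half-line, so no local solutions have to be
  glued. The growth condition on \<open>f t 0\<close> keeps the operator inside this space.\<close>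

lemma picard:
  fixes f :: "real \<Rightarrow> 'a::banach \<Rightarrow> 'a"
  assumes cont: "continuous_on ({0..} \<times> UNIV) (\<lambda>(t, x). f t x)"
    and lip: "\<And>t x y. 0 \<le> t \<Longrightarrow> norm (f t x - f t y) \<le> L * norm (x - y)"
    and gr: "\<And>t. 0 \<le> t \<Longrightarrow> norm (f t 0) \<le> B * exp (c * t)"
    and L: "0 \<le> L" "L < c" "0 \<le> B"
  shows "\<exists>y. y 0 = x0 \<and> (\<forall>t\<ge>0. (y has_vector_derivative f t (y t)) (at t within {0..}))"
proof -
  have c: "0 < c" using L by simp
  define h where "h z s = f s (exp (c * s) *\<^sub>R apply_bcontfun z s)" for z :: "real \<Rightarrow>\<^sub>C 'a" and s
  have hcont: "continuous_on {0..} (h z)" for z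
    unfolding h_def
    by (rule continuous_on_compose2[OF cont, where f="\<lambda>s. (s, exp (c * s) *\<^sub>R apply_bcontfun z s)", simplified])
      (auto intro!: continuous_intros)
  have hint: "h z integrable_on {0..t}" for z t
    by (intro integrable_continuous_interval continuous_on_subset[OF hcont]) auto
  have expint: "((\<lambda>s. A * exp (c * s)) has_integral A * (exp (c * t) - 1) / c) {0..t}" if "0 \<le> t" for A t
  proof -
    have "((\<lambda>s. A * exp (c * s)) has_integral A * exp (c * t) / c - A * exp (c * 0) / c) {0..t}"
      using that c
      by (intro fundamental_theorem_of_calculus)
        (auto intro!: derivative_eq_intros simp flip: has_real_derivative_iff_has_vector_derivative)
    then show ?thesis by (simp add: diff_divide_distrib right_diff_distrib)
  qed
  \<comment> \<open>\<open>max 0 t\<close> continues the iterate by the constant \<open>x0\<close>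
    to negative times, since \<open>bcontfun\<close> consists of functions on the whole
    line.\<close>
  define P where "P z t = exp (- (c * max 0 t)) *\<^sub>R (x0 + integral {0..max 0 t} (h z))" for z t
  have Pcont: "continuous_on UNIV (P z)" for z
  proof -
    have "continuous_on {0..} (\<lambda>t. integral {0..t} (h z))"
      using integral_half_line_deriv[OF hcont]
      by (auto simp: continuous_on_eq_continuous_within intro!: has_vector_derivative_continuous)
    then have "continuous_on UNIV (\<lambda>t. integral {0..max 0 t} (h z))"
      by (rule continuous_on_compose2) (auto intro!: continuous_intros)
    then show ?thesis unfolding P_def by (auto intro!: continuous_intros)
  qed
  have hbd: "norm (h z s) \<le> (B + L * norm z) * exp (c * s)" if "0 \<le> s" for z s
  proof -
    have "norm (h z s) \<le> norm (f s 0) + norm (f s (exp (c * s) *\<^sub>R apply_bcontfun z s) - f s 0)"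
      unfolding h_def by (metis add.commute diff_add_cancel norm_triangle_ineq)
    also have "\<dots> \<le> B * exp (c * s) + L * norm (exp (c * s) *\<^sub>R apply_bcontfun z s)"
      using lip[OF that, of _ 0] gr[OF that] by (intro add_mono) (auto simp del: norm_scaleR simp: lip[OF that, of _ 0, simplified])
    also have "\<dots> \<le> B * exp (c * s) + L * (exp (c * s) * norm z)"
      using L norm_bounded[of z s] by (intro add_mono mult_left_mono) auto
    finally show ?thesis by (simp add: algebra_simps)
  qed
  have Pbd: "P z \<in> bcontfun" for z
  proof (rule bcontfun_normI[OF Pcont])
    fix t :: real
    let ?t = "max 0 t" and ?A = "B + L * norm z"
    have A: "0 \<le> ?A" using L by simp
    have "norm (integral {0..?t} (h z)) \<le> integral {0..?t} (\<lambda>s. ?A * exp (c * s))"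
      using expint[of ?t] by (intro integral_norm_bound_integral hint) (auto intro!: hbd simp: has_integral_integrable)
    also have "\<dots> = ?A * (exp (c * ?t) - 1) / c" by (rule integral_unique[OF expint]) simp
    also have "\<dots> \<le> ?A * exp (c * ?t) / c" using A c by (intro divide_right_mono mult_left_mono) auto
    finally have i: "norm (integral {0..?t} (h z)) \<le> ?A * exp (c * ?t) / c" .
    have "norm (P z t) \<le> exp (- (c * ?t)) * (norm x0 + ?A * exp (c * ?t) / c)"
      unfolding P_def norm_scaleR using i norm_triangle_ineq[of x0 "integral {0..?t} (h z)"] by auto
    also have "\<dots> = exp (- (c * ?t)) * norm x0 + ?A / c" by (simp add: algebra_simps exp_minus)
    also have "\<dots> \<le> 1 * norm x0 + ?A / c" using c by (intro add_mono mult_right_mono) auto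
    finally show "norm (P z t) \<le> norm x0 + ?A / c" by simp
  qed
  define \<Phi> where "\<Phi> z = Bcontfun (P z)" for z
  have ap: "apply_bcontfun (\<Phi> z) = P z" for z
    unfolding \<Phi>_def by (rule Bcontfun_inverse[OF Pbd])
  have "dist (\<Phi> z1) (\<Phi> z2) \<le> L / c * dist z1 z2" for z1 z2
  proof (rule dist_bound)
    fix t :: real
    let ?t = "max 0 t" and ?A = "L * dist z1 z2"
    have A: "0 \<le> ?A" using L by simp
    have "norm (integral {0..?t} (\<lambda>s. h z1 s - h z2 s)) \<le> integral {0..?t} (\<lambda>s. ?A * exp (c * s))"
    proof (intro integral_norm_bound_integral integrable_diff hint)
      fix s assume "s \<in> {0..?t}"
      then have s: "0 \<le> s" by auto
      have "norm (h z1 s - h z2 s) \<le> L * norm (exp (c * s) *\<^sub>R (apply_bcontfun z1 s - apply_bcontfun z2 s))"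
        unfolding h_def using lip[OF s] by (simp add: scaleR_diff_right)
      also have "\<dots> \<le> L * (exp (c * s) * dist z1 z2)"
        using L dist_bounded[of z1 s z2] by (intro mult_left_mono) (auto simp: dist_norm)
      finally show "norm (h z1 s - h z2 s) \<le> ?A * exp (c * s)" by (simp add: algebra_simps)
    qed (use expint[of ?t] in \<open>auto simp: has_integral_integrable\<close>)
    also have "\<dots> = ?A * (exp (c * ?t) - 1) / c" by (rule integral_unique[OF expint]) simp
    also have "\<dots> \<le> ?A * exp (c * ?t) / c" using A c by (intro divide_right_mono mult_left_mono) auto
    finally have i: "norm (integral {0..?t} (h z1) - integral {0..?t} (h z2)) \<le> ?A * exp (c * ?t) / c"
      by (simp add: Henstock_Kurzweil_Integration.integral_diff hint)
    have "dist (P z1 t) (P z2 t) = exp (- (c * ?t)) * norm (integral {0..?t} (h z1) - integral {0..?t} (h z2))"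
      unfolding P_def dist_norm by (simp flip: scaleR_diff_right)
    also have "\<dots> \<le> exp (- (c * ?t)) * (?A * exp (c * ?t) / c)" using i by (intro mult_left_mono) auto
    also have "\<dots> = L / c * dist z1 z2" by (simp add: exp_minus)
    finally show "dist (\<Phi> z1 t) (\<Phi> z2 t) \<le> L / c * dist z1 z2" by (simp add: ap)
  qed
  then obtain z where z: "\<Phi> z = z"
    using banach_fix_type[of "L / c" \<Phi>] L c by auto
  define y where "y t = x0 + integral {0..t} (h z)" for t
  have yz: "exp (c * t) *\<^sub>R apply_bcontfun z t = y t" if "0 \<le> t" for t
  proof -
    have "apply_bcontfun z t = P z t" using ap[of z] z by simp
    then show ?thesis using that by (simp add: P_def y_def exp_minus)
  qed
  have "(y has_vector_derivative f t (y t)) (at t within {0..})" if "0 \<le> t" for t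
  proof -
    have "(y has_vector_derivative 0 + h z t) (at t within {0..})"
      unfolding y_def by (intro has_vector_derivative_add integral_half_line_deriv hcont that) auto
    then show ?thesis by (simp add: h_def yz[OF that])
  qed
  moreover have "y 0 = x0" by (simp add: y_def)
  ultimately show ?thesis by blast
qed

section \<open>Calculus in space-time strips\<close>

abbreviation continuous_strip :: "real set \<Rightarrow> (real \<Rightarrow> real \<Rightarrow> real) \<Rightarrow> bool" where
  "continuous_strip J f \<equiv> continuous_on (J \<times> UNIV) (\<lambda>(t, x). f t x)"

lemma continuous_on_Icc_if_deriv:
  fixes h h' :: "real \<Rightarrow> real"
  assumes "\<And>s. s \<in> {0..\<tau>} \<Longrightarrow> (h has_real_derivative h' s) (at s within {0..})"
  shows "continuous_on {0..\<tau>} h"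
  unfolding continuous_on_eq_continuous_within
proof
  fix s assume s: "s \<in> {0..\<tau>}"
  show "continuous (at s within {0..\<tau>}) h"
    by (rule continuous_within_subset[OF DERIV_continuous[OF assms[OF s]]]) auto
qed

text \<open>The equivalence of integrability is stated besides the values because it later decides
  whether the momentum of the constructed solution is integrable.\<close>

lemma change_of_variables_UNIV:
  fixes X G f :: "real \<Rightarrow> real"
  assumes d: "\<And>a. (X has_real_derivative G a) (at a)"
    and pos: "\<And>a. 0 < G a" and G: "continuous_on UNIV G" and sur: "surj X"
    and f[measurable]: "f \<in> borel_measurable borel"
  shows "integrable lborel (\<lambda>a. f (X a) * G a) \<longleftrightarrow> integrable lborel f"
    and "integral\<^sup>L lborel (\<lambda>a. f (X a) * G a) = integral\<^sup>L lborel f"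
proof -
  have cX: "continuous_on UNIV X"
    using d by (auto simp: continuous_on_eq_continuous_at intro: DERIV_isCont)
  have [measurable]: "X \<in> borel_measurable borel" "G \<in> borel_measurable borel"
    using cX G by (auto intro: borel_measurable_continuous_onI)
  have "strict_mono X"
    by (rule strict_monoI, rule DERIV_pos_imp_increasing) (use d pos in blast)+
  then have inj: "inj X" by (rule strict_mono_imp_inj_on)
  have ab: "\<bar>G a\<bar> * f (X a) = f (X a) * G a" for a using pos[of a] by simp
  have eqv: "(\<lambda>a. f (X a) * G a) absolutely_integrable_on UNIV \<and> integral UNIV (\<lambda>a. f (X a) * G a) = b
    \<longleftrightarrow> f absolutely_integrable_on UNIV \<and> integral UNIV f = b" for b
    using has_absolute_integral_change_of_variables_1'[of UNIV X G f b] d inj sur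
    by (simp add: ab)
  have ai: "h absolutely_integrable_on UNIV \<longleftrightarrow> integrable lborel h"
    if [measurable]: "h \<in> borel_measurable borel" for h :: "real \<Rightarrow> real"
    by (simp add: set_integrable_def integrable_completion)
  have ii: "integral UNIV h = integral\<^sup>L lborel h" if "integrable lborel h" for h :: "real \<Rightarrow> real"
    by (rule integral_lborel[OF that])
  have m: "(\<lambda>a. f (X a) * G a) \<in> borel_measurable borel" by measurable
  show *: "integrable lborel (\<lambda>a. f (X a) * G a) \<longleftrightarrow> integrable lborel f"
    using eqv ai[OF m] ai[OF f] by blast
  show "integral\<^sup>L lborel (\<lambda>a. f (X a) * G a) = integral\<^sup>L lborel f"
  proof (cases "integrable lborel f")
    case True
    then show ?thesis using eqv ai[OF m] ai[OF f] * ii by metis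
  next
    \<comment> \<open>Both integrals then have the default value 0.\<close>
    case False
    then show ?thesis using * by (simp add: not_integrable_integral_eq)
  qed
qed

text \<open>The mean value inequality bounds every difference quotient by \<open>g\<close>, so
  dominated convergence applies along sequences. The convex set \<open>S\<close> admits the
  one-sided derivative at time 0.\<close>

lemma DERIV_integral_dominated:
  fixes f f' :: "real \<Rightarrow> 'a \<Rightarrow> real"
  assumes t: "t \<in> S" and S: "convex S"
    and int: "\<And>s. s \<in> S \<Longrightarrow> integrable M (f s)"
    and d: "\<And>s x. s \<in> S \<Longrightarrow> x \<in> space M \<Longrightarrow> ((\<lambda>s. f s x) has_real_derivative f' s x) (at s within S)"
    and meas: "f' t \<in> borel_measurable M"
    and b: "\<And>s x. s \<in> S \<Longrightarrow> x \<in> space M \<Longrightarrow> \<bar>f' s x\<bar> \<le> g x" and g: "integrable M g"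
  shows "((\<lambda>s. integral\<^sup>L M (f s)) has_real_derivative integral\<^sup>L M (f' t)) (at t within S)"
  unfolding has_field_derivative_iff tendsto_at_iff_sequentially comp_def
proof (intro allI impI)
  fix X assume X: "\<forall>i::nat. X i \<in> S - {t}" and lim: "X \<longlonglongrightarrow> t"
  have XS: "X i \<in> S" "X i \<noteq> t" for i using X by auto
  have "(\<lambda>i. integral\<^sup>L M (\<lambda>x. (f (X i) x - f t x) / (X i - t))) \<longlonglongrightarrow> integral\<^sup>L M (f' t)"
  proof (rule integral_dominated_convergence[OF meas _ g])
    show "(\<lambda>x. (f (X i) x - f t x) / (X i - t)) \<in> borel_measurable M" for i
      using int[OF XS(1)] int[OF t] by measurable
    show "AE x in M. (\<lambda>i. (f (X i) x - f t x) / (X i - t)) \<longlonglongrightarrow> f' t x"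
      using d[OF t] lim X
      by (auto simp: has_field_derivative_iff tendsto_at_iff_sequentially comp_def)
    show "AE x in M. norm ((f (X i) x - f t x) / (X i - t)) \<le> g x" for i
    proof (rule AE_I2)
      fix x assume x: "x \<in> space M"
      have "norm (f (X i) x - f t x) \<le> g x * norm (X i - t)"
        by (rule field_differentiable_bound[OF S d[OF _ x] _ XS(1) t]) (use b x in auto)
      then show "norm ((f (X i) x - f t x) / (X i - t)) \<le> g x"
        using XS(2)[of i] by (simp add: norm_divide divide_simps)
    qed
  qed
  moreover have "integral\<^sup>L M (\<lambda>x. (f (X i) x - f t x) / (X i - t)) =
      (integral\<^sup>L M (f (X i)) - integral\<^sup>L M (f t)) / (X i - t)" for i
    using int[OF XS(1)] int[OF t] by (simp only: integral_divide_zero Bochner_Integration.integral_diff)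
  ultimately show "(\<lambda>i. (integral\<^sup>L M (f (X i)) - integral\<^sup>L M (f t)) / (X i - t)) \<longlonglongrightarrow> integral\<^sup>L M (f' t)"
    by (simp only:)
qed

text \<open>A jointly continuous space derivative together with a time derivative at the single
  point \<open>(t, x)\<close> already gives total differentiability; this is why the chain rule
  along a curve asks for no continuity of the time derivative.\<close>

lemma has_derivative_slab:
  fixes H Hx :: "real \<Rightarrow> real \<Rightarrow> real"
  assumes Ht: "((\<lambda>s. H s x) has_real_derivative Ht) (at t within S)" and t: "t \<in> S"
    and Hx: "\<And>s y. s \<in> S \<Longrightarrow> (H s has_real_derivative Hx s y) (at y)"
    and cont: "continuous_strip S Hx"
  shows "((\<lambda>(s, y). H s y) has_derivative (\<lambda>(h, l). Ht * h + Hx t x * l)) (at (t, x) within S \<times> UNIV)"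
proof -
  have "((\<lambda>(s, y). H s y) has_derivative (\<lambda>(h, l). Ht * h + blinfun_mult_right (Hx t x) l))
    (at (t, x) within S \<times> UNIV)"
  proof (rule has_derivative_partialsI)
    show "((\<lambda>s. H s x) has_derivative (*) Ht) (at t within S)"
      using Ht by (simp add: has_field_derivative_def)
    show "(H s has_derivative blinfun_apply (blinfun_mult_right (Hx s y))) (at y within UNIV)" if "s \<in> S" for s y
    proof -
      have "blinfun_apply (blinfun_mult_right (Hx s y)) = (*) (Hx s y)" by auto
      then show ?thesis using Hx[OF that] by (simp add: has_field_derivative_def)
    qed
    show "continuous (at (t, x) within S \<times> UNIV) (\<lambda>(s, y). blinfun_mult_right (Hx s y))"
    proof -
      have "continuous_on (S \<times> UNIV) (\<lambda>z. blinfun_mult_right (case z of (s, y) \<Rightarrow> Hx s y))"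
        by (intro bounded_linear.continuous_on[OF bounded_linear_blinfun_mult_right] cont)
      then show ?thesis using t by (simp add: continuous_on_eq_continuous_within split_beta')
    qed
  qed auto
  then show ?thesis by simp
qed

lemma C1_slab_continuous:
  assumes "C1_slab T f"
  shows "continuous_strip (time_dom T) f"
proof -
  obtain ft fx where c: "continuous_strip (time_dom T) fx"
    and d: "\<And>t x. t \<in> time_dom T \<Longrightarrow> ((\<lambda>s. f s x) has_real_derivative ft t x) (at t within time_dom T)"
    "\<And>t x. t \<in> time_dom T \<Longrightarrow> (f t has_real_derivative fx t x) (at x)"
    using assms unfolding C1_slab_def by blast
  show ?thesis
    unfolding continuous_on_eq_continuous_within
    using has_derivative_slab[OF d(1) _ d(2) c] has_derivative_continuous by fast
qed

lemma DERIV_along_curve: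
  fixes H Hx :: "real \<Rightarrow> real \<Rightarrow> real"
  assumes Ht: "((\<lambda>s. H s (A t)) has_real_derivative Ht) (at t within S)" and t: "t \<in> S"
    and Hx: "\<And>s y. s \<in> S \<Longrightarrow> (H s has_real_derivative Hx s y) (at y)"
    and cont: "continuous_strip S Hx"
    and A: "(A has_real_derivative A') (at t within S)"
  shows "((\<lambda>s. H s (A s)) has_real_derivative Ht + Hx t (A t) * A') (at t within S)"
proof -
  note H = has_derivative_slab[OF Ht t Hx cont]
  have "((\<lambda>s. (s, A s)) has_derivative (\<lambda>h. (h, A' * h))) (at t within S)"
    using A by (intro has_derivative_Pair has_derivative_ident) (simp add: has_field_derivative_def)
  from has_derivative_in_compose[OF this has_derivative_subset[OF H]]
  have "((\<lambda>s. H s (A s)) has_derivative (\<lambda>h. Ht * h + Hx t (A t) * (A' * h))) (at t within S)"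
    by (auto simp: image_subset_iff)
  moreover have "(\<lambda>h. Ht * h + Hx t (A t) * (A' * h)) = (*) (Ht + Hx t (A t) * A')"
    by (simp add: fun_eq_iff algebra_simps)
  ultimately show ?thesis by (simp add: has_field_derivative_def)
qed

section \<open>Derivatives of flows and of their inverses\<close>

lemma surj_if_deriv_ge:
  fixes X G :: "real \<Rightarrow> real"
  assumes d: "\<And>a. (X has_real_derivative G a) (at a)" and G: "\<And>a. c \<le> G a" and c: "0 < c"
  shows "surj X"
proof -
  have grow: "c * (b - a) \<le> X b - X a" if ab: "a < b" for a b
  proof -
    obtain z where "X b - X a = (b - a) * G z" using MVT2[OF ab, of X G] d by blast
    then show ?thesis using G[of z] ab by (simp add: mult.commute mult_right_mono)
  qed
  have "\<exists>x. X x = y" for y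
  proof -
    define r where "r = \<bar>y - X 0\<bar> / c + 1"
    have r: "0 < r" "\<bar>y - X 0\<bar> \<le> c * r" using c by (auto simp: r_def field_simps add_pos_nonneg intro: add_nonneg_pos)
    have "X (- r) \<le> y" "y \<le> X r" using grow[of 0 r] grow[of "-r" 0] r by auto
    moreover have "isCont X x" for x using d DERIV_isCont by blast
    ultimately show ?thesis using IVT[of X "-r" y r] r by auto
  qed
  then show ?thesis by (metis surjI surj_def)
qed

text \<open>Uniform continuity of \<open>f'\<close> on a strip wider by 1 than \<open>R\<close>,
  with the mean value inequality applied to \<open>f s z - f' s y * z\<close>; hence the choice
  \<open>\<delta> \<le> 1\<close>. The remainder is uniform along a whole trajectory, as Gronwall's
  inequality requires.\<close>

lemma remainder_uniform:
  fixes f f' :: "real \<Rightarrow> real \<Rightarrow> real"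
  assumes f: "\<And>s y. s \<in> {0..\<tau>} \<Longrightarrow> (f s has_real_derivative f' s y) (at y)"
    and c: "continuous_strip {0..\<tau>} f'" and e: "0 < \<epsilon>"
  shows "\<exists>\<delta>>0. \<forall>s\<in>{0..\<tau>}. \<forall>y z. \<bar>y\<bar> \<le> R \<longrightarrow> \<bar>z - y\<bar> < \<delta> \<longrightarrow>
    \<bar>f s z - f s y - f' s y * (z - y)\<bar> \<le> \<epsilon> * \<bar>z - y\<bar>"
proof -
  have "uniformly_continuous_on ({0..\<tau>} \<times> {-R-1..R+1}) (\<lambda>(s, y). f' s y)"
    by (intro compact_uniformly_continuous continuous_on_subset[OF c] compact_Times) auto
  then obtain d where d: "d > 0"
    "\<And>p q. p \<in> {0..\<tau>} \<times> {-R-1..R+1} \<Longrightarrow> q \<in> {0..\<tau>} \<times> {-R-1..R+1} \<Longrightarrow> dist q p < d \<Longrightarrow>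
       dist ((\<lambda>(s, y). f' s y) q) ((\<lambda>(s, y). f' s y) p) < \<epsilon>"
    using e unfolding uniformly_continuous_on_def by metis
  show ?thesis
  proof (intro exI[of _ "min d 1"] conjI ballI allI impI)
    fix s y z assume s: "s \<in> {0..\<tau>}" and y: "\<bar>y\<bar> \<le> R" and z: "\<bar>z - y\<bar> < min d 1"
    define B where "B = ball y (min d 1)"
    have "norm ((\<lambda>z. f s z - f' s y * z) z - (\<lambda>z. f s z - f' s y * z) y) \<le> \<epsilon> * norm (z - y)"
    proof (rule field_differentiable_bound[of B _ "\<lambda>z. f' s z - f' s y"])
      show "convex B" "z \<in> B" "y \<in> B" using z d(1) by (auto simp: B_def dist_real_def)
      fix x assume x: "x \<in> B"
      show "((\<lambda>z. f s z - f' s y * z) has_real_derivative f' s x - f' s y) (at x within B)"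
        by (rule derivative_eq_intros has_field_derivative_at_within[OF f[OF s]] refl | simp)+
      show "norm (f' s x - f' s y) \<le> \<epsilon>"
      proof -
        have "y \<in> {-R-1..R+1}" "x \<in> {-R-1..R+1}" "\<bar>x - y\<bar> < d"
          using x y unfolding B_def mem_ball dist_real_def min_less_iff_conj atLeastAtMost_iff by linarith+
        then show ?thesis
          using d(2)[of "(s, y)" "(s, x)"] s by (auto simp: dist_real_def dist_Pair_Pair)
      qed
    qed
    then show "\<bar>f s z - f s y - f' s y * (z - y)\<bar> \<le> \<epsilon> * \<bar>z - y\<bar>"
      by (simp add: algebra_simps)
  qed (use d in auto)
qed

text \<open>The label enters twice, directly in \<open>p\<close> and through the position in
  \<open>n\<close>; this is the form taken by the alignment flow. One Gronwall estimate makes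
  \<open>x\<close> Lipschitz in the label, a second one, for
  \<open>x s b - x s a - (b - a) * g s\<close>, leaves an error of order
  \<open>\<epsilon> * \<bar>b - a\<bar>\<close>. The candidate \<open>g\<close> is given beforehand
  as the solution of the linearised equation.\<close>

lemma flow_space_deriv:
  fixes x p p' n n' :: "real \<Rightarrow> real \<Rightarrow> real" and g :: "real \<Rightarrow> real"
  assumes x: "\<And>s a. s \<in> {0..\<tau>} \<Longrightarrow> ((\<lambda>s. x s a) has_real_derivative p s a + n s (x s a)) (at s within {0..})"
    and x0: "\<And>a. x 0 a = a"
    and p: "\<And>s a. s \<in> {0..\<tau>} \<Longrightarrow> (p s has_real_derivative p' s a) (at a)"
    and n: "\<And>s y. s \<in> {0..\<tau>} \<Longrightarrow> (n s has_real_derivative n' s y) (at y)"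
    and cp: "continuous_strip {0..\<tau>} p'"
    and cn: "continuous_strip {0..\<tau>} n'"
    and nb: "\<And>s y. s \<in> {0..\<tau>} \<Longrightarrow> \<bar>n' s y\<bar> \<le> C"
    and g: "\<And>s. s \<in> {0..\<tau>} \<Longrightarrow> (g has_real_derivative p' s a + n' s (x s a) * g s) (at s within {0..})"
    and g0: "g 0 = 1" and t: "0 \<le> t" "t \<le> \<tau>"
  shows "(x t has_real_derivative g t) (at a)"
proof -
  have C: "0 \<le> C" using nb[of 0 0] t by auto
  define E where "E = exp ((C+1)*(\<tau>+1))"
  have E: "0 < E" by (simp add: E_def)
  have nlip: "\<bar>n s y - n s z\<bar> \<le> C * \<bar>y - z\<bar>" if "s \<in> {0..\<tau>}" for s y z
    using field_differentiable_bound[of UNIV "n s" "n' s" C y z] n nb that by auto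
  have "compact ({0..\<tau>} \<times> {a-1..a+1})" by (intro compact_Times) auto
  then have "bounded ((\<lambda>(s, a). p' s a) ` ({0..\<tau>} \<times> {a-1..a+1}))"
    by (intro compact_imp_bounded compact_continuous_image continuous_on_subset[OF cp]) auto
  then obtain P0 where P0': "0 < P0" "\<forall>v\<in>(\<lambda>(s, a). p' s a) ` ({0..\<tau>} \<times> {a-1..a+1}). norm v \<le> P0"
    unfolding bounded_pos by blast
  have P0: "\<bar>p' s b\<bar> \<le> P0" "0 < P0" if "s \<in> {0..\<tau>}" "b \<in> {a-1..a+1}" for s b
  proof -
    have "(\<lambda>(s, a). p' s a) (s, b) \<in> (\<lambda>(s, a). p' s a) ` ({0..\<tau>} \<times> {a-1..a+1})"
      using that by (intro imageI) auto
    then show "\<bar>p' s b\<bar> \<le> P0" "0 < P0" using P0' by auto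
  qed
  define K where "K = (1 + P0) * E"
  have K: "0 < K" using P0'(1) E by (simp add: K_def)
  have xlip: "\<bar>x s b - x s a\<bar> \<le> K * \<bar>b - a\<bar>" if s: "s \<in> {0..\<tau>}" and b: "b \<in> {a-1..a+1}" for s b
  proof -
    have "\<bar>x s b - x s a\<bar> \<le> (\<bar>x 0 b - x 0 a\<bar> + P0 * \<bar>b - a\<bar>) * exp ((C+1)*(\<tau>+1))"
    proof (rule gronwall_abs[where y="\<lambda>s. x s b - x s a"])
      fix r assume r: "r \<in> {0..\<tau>}"
      show "((\<lambda>s. x s b - x s a) has_real_derivative p r b + n r (x r b) - (p r a + n r (x r a))) (at r within {0..})"
        by (intro DERIV_diff x r)
    next
      fix r assume "0 < r" "r < \<tau>"
      then have r: "r \<in> {0..\<tau>}" by auto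
      have "\<bar>p r b - p r a\<bar> \<le> P0 * \<bar>b - a\<bar>"
        using field_differentiable_bound[of "{a-1..a+1}" "p r" "p' r" P0 b a] has_field_derivative_at_within[OF p[OF r]] P0(1)[OF r] b by auto
      with nlip[OF r, of "x r b" "x r a"]
      show "\<bar>p r b + n r (x r b) - (p r a + n r (x r a))\<bar> \<le> C * \<bar>x r b - x r a\<bar> + P0 * \<bar>b - a\<bar>" by linarith
    qed (use C s P0' in auto)
    then show ?thesis by (simp add: x0 K_def E_def algebra_simps)
  qed
  have "continuous_on {0..\<tau>} (\<lambda>s. x s a)"
    by (rule continuous_on_Icc_if_deriv[OF x])
  then have "bounded ((\<lambda>s. x s a) ` {0..\<tau>})" by (intro compact_imp_bounded compact_continuous_image) auto
  then obtain R0 where R0: "\<And>s. s \<in> {0..\<tau>} \<Longrightarrow> \<bar>x s a\<bar> \<le> R0" unfolding bounded_iff by fastforce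
  define R where "R = max R0 \<bar>a\<bar>"
  show ?thesis
    unfolding has_field_derivative_iff LIM_def
  proof (intro allI impI)
    fix e :: real assume e: "0 < e"
    \<comment> \<open>Chosen so that the second Gronwall bound
      \<open>\<epsilon> * (1 + K) * E * \<bar>b - a\<bar>\<close> is half of
      \<open>e * \<bar>b - a\<bar>\<close>.\<close>
    define \<epsilon> where "\<epsilon> = e / (2 * (1 + K) * E)"
    have \<epsilon>: "0 < \<epsilon>" using e K E by (simp add: \<epsilon>_def)
    obtain d1 where d1: "d1 > 0" "\<And>s y z. s \<in> {0..\<tau>} \<Longrightarrow> \<bar>y\<bar> \<le> R \<Longrightarrow> \<bar>z - y\<bar> < d1 \<Longrightarrow>
      \<bar>p s z - p s y - p' s y * (z - y)\<bar> \<le> \<epsilon> * \<bar>z - y\<bar>"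
      using remainder_uniform[where f=p and f'=p' and R=R, OF p cp \<epsilon>] by blast
    obtain d2 where d2: "d2 > 0" "\<And>s y z. s \<in> {0..\<tau>} \<Longrightarrow> \<bar>y\<bar> \<le> R \<Longrightarrow> \<bar>z - y\<bar> < d2 \<Longrightarrow>
      \<bar>n s z - n s y - n' s y * (z - y)\<bar> \<le> \<epsilon> * \<bar>z - y\<bar>"
      using remainder_uniform[where f=n and f'=n' and R=R, OF n cn \<epsilon>] by blast
    define d where "d = min 1 (min d1 (d2 / K))"
    have "\<bar>(x t b - x t a) / (b - a) - g t\<bar> < e" if b: "b \<noteq> a" "\<bar>b - a\<bar> < d" for b
    proof -
      have b1: "b \<in> {a-1..a+1}" "\<bar>b - a\<bar> < d1" "K * \<bar>b - a\<bar> < d2"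
        using b K by (auto simp: d_def field_simps)
      have "\<bar>x t b - x t a - (b - a) * g t\<bar> \<le> (\<bar>x 0 b - x 0 a - (b - a) * g 0\<bar> + \<epsilon> * (1 + K) * \<bar>b - a\<bar>) * exp ((C+1)*(\<tau>+1))"
      proof (rule gronwall_abs[where y="\<lambda>s. x s b - x s a - (b - a) * g s"])
        fix r assume r: "r \<in> {0..\<tau>}"
        show "((\<lambda>s. x s b - x s a - (b - a) * g s) has_real_derivative
          p r b + n r (x r b) - (p r a + n r (x r a)) - (b - a) * (p' r a + n' r (x r a) * g r)) (at r within {0..})"
          by (intro DERIV_diff x r DERIV_cmult g)
      next
        fix r assume "0 < r" "r < \<tau>"
        then have r: "r \<in> {0..\<tau>}" by auto
        have 1: "\<bar>p r b - p r a - p' r a * (b - a)\<bar> \<le> \<epsilon> * \<bar>b - a\<bar>"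
          using d1(2)[OF r, of a b] b1 by (simp add: R_def)
        have xl: "\<bar>x r b - x r a\<bar> \<le> K * \<bar>b - a\<bar>" by (rule xlip[OF r b1(1)])
        then have "\<bar>n r (x r b) - n r (x r a) - n' r (x r a) * (x r b - x r a)\<bar> \<le> \<epsilon> * \<bar>x r b - x r a\<bar>"
          using d2(2)[OF r, of "x r a" "x r b"] R0[OF r] b1 by (simp add: R_def)
        also have "\<dots> \<le> \<epsilon> * (K * \<bar>b - a\<bar>)" using xl \<epsilon> by (intro mult_left_mono) auto
        finally have 2: "\<bar>n r (x r b) - n r (x r a) - n' r (x r a) * (x r b - x r a)\<bar> \<le> \<epsilon> * (K * \<bar>b - a\<bar>)" .
        have 3: "\<bar>n' r (x r a) * (x r b - x r a - (b - a) * g r)\<bar> \<le> C * \<bar>x r b - x r a - (b - a) * g r\<bar>"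
          using nb[OF r] by (simp add: abs_mult mult_right_mono)
        have "p r b + n r (x r b) - (p r a + n r (x r a)) - (b - a) * (p' r a + n' r (x r a) * g r)
          = (p r b - p r a - p' r a * (b - a)) + (n r (x r b) - n r (x r a) - n' r (x r a) * (x r b - x r a))
            + n' r (x r a) * (x r b - x r a - (b - a) * g r)" by (simp add: algebra_simps)
        with 1 2 3
        have "\<bar>p r b + n r (x r b) - (p r a + n r (x r a)) - (b - a) * (p' r a + n' r (x r a) * g r)\<bar>
          \<le> C * \<bar>x r b - x r a - (b - a) * g r\<bar> + (\<epsilon> * \<bar>b - a\<bar> + \<epsilon> * (K * \<bar>b - a\<bar>))" by linarith
        then show "\<bar>p r b + n r (x r b) - (p r a + n r (x r a)) - (b - a) * (p' r a + n' r (x r a) * g r)\<bar>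
          \<le> C * \<bar>x r b - x r a - (b - a) * g r\<bar> + \<epsilon> * (1 + K) * \<bar>b - a\<bar>" by (simp add: algebra_simps)
      qed (use C t \<epsilon> K in auto)
      then have "\<bar>x t b - x t a - (b - a) * g t\<bar> \<le> \<epsilon> * (1 + K) * E * \<bar>b - a\<bar>"
        by (simp add: x0 g0 E_def mult_ac)
      also have "\<epsilon> * (1 + K) * E = e / 2"
      proof -
        have "1 + K \<noteq> 0" "E \<noteq> 0" using K E by auto
        then show ?thesis unfolding \<epsilon>_def by (simp add: divide_simps)
      qed
      finally have "\<bar>x t b - x t a - (b - a) * g t\<bar> \<le> e / 2 * \<bar>b - a\<bar>" .
      moreover have "(x t b - x t a) / (b - a) - g t = (x t b - x t a - (b - a) * g t) / (b - a)"
        using b by (simp add: field_simps)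
      ultimately have "\<bar>(x t b - x t a) / (b - a) - g t\<bar> \<le> e / 2"
        using b by (simp add: abs_divide pos_divide_le_eq del: divide_divide_eq_left)
      then show ?thesis using e by linarith
    qed
    moreover have "0 < d" using d1 d2 K by (simp add: d_def)
    ultimately show "\<exists>s>0. \<forall>b. b \<noteq> a \<and> dist b a < s \<longrightarrow> dist ((x t b - x t a) / (b - a)) (g t) < e"
      unfolding dist_real_def by blast
  qed
qed

text \<open>Monotonicity traps the inverse: with \<open>a = A t x\<close>, the condition
  \<open>X t (a - e) < x < X t (a + e)\<close> is open in \<open>(t, x)\<close>, so it persists
  nearby and confines \<open>A\<close> to the interval of radius \<open>e\<close> around
  \<open>a\<close>.\<close>

lemma inverse_jointly_continuous:
  fixes X A :: "real \<Rightarrow> real \<Rightarrow> real"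
  assumes c: "continuous_strip S X"
    and m: "\<And>s. s \<in> S \<Longrightarrow> strict_mono (X s)"
    and A: "\<And>s x. s \<in> S \<Longrightarrow> X s (A s x) = x"
  shows "continuous_strip S A"
  unfolding continuous_on_eq_continuous_within continuous_within
proof (clarsimp, rule tendstoI, goal_cases)
  case (1 t x e)
  let ?F = "at (t, x) within S \<times> UNIV"
  have cs: "((\<lambda>z. X (fst z) b) \<longlongrightarrow> X t b) ?F" for b
  proof -
    have "continuous_on (S \<times> UNIV) (\<lambda>z. X (fst z) b)"
      by (rule continuous_on_compose2[OF c, of _ "\<lambda>z. (fst z, b)", simplified]) (auto intro!: continuous_intros)
    then show ?thesis using 1 by (auto simp: continuous_on_def)
  qed
  have ss: "(snd \<longlongrightarrow> x) ?F" by (rule tendsto_eq_intros | simp)+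
  let ?a = "A t x"
  have "X t (?a - e) < x" "x < X t (?a + e)"
    using m[OF 1(1)] A[OF 1(1), of x] 1 by (metis strict_mono_less diff_less_eq less_add_same_cancel1)+
  then have "eventually (\<lambda>z. X (fst z) (?a - e) - snd z < 0) ?F" "eventually (\<lambda>z. 0 < X (fst z) (?a + e) - snd z) ?F"
    using order_tendstoD(2)[OF tendsto_diff[OF cs ss], of "?a - e" 0] order_tendstoD(1)[OF tendsto_diff[OF cs ss], of 0 "?a + e"] by auto
  moreover have "eventually (\<lambda>z. z \<in> S \<times> UNIV) ?F" by (simp add: eventually_at_filter)
  ultimately show ?case
  proof eventually_elim
    case (elim z)
    obtain s y where z: "z = (s, y)" "s \<in> S" using elim by (cases z) auto
    have "X s (?a - e) < X s (A s y)" "X s (A s y) < X s (?a + e)" using elim A[OF z(2)] z by auto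
    then have "?a - e < A s y" "A s y < ?a + e" using m[OF z(2)] by (auto simp: strict_mono_less)
    then show ?case by (auto simp: z dist_real_def)
  qed
qed

text \<open>Since \<open>X s (A s)\<close> stays equal to \<open>x\<close>, the increment of
  \<open>X\<close> in time at the fixed label \<open>A t\<close> is balanced by
  \<open>G s (z s) * (A s - A t)\<close> with an intermediate label \<open>z s\<close>. Dividing by
  \<open>s - t\<close> and passing to the limit gives the implicit function formula.\<close>

lemma inverse_time_deriv:
  fixes X G :: "real \<Rightarrow> real \<Rightarrow> real" and A :: "real \<Rightarrow> real"
  assumes X: "\<And>s a. s \<in> S \<Longrightarrow> (X s has_real_derivative G s a) (at a)"
    and c: "continuous_strip S G"
    and V: "((\<lambda>s. X s (A t)) has_real_derivative V) (at t within S)"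
    and A: "\<And>s. s \<in> S \<Longrightarrow> X s (A s) = x" and cA: "continuous (at t within S) A"
    and t: "t \<in> S" and G: "G t (A t) \<noteq> 0"
  shows "(A has_real_derivative - V / G t (A t)) (at t within S)"
proof -
  have "\<exists>z. \<bar>z - A t\<bar> \<le> \<bar>A s - A t\<bar> \<and> X s (A s) - X s (A t) = G s z * (A s - A t)" if s: "s \<in> S" for s
  proof (cases "A s" "A t" rule: linorder_cases)
    case less
    from MVT2[OF less, of "X s" "G s"] X[OF s] obtain z where "A s < z" "z < A t" "X s (A t) - X s (A s) = (A t - A s) * G s z" by blast
    then show ?thesis by (intro exI[of _ z]) (auto simp: algebra_simps)
  next
    case greater
    from MVT2[OF greater, of "X s" "G s"] X[OF s] obtain z where "A t < z" "z < A s" "X s (A s) - X s (A t) = (A s - A t) * G s z" by blast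
    then show ?thesis by (intro exI[of _ z]) (auto simp: algebra_simps)
  qed auto
  then obtain z where z: "\<And>s. s \<in> S \<Longrightarrow> \<bar>z s - A t\<bar> \<le> \<bar>A s - A t\<bar>"
    "\<And>s. s \<in> S \<Longrightarrow> X s (A s) - X s (A t) = G s (z s) * (A s - A t)" by metis
  let ?F = "at t within S"
  have ev: "eventually (\<lambda>s. s \<in> S \<and> s \<noteq> t) ?F" by (simp add: eventually_at_filter)
  have evS: "eventually (\<lambda>s. s \<in> S) ?F" using ev by eventually_elim simp
  have Alim: "(A \<longlongrightarrow> A t) ?F" using cA by (simp add: continuous_within)
  have "((\<lambda>s. \<bar>A s - A t\<bar>) \<longlongrightarrow> 0) ?F"
    using tendsto_rabs[OF tendsto_diff[OF Alim tendsto_const[of "A t"]]] by simp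
  then have "((\<lambda>s. z s - A t) \<longlongrightarrow> 0) ?F"
    by (rule Lim_null_comparison[rotated]) (use evS in eventually_elim, use z(1) in auto)
  then have zlim: "(z \<longlongrightarrow> A t) ?F" by (simp add: LIM_zero_iff)
  have "((\<lambda>s. (\<lambda>(s, a). G s a) (s, z s)) \<longlongrightarrow> (\<lambda>(s, a). G s a) (t, A t)) ?F"
  proof (rule continuous_on_tendsto_compose[OF c])
    show "((\<lambda>s. (s, z s)) \<longlongrightarrow> (t, A t)) ?F"
      by (intro tendsto_Pair tendsto_ident_at zlim)
    show "(t, A t) \<in> S \<times> UNIV" using t by simp
    show "\<forall>\<^sub>F s in ?F. (s, z s) \<in> S \<times> UNIV" using evS by eventually_elim simp
  qed
  then have Glim: "((\<lambda>s. G s (z s)) \<longlongrightarrow> G t (A t)) ?F" by simp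
  have "((\<lambda>s. - ((X s (A t) - X t (A t)) / (s - t)) / G s (z s)) \<longlongrightarrow> - V / G t (A t)) ?F"
    using V Glim G unfolding has_field_derivative_iff by (intro tendsto_intros)
  moreover have "eventually (\<lambda>s. - ((X s (A t) - X t (A t)) / (s - t)) / G s (z s) = (A s - A t) / (s - t)) ?F"
    using ev tendsto_imp_eventually_ne[OF Glim G]
  proof eventually_elim
    case (elim s)
    have "X s (A t) - X t (A t) = - (G s (z s) * (A s - A t))" using z(2)[of s] elim A[of s] A[OF t] by auto
    then show ?case using elim by simp
  qed
  ultimately show ?thesis
    unfolding has_field_derivative_iff by (rule Lim_transform_eventually)
qed

section \<open>Products with a weight that may vanish\<close>

lemma DERIV_mult_zero:
  fixes F g :: "real \<Rightarrow> real"
  assumes "(F has_real_derivative d) (at a)" "F a = 0" "isCont g a"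
  shows "((\<lambda>x. F x * g x) has_real_derivative d * g a) (at a)"
proof -
  have "((\<lambda>x. (F x - F a) / (x - a) * g x) \<longlongrightarrow> d * g a) (at a)"
    using assms by (intro tendsto_mult) (auto simp: has_field_derivative_iff isCont_def)
  then show ?thesis using assms by (simp add: has_field_derivative_iff)
qed

text \<open>
  Zeros of the weight cause no loss: if \<open>r a = 0\<close>, then \<open>r f\<close> with \<open>f\<close> merely continuous has the
  derivative \<open>r' a * f a\<close> at \<open>a\<close>, which agrees with the formulas below. So the functions \<open>f\<close> for
  which \<open>r f\<close> is \<open>C\<^sup>1\<close> form an algebra closed under inversion, although \<open>f\<close> itself need not be
  differentiable where \<open>r\<close> vanishes.
\<close>

lemma weighted_deriv_cancel:
  fixes r f :: "real \<Rightarrow> real"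
  assumes r: "(r has_real_derivative r') (at a)" and f: "((\<lambda>x. r x * f x) has_real_derivative f') (at a)"
    and nz: "r a \<noteq> 0"
  shows "(f has_real_derivative (f' - r' * f a) / r a) (at a)"
proof -
  have "(r \<longlongrightarrow> r a) (nhds a)"
    using DERIV_isCont[OF r] by (simp add: isCont_def tendsto_at_iff_tendsto_nhds)
  then have "eventually (\<lambda>x. r x \<noteq> 0) (nhds a)"
    by (rule tendsto_imp_eventually_ne) (rule nz)
  then have "eventually (\<lambda>x. r x * f x / r x = f x) (nhds a)" by eventually_elim auto
  moreover have "((\<lambda>x. r x * f x / r x) has_real_derivative (f' - r' * f a) / r a) (at a)"
  proof -
    have "(f' * r a - r a * f a * r') / (r a * r a) = (f' - r' * f a) / r a"
      using nz by (simp add: field_simps)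
    then show ?thesis using DERIV_divide[OF f r nz] by (simp only:)
  qed
  ultimately show ?thesis using DERIV_cong_ev[OF refl _ refl, of "\<lambda>x. r x * f x / r x" f a] by simp
qed

lemma weighted_deriv_mult:
  fixes r f g :: "real \<Rightarrow> real"
  assumes r: "(r has_real_derivative r') (at a)"
    and f: "((\<lambda>x. r x * f x) has_real_derivative f') (at a)"
    and g: "((\<lambda>x. r x * g x) has_real_derivative g') (at a)"
    and c: "isCont f a" "isCont g a"
  shows "((\<lambda>x. r x * (f x * g x)) has_real_derivative f' * g a + f a * g' - r' * f a * g a) (at a)"
proof (cases "r a = 0")
  case True
  have "((\<lambda>x. r x * g x) has_real_derivative r' * g a) (at a)" by (rule DERIV_mult_zero[OF r True c(2)])
  then have "g' = r' * g a" using g DERIV_unique by blast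
  moreover have "((\<lambda>x. r x * f x * g x) has_real_derivative f' * g a) (at a)"
    by (rule DERIV_mult_zero[OF f _ c(2)]) (simp add: True)
  ultimately show ?thesis by (simp add: mult_ac)
next
  case False
  have "f' * g a + (g' - r' * g a) / r a * (r a * f a) = f' * g a + f a * g' - r' * f a * g a"
    using False by (simp add: field_simps)
  moreover have "(\<lambda>x. r x * f x * g x) = (\<lambda>x. r x * (f x * g x))" by (simp add: mult.assoc)
  ultimately show ?thesis using DERIV_mult[OF f weighted_deriv_cancel[OF r g False]] by (simp only:)
qed

lemma weighted_deriv_inverse:
  fixes r f :: "real \<Rightarrow> real"
  assumes r: "(r has_real_derivative r') (at a)"
    and f: "((\<lambda>x. r x * f x) has_real_derivative f') (at a)"
    and c: "isCont f a" and nz: "f a \<noteq> 0"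
  shows "((\<lambda>x. r x * inverse (f x)) has_real_derivative 2 * r' / f a - f' / (f a)\<^sup>2) (at a)"
proof (cases "r a = 0")
  case True
  have "((\<lambda>x. r x * f x) has_real_derivative r' * f a) (at a)" by (rule DERIV_mult_zero[OF r True c])
  then have "f' = r' * f a" using f DERIV_unique by blast
  moreover have "((\<lambda>x. r x * inverse (f x)) has_real_derivative r' * inverse (f a)) (at a)"
    using c nz by (intro DERIV_mult_zero[OF r True]) (auto intro: continuous_intros)
  ultimately show ?thesis using nz by (simp add: field_simps power2_eq_square)
next
  case False
  have "((\<lambda>x. r x * inverse (f x)) has_real_derivative
      r' * inverse (f a) + - (inverse (f a) * ((f' - r' * f a) / r a) * inverse (f a)) * r a) (at a)"
    by (rule DERIV_mult[OF r DERIV_inverse'[OF weighted_deriv_cancel[OF r f False] nz]])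
  moreover have "r' * inverse (f a) + - (inverse (f a) * ((f' - r' * f a) / r a) * inverse (f a)) * r a
      = 2 * r' / f a - f' / (f a)\<^sup>2"
    using False nz by (simp add: field_simps power2_eq_square)
  ultimately show ?thesis by simp
qed

section \<open>Integrals with a parameter and joint continuity\<close>

lemma continuous_on_integral_upto:
  fixes f :: "real \<Rightarrow> real \<Rightarrow> real"
  assumes c: "continuous_strip S f"
    and S: "\<And>s. s \<in> S \<Longrightarrow> {0..s} \<subseteq> S" "S \<subseteq> {0..}"
  shows "continuous_on (S \<times> UNIV) (\<lambda>(t, a). integral {0..t} (\<lambda>s. f s a))"
proof -
  \<comment> \<open>Rescaling \<open>s = t * \<theta>\<close> fixes the domain of integration, so
    that \<open>t\<close> enters only through a jointly continuous integrand.\<close>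
  have "integral {0..t} (\<lambda>s. f s a) = t * integral {0..1} (\<lambda>\<theta>. f (t * \<theta>) a)" if tS: "t \<in> S" for t a
  proof (cases "t = 0")
    case False
    then have t: "0 < t" using that S(2) by force
    have "continuous_on {0..t} (\<lambda>s. f s a)"
      by (rule continuous_on_compose2[OF c, of _ "\<lambda>s. (s, a)", simplified])
        (use S(1)[OF tS] in \<open>auto intro!: continuous_intros\<close>)
    then have "((\<lambda>s. f s a) has_integral integral {0..t} (\<lambda>s. f s a)) {0..t}"
      by (intro integrable_integral integrable_continuous_interval)
    from has_integral_stretch_real[OF this False]
    have "((\<lambda>\<theta>. f (t * \<theta>) a) has_integral (1 / t) * integral {0..t} (\<lambda>s. f s a)) ((\<lambda>x. x / t) ` {0..t})"
      using t by simp
    moreover have "(\<lambda>x. x / t) ` {0..t} = {0..1}"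
      using t by (auto simp: image_iff field_simps intro!: bexI[of _ "t * _"])
    ultimately show ?thesis using t by (simp add: integral_unique field_simps)
  qed simp
  moreover have "continuous_on (S \<times> UNIV) (\<lambda>z. fst z * integral (cbox 0 1) (\<lambda>\<theta>. f (fst z * \<theta>) (snd z)))"
  proof (intro continuous_on_mult continuous_on_fst continuous_on_id integral_continuous_on_param)
    have "t * \<theta> \<in> S" if "t \<in> S" "0 \<le> \<theta>" "\<theta> \<le> 1" for t \<theta>
    proof -
      have "0 \<le> t" using that S(2) by auto
      then have "t * \<theta> \<in> {0..t}" using that mult_left_mono[of \<theta> 1 t] by auto
      then show ?thesis using S(1)[OF that(1)] by blast
    qed
    then have "continuous_on ((S \<times> UNIV) \<times> cbox 0 1) (\<lambda>y. f (fst (fst y) * snd y) (snd (fst y)))"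
      by (intro continuous_on_compose2[OF c, of _ "\<lambda>y. (fst (fst y) * snd y, snd (fst y))", simplified])
        (auto intro!: continuous_intros)
    then show "continuous_on ((S \<times> UNIV) \<times> cbox 0 1) (\<lambda>(z, \<theta>). f (fst z * \<theta>) (snd z))"
      by (simp add: case_prod_beta)
  qed
  ultimately show ?thesis
    by (subst continuous_on_cong[where g="\<lambda>z. fst z * integral (cbox 0 1) (\<lambda>\<theta>. f (fst z * \<theta>) (snd z))"]) auto
qed

lemma DERIV_integral_upto:
  fixes f fa :: "real \<Rightarrow> real \<Rightarrow> real"
  assumes d: "\<And>s a. s \<in> {0..t} \<Longrightarrow> (f s has_real_derivative fa s a) (at a)"
    and cf: "\<And>a. continuous_on {0..t} (\<lambda>s. f s a)"
    and c: "continuous_strip {0..t} fa"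
  shows "((\<lambda>a. integral {0..t} (\<lambda>s. f s a)) has_real_derivative integral {0..t} (\<lambda>s. fa s a)) (at a)"
proof -
  have "((\<lambda>a. integral (cbox 0 t) (\<lambda>s. f s a)) has_real_derivative integral (cbox 0 t) (\<lambda>s. fa s a)) (at a within UNIV)"
  proof (rule leibniz_rule_field_derivative)
    show "((\<lambda>x. f s x) has_real_derivative fa s x) (at x within UNIV)" if "s \<in> cbox 0 t" for x s
      using d that by simp
    show "(\<lambda>s. f s x) integrable_on cbox 0 t" for x
      using cf by (simp add: integrable_continuous_interval)
    have "continuous_on (UNIV \<times> {0..t}) (\<lambda>z. fa (snd z) (fst z))"
      by (rule continuous_on_compose2[OF c, of _ "\<lambda>z. (snd z, fst z)", simplified]) (auto intro!: continuous_intros)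
    then show "continuous_on (UNIV \<times> cbox 0 t) (\<lambda>(x, s). fa s x)" by (simp add: split_beta')
  qed auto
  then show ?thesis by simp
qed

lemma continuous_on_UNIV_if_deriv:
  fixes f :: "real \<Rightarrow> real"
  assumes "\<And>x. (f has_real_derivative f' x) (at x)"
  shows "continuous_on UNIV f"
  using assms by (meson DERIV_isCont continuous_at_imp_continuous_on)

lemma continuous_on_half_line_if_deriv:
  fixes h h' :: "real \<Rightarrow> real"
  assumes "\<And>t. 0 \<le> t \<Longrightarrow> (h has_real_derivative h' t) (at t within {0..})"
  shows "continuous_on {0..} h"
  using assms by (auto simp: continuous_on_eq_continuous_within intro: DERIV_continuous)

lemma integral_upto_deriv:
  fixes h :: "real \<Rightarrow> real"
  assumes "continuous_on {0..} h" "0 \<le> t"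
  shows "((\<lambda>t. integral {0..t} h) has_real_derivative h t) (at t within {0..})"
  using integral_half_line_deriv[OF assms] by (simp add: has_real_derivative_iff_has_vector_derivative)

lemma antiderivative_exists:
  fixes f :: "real \<Rightarrow> real"
  assumes "continuous_on UNIV f"
  shows "\<exists>h. \<forall>x. (h has_real_derivative f x) (at x)"
  using einterval_antiderivative[of "-\<infinity>" "\<infinity>" f] assms
  by (auto simp: continuous_on_eq_continuous_at has_real_derivative_iff_has_vector_derivative)

lemma primitive_lipschitz:
  fixes f g :: "real \<Rightarrow> real"
  assumes diff: "\<And>a b. a \<le> b \<Longrightarrow> f b - f a = (LINT y:{a..b}|lborel. g y)"
    and g: "\<And>x. \<bar>g x\<bar> \<le> B"
  shows "\<bar>f x - f y\<bar> \<le> B * \<bar>x - y\<bar>"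
proof -
  have B: "0 \<le> B" using g[of 0] by simp
  have *: "\<bar>f b - f a\<bar> \<le> B * \<bar>b - a\<bar>" if "a \<le> b" for a b
  proof -
    have "\<bar>LINT y:{a..b}|lborel. g y\<bar> \<le> (LINT y:{a..b}|lborel. B)"
      unfolding set_lebesgue_integral_def
    proof (rule order_trans[OF integral_abs_bound integral_mono'])
      show "integrable lborel (\<lambda>y. indicator {a..b} y *\<^sub>R B)"
        by (intro integrable_scaleR_left integrable_real_indicator) (auto simp: emeasure_lborel_Icc_eq)
    qed (use g B in \<open>auto simp: indicator_def\<close>)
    moreover have "(LINT y:{a..b}|lborel. B) = B * (b - a)"
      using that by (simp add: set_lebesgue_integral_def)
    ultimately show ?thesis using that by (simp add: diff)
  qed
  show ?thesis using *[of x y] *[of y x] by (cases "x \<le> y") (auto simp: abs_minus_commute)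
qed

text \<open>\<open>sgn (b - y) - sgn (a - y)\<close> is twice the indicator of \<open>{a..b}\<close>
  except at the two end points, a null set, so the increments of the integral are
  \<open>2 * integral {a..b} r\<close>.\<close>

lemma DERIV_sgn_integral:
  fixes r :: "real \<Rightarrow> real"
  assumes int: "integrable lborel r" and c: "continuous_on UNIV r"
  shows "((\<lambda>x. LINT y|lborel. sgn (x - y) * r y) has_real_derivative 2 * r x) (at x)"
proof -
  have [measurable]: "r \<in> borel_measurable borel" using c by (rule borel_measurable_continuous_onI)
  have i: "integrable lborel (\<lambda>y. sgn (x - y) * r y)" for x
    by (rule Bochner_Integration.integrable_bound[OF int]) (auto simp: abs_mult sgn_if)
  have diff: "(LINT y|lborel. sgn (b - y) * r y) - (LINT y|lborel. sgn (a - y) * r y) = 2 * integral {a..b} r"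
    if "a \<le> b" for a b
  proof -
    have "(LINT y|lborel. sgn (b - y) * r y) - (LINT y|lborel. sgn (a - y) * r y)
        = (LINT y|lborel. sgn (b - y) * r y - sgn (a - y) * r y)"
      by (simp add: i)
    also have "\<dots> = (LINT y|lborel. 2 * (indicator {a..b} y *\<^sub>R r y))"
    proof (rule integral_cong_AE)
      have "AE y in lborel. y \<noteq> a \<and> y \<noteq> b"
        using AE_lborel_singleton[of a] AE_lborel_singleton[of b] by eventually_elim simp
      then show "AE y in lborel. sgn (b - y) * r y - sgn (a - y) * r y = 2 * (indicator {a..b} y *\<^sub>R r y)"
        by eventually_elim (use that in \<open>auto simp: sgn_if indicator_def\<close>)
    qed auto
    also have "\<dots> = 2 * (LINT y:{a..b}|lborel. r y)" by (simp add: set_lebesgue_integral_def)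
    also have "(LINT y:{a..b}|lborel. r y) = integral {a..b} r"
      by (rule set_borel_integral_eq_integral)
        (use int in \<open>auto simp: set_integrable_def intro!: integrable_mult_indicator[where 'b=real, simplified]\<close>)
    finally show ?thesis .
  qed
  have "((\<lambda>u. integral {x-1..u} r) has_real_derivative r x) (at x within {x-1..x+1})"
    by (rule integral_has_real_derivative) (auto intro: continuous_on_subset[OF c])
  then have 1: "((\<lambda>u. (LINT y|lborel. sgn (x - 1 - y) * r y) + 2 * integral {x-1..u} r) has_real_derivative 0 + 2 * r x) (at x)"
    by (intro DERIV_add DERIV_cmult) (auto simp: at_within_Icc_at)
  have "((\<lambda>x. LINT y|lborel. sgn (x - y) * r y) has_real_derivative 0 + 2 * r x) (at x)"
  proof (rule has_field_derivative_transform_within_open[OF 1, of "{x-1<..}"])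
    fix u assume "u \<in> {x-1<..}"
    then show "(LINT y|lborel. sgn (x - 1 - y) * r y) + 2 * integral {x-1..u} r = (LINT y|lborel. sgn (u - y) * r y)"
      using diff[of "x-1" u] by simp
  qed auto
  then show ?thesis by simp
qed

lemma continuous_on_integral_dominated:
  fixes f :: "'a::metric_space \<Rightarrow> 'b \<Rightarrow> real"
  assumes m: "\<And>x. x \<in> S \<Longrightarrow> f x \<in> borel_measurable M"
    and c: "\<And>y. y \<in> space M \<Longrightarrow> continuous_on S (\<lambda>x. f x y)"
    and b: "\<And>x y. x \<in> S \<Longrightarrow> y \<in> space M \<Longrightarrow> \<bar>f x y\<bar> \<le> g y" and g: "integrable M g"
  shows "continuous_on S (\<lambda>x. integral\<^sup>L M (f x))"
  unfolding continuous_on_sequentially comp_def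
proof (intro allI ballI impI)
  fix x a assume a: "a \<in> S" and x: "(\<forall>n. x n \<in> S) \<and> x \<longlonglongrightarrow> a"
  show "(\<lambda>n. integral\<^sup>L M (f (x n))) \<longlonglongrightarrow> integral\<^sup>L M (f a)"
  proof (rule integral_dominated_convergence[OF m[OF a] _ g])
    show "f (x n) \<in> borel_measurable M" for n using x m by auto
    show "AE y in M. (\<lambda>n. f (x n) y) \<longlonglongrightarrow> f a y"
      using c a x by (auto simp: continuous_on_sequentially comp_def)
    show "AE y in M. norm (f (x n) y) \<le> g y" for n using x b by auto
  qed
qed

lemma continuous_on_half_strip:
  fixes f :: "real \<times> 'a::t2_space \<Rightarrow> 'b::topological_space"
  assumes "\<And>\<tau>. 0 \<le> \<tau> \<Longrightarrow> continuous_on ({0..\<tau>} \<times> UNIV) f"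
  shows "continuous_on ({0..} \<times> UNIV) f"
  unfolding continuous_on_eq_continuous_within
proof
  fix z :: "real \<times> 'a" assume z: "z \<in> {0..} \<times> UNIV"
  have "at z within {0..fst z + 1} \<times> UNIV = at z within {0..} \<times> UNIV"
    by (rule at_within_nhd[of z "{..<fst z + 1} \<times> UNIV"]) (use z in \<open>auto intro: open_Times\<close>)
  moreover have "continuous (at z within {0..fst z + 1} \<times> UNIV) f"
    using assms[of "fst z + 1"] z by (auto simp: continuous_on_eq_continuous_within)
  ultimately show "continuous (at z within {0..} \<times> UNIV) f" by simp
qed

lemma continuous_on_slice:
  assumes "continuous_strip S f" "continuous_on S' g" "continuous_on S' h" "g ` S' \<subseteq> S"
  shows "continuous_on S' (\<lambda>z. f (g z) (h z))"
  using continuous_on_compose2[OF assms(1) continuous_on_Pair[OF assms(2,3)]] assms(4) by auto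

lemma continuous_on_space_slice:
  assumes "continuous_strip J f" "t \<in> J"
  shows "continuous_on UNIV (f t)"
  by (rule continuous_on_slice[OF assms(1), where h="\<lambda>a. a" and g="\<lambda>_. t"])
    (use assms(2) in \<open>auto intro: continuous_on_id continuous_on_const\<close>)

lemma continuous_on_snd_comp:
  assumes "continuous_on UNIV f"
  shows "continuous_on A (\<lambda>z. f (snd z))"
  by (rule continuous_on_compose2[OF assms]) (auto intro!: continuous_intros)

text \<open>The bound on \<open>fa\<close> is a Lipschitz constant in the label common to all times
  up to \<open>\<tau>\<close>; it upgrades separate continuity to joint continuity.\<close>

lemma slab_continuous:
  fixes f fa :: "real \<Rightarrow> real \<Rightarrow> real"
  assumes ct: "\<And>a. continuous_on {0..} (\<lambda>s. f s a)"
    and da: "\<And>t a. 0 \<le> t \<Longrightarrow> (f t has_real_derivative fa t a) (at a)"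
    and b: "\<And>\<tau>. 0 \<le> \<tau> \<Longrightarrow> \<exists>C. \<forall>t\<in>{0..\<tau>}. \<forall>a. \<bar>fa t a\<bar> \<le> C"
  shows "continuous_strip {0..} f"
proof (rule continuous_on_half_strip)
  fix \<tau> :: real assume \<tau>: "0 \<le> \<tau>"
  obtain C where C: "\<And>t a. t \<in> {0..\<tau>} \<Longrightarrow> \<bar>fa t a\<bar> \<le> C" using b[OF \<tau>] by blast
  have al: "\<bar>f t a - f t b\<bar> \<le> C * \<bar>a - b\<bar>" if "t \<in> {0..\<tau>}" for t a b
    using field_differentiable_bound[of UNIV "f t" "fa t" C a b] C that da by auto
  show "continuous_strip {0..\<tau>} f"
    unfolding continuous_on_eq_continuous_within continuous_within
  proof (clarsimp)
    fix t a :: real assume t: "0 \<le> t" "t \<le> \<tau>"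
    let ?F = "at (t, a) within {0..\<tau>} \<times> UNIV"
    have "continuous_on ({0..\<tau>} \<times> (UNIV :: real set)) (\<lambda>z. f (fst z) a)"
      by (rule continuous_on_compose2[OF ct]) (auto intro!: continuous_intros)
    then have "((\<lambda>z. f (fst z) a) \<longlongrightarrow> f t a) ?F" using t by (auto simp: continuous_on_def)
    then have "((\<lambda>z. \<bar>f (fst z) a - f t a\<bar> + C * \<bar>snd z - a\<bar>) \<longlongrightarrow>
        \<bar>f t a - f t a\<bar> + C * \<bar>snd (t, a) - a\<bar>) ?F"
      by (intro tendsto_intros)
    then have "((\<lambda>z. \<bar>f (fst z) a - f t a\<bar> + C * \<bar>snd z - a\<bar>) \<longlongrightarrow> 0) ?F" by simp
    then have "((\<lambda>z. (case z of (s, b) \<Rightarrow> f s b) - f t a) \<longlongrightarrow> 0) ?F"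
    proof (rule Lim_null_comparison[rotated])
      have "\<bar>f s b - f t a\<bar> \<le> \<bar>f s a - f t a\<bar> + C * \<bar>b - a\<bar>" if "s \<in> {0..\<tau>}" for s b
        using al[of s b a] that t by auto
      then show "\<forall>\<^sub>F z in ?F. norm ((case z of (s, b) \<Rightarrow> f s b) - f t a) \<le> \<bar>f (fst z) a - f t a\<bar> + C * \<bar>snd z - a\<bar>"
        unfolding eventually_at_filter by (intro always_eventually) auto
    qed
    then show "((\<lambda>(t, a). f t a) \<longlongrightarrow> f t a) ?F" by (simp add: LIM_zero_iff)
  qed
qed

section \<open>Limits of probability densities and their decay at infinity\<close>

lemma tendsto_integral_prob_density:
  fixes f :: "nat \<Rightarrow> real \<Rightarrow> real" and f0 h :: "real \<Rightarrow> real"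
  assumes f: "\<And>n. prob_density (f n)" and f0: "prob_density f0"
    and lim: "\<And>x. (\<lambda>n. f n x) \<longlonglongrightarrow> f0 x"
    and h[measurable]: "h \<in> borel_measurable borel" and hb: "\<And>x. \<bar>h x\<bar> \<le> B"
  shows "(\<lambda>n. LINT x|lborel. h x * f n x) \<longlonglongrightarrow> (LINT x|lborel. h x * f0 x)"
proof -
  have i: "integrable lborel (f n)" "integrable lborel f0" "(LINT x|lborel. f n x) = 1" "(LINT x|lborel. f0 x) = 1"
    "0 \<le> f n x" "0 \<le> f0 x" for n x
    using f f0 by (auto simp: prob_density_def)
  have [measurable]: "f n \<in> borel_measurable borel" "f0 \<in> borel_measurable borel" for n
    using i(1)[of n] i(2) by auto
  \<comment> \<open>Scheffe's argument: \<open>\<bar>f n - f0\<bar> = (f n - f0) + 2 * p n\<close>,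
    where the first term has integral 0 because both masses are 1, and \<open>p n\<close> is
    dominated by \<open>f0\<close>.\<close>
  define p where "p n x = max 0 (f0 x - f n x)" for n x
  have pint: "integrable lborel (p n)" for n
    unfolding p_def by (rule Bochner_Integration.integrable_bound[OF i(2)]) (use i(5,6) in auto)
  have "(\<lambda>n. LINT x|lborel. p n x) \<longlonglongrightarrow> integral\<^sup>L lborel (\<lambda>_ :: real. 0 :: real)"
  proof (rule integral_dominated_convergence[where f="\<lambda>_. 0" and s=p and w=f0])
    show "integrable lborel f0" by (rule i(2))
    have "(\<lambda>n. max 0 (f0 x - f n x)) \<longlonglongrightarrow> max 0 (f0 x - f0 x)" for x by (intro tendsto_intros lim)
    then show "AE x in lborel. (\<lambda>n. p n x) \<longlonglongrightarrow> 0" by (simp add: p_def)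
    show "AE x in lborel. norm (p n x) \<le> f0 x" for n using i(5,6) by (simp add: p_def)
  qed (use pint in auto)
  then have p0: "(\<lambda>n. LINT x|lborel. p n x) \<longlonglongrightarrow> 0" by simp
  have le: "norm ((LINT x|lborel. h x * f n x) - (LINT x|lborel. h x * f0 x)) \<le> 2 * B * (LINT x|lborel. p n x)" for n
  proof -
    have hi: "integrable lborel (\<lambda>x. h x * r x)" if r: "integrable lborel r" for r
    proof (rule Bochner_Integration.integrable_bound)
      show "integrable lborel (\<lambda>x. B * r x)" using r by simp
      have "\<bar>h x * r x\<bar> \<le> \<bar>B * r x\<bar>" for x
        using hb[of x] unfolding abs_mult by (intro mult_right_mono) auto
      then show "AE x in lborel. norm (h x * r x) \<le> norm (B * r x)" by simp
    qed (use r in auto)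
    have "norm ((LINT x|lborel. h x * f n x) - (LINT x|lborel. h x * f0 x)) = \<bar>LINT x|lborel. h x * f n x - h x * f0 x\<bar>"
      by (simp add: hi i)
    also have "\<dots> \<le> (LINT x|lborel. \<bar>h x * f n x - h x * f0 x\<bar>)" by (rule integral_abs_bound)
    also have "\<dots> \<le> (LINT x|lborel. B * ((f n x - f0 x) + 2 * p n x))"
    proof (rule integral_mono)
      show "integrable lborel (\<lambda>x. \<bar>h x * f n x - h x * f0 x\<bar>)"
        by (intro integrable_abs Bochner_Integration.integrable_diff hi i)
      show "integrable lborel (\<lambda>x. B * ((f n x - f0 x) + 2 * p n x))" using i pint by auto
      fix x
      have "\<bar>h x * f n x - h x * f0 x\<bar> = \<bar>h x\<bar> * \<bar>f n x - f0 x\<bar>" by (simp add: abs_mult flip: right_diff_distrib)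
      also have "\<dots> \<le> B * \<bar>f n x - f0 x\<bar>" using hb by (intro mult_right_mono) auto
      also have "\<bar>f n x - f0 x\<bar> = (f n x - f0 x) + 2 * p n x" by (simp add: p_def max_def)
      finally show "\<bar>h x * f n x - h x * f0 x\<bar> \<le> B * ((f n x - f0 x) + 2 * p n x)" .
    qed
    also have "\<dots> = 2 * B * (LINT x|lborel. p n x)" using i pint by simp
    finally show ?thesis .
  qed
  have "(\<lambda>n. 2 * B * (LINT x|lborel. p n x)) \<longlonglongrightarrow> 2 * B * 0" by (intro tendsto_intros p0)
  then have "(\<lambda>n. 2 * B * (LINT x|lborel. p n x)) \<longlonglongrightarrow> 0" by simp
  then have "(\<lambda>n. (LINT x|lborel. h x * f n x) - (LINT x|lborel. h x * f0 x)) \<longlonglongrightarrow> 0"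
    by (rule Lim_null_comparison[rotated]) (use le in auto)
  then show ?thesis by (simp add: LIM_zero_iff)
qed

text \<open>A value \<open>r x \<ge> e\<close> far out would, by uniform continuity, put mass at
  least \<open>d * (e / 2)\<close> on an interval of length \<open>d\<close> around
  \<open>x\<close>, more than the tail of an integrable function holds. The margin \<open>d\<close>
  in \<open>real n + d\<close> keeps that interval inside the tail.\<close>

lemma prob_density_vanishes_at_infinity:
  fixes r :: "real \<Rightarrow> real"
  assumes r: "prob_density r" and uc: "uniformly_continuous_on UNIV r" and e: "0 < e"
  shows "\<exists>b. \<forall>x. b < \<bar>x\<bar> \<longrightarrow> r x < e"
proof -
  have i: "integrable lborel r" "0 \<le> r x" for x using r by (auto simp: prob_density_def)
  have [measurable]: "r \<in> borel_measurable borel" using i(1) by auto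
  obtain d where d: "0 < d" "\<And>x y. \<bar>y - x\<bar> < d \<Longrightarrow> \<bar>r y - r x\<bar> < e / 2"
    using uc e unfolding uniformly_continuous_on_def dist_real_def by (metis UNIV_I half_gt_zero)
  have "(\<lambda>n. LINT x|lborel. indicator {x. real n < \<bar>x\<bar>} x * r x) \<longlonglongrightarrow> integral\<^sup>L lborel (\<lambda>_ :: real. 0 :: real)"
  proof (rule integral_dominated_convergence[where w=r])
    show "AE x in lborel. (\<lambda>n. indicator {x. real n < \<bar>x\<bar>} x * r x) \<longlonglongrightarrow> 0"
    proof (rule AE_I2, rule tendsto_eventually)
      fix x :: real
      obtain n where "\<bar>x\<bar> \<le> real n" using real_arch_simple by blast
      then show "\<forall>\<^sub>F n in sequentially. indicator {x. real n < \<bar>x\<bar>} x * r x = 0"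
        by (intro eventually_sequentiallyI[of n]) (auto simp: indicator_def)
    qed
  qed (use i in \<open>auto simp: indicator_def\<close>)
  then have "(\<lambda>n. LINT x|lborel. indicator {x. real n < \<bar>x\<bar>} x * r x) \<longlonglongrightarrow> 0" by simp
  moreover have "0 < d * (e / 2)" using d e by simp
  ultimately obtain n where n: "(LINT x|lborel. indicator {x. real n < \<bar>x\<bar>} x * r x) < d * (e / 2)"
    by (metis (no_types, lifting) eventually_sequentially order_refl order_tendstoD(2))
  have "r x < e" if x: "real n + d < \<bar>x\<bar>" for x
  proof (rule ccontr)
    assume "\<not> r x < e"
    then have ge: "e / 2 \<le> r y" if "y \<in> {x - d / 2..x + d / 2}" for y
    proof -
      have "\<bar>y - x\<bar> < d" using that d(1) by (simp add: abs_less_iff)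
      then show ?thesis using d(2)[of y x] \<open>\<not> r x < e\<close> by linarith
    qed
    have "d * (e / 2) = (LINT y|lborel. indicator {x - d / 2..x + d / 2} y * (e / 2))"
      using d(1) by simp
    also have "\<dots> \<le> (LINT y|lborel. indicator {x. real n < \<bar>x\<bar>} y * r y)"
    proof (rule integral_mono)
      show "integrable lborel (\<lambda>y. indicator {x - d / 2..x + d / 2} y * (e / 2))"
        by (intro integrable_mult_left integrable_real_indicator) (auto simp: emeasure_lborel_Icc_eq)
      show "integrable lborel (\<lambda>y. indicator {x. real n < \<bar>x\<bar>} y * r y)"
        by (rule Bochner_Integration.integrable_bound[OF i(1)]) (use i in \<open>auto simp: indicator_def\<close>)
      show "indicator {x - d / 2..x + d / 2} y * (e / 2) \<le> indicator {x. real n < \<bar>x\<bar>} y * r y" for y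
        using ge[of y] x d(1) i(2)[of y] by (auto simp: indicator_def)
    qed
    finally show False using n by simp
  qed
  then show ?thesis by blast
qed

text \<open>Lets \<open>picard\<close> run with bounded continuous functions as the state
  space.\<close>

instance bcontfun :: (metric_space, banach) banach ..

section \<open>Global existence of the Lagrangian flow\<close>

text \<open>The assumptions on \<open>rho0\<close> and \<open>u0\<close> are what a local classical
  solution provides at time 0. \<open>psi'\<close> is a weak derivative, bounded but possibly
  discontinuous; \<open>Psi\<close> is an arbitrary primitive, as only its differences
  enter.\<close>

locale epa_data =
  fixes k M B R0 C0 :: real and psi psi' Psi rho0 rho0' u0 u0' :: "real \<Rightarrow> real"
  assumes M: "0 < M"
    and psi_nonneg: "\<And>x. 0 \<le> psi x" and psi_le: "\<And>x. psi x \<le> M"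
    and psi'_meas[measurable]: "psi' \<in> borel_measurable borel" and psi'_le: "\<And>x. \<bar>psi' x\<bar> \<le> B"
    and psi_diff: "\<And>a b. a \<le> b \<Longrightarrow> psi b - psi a = (LINT y:{a..b}|lborel. psi' y)"
    and Psi: "\<And>x. (Psi has_real_derivative psi x) (at x)"
    and rho0_prob: "prob_density rho0"
    and rho0_deriv: "\<And>x. (rho0 has_real_derivative rho0' x) (at x)"
    and rho0'_cont: "continuous_on UNIV rho0'"
    and rho0_le: "\<And>x. rho0 x \<le> R0"
    and u0_deriv: "\<And>x. (u0 has_real_derivative u0' x) (at x)"
    and u0'_cont: "continuous_on UNIV u0'"
    and u0'_le: "\<And>x. \<bar>u0' x\<bar> \<le> C0"
    and u0_int: "integrable lborel (\<lambda>y. u0 y * rho0 y)"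
begin

text \<open>
  Integrals against \<open>\<rho>(t,\<cdot>)\<close> become integrals against the fixed measure \<open>D\<close> of the initial
  labels. Since \<open>u\<^sub>0\<close> may be unbounded, displacements are measured relative to \<open>w = 1 + |u\<^sub>0|\<close>,
  which is \<open>D\<close>-integrable even if \<open>\<rho>\<^sub>0\<close> has no first moment.
\<close>

definition D :: "real measure" where "D = density lborel (\<lambda>x. ennreal (rho0 x))"

definition w :: "real \<Rightarrow> real" where "w a = 1 + \<bar>u0 a\<bar>"

definition F :: "real \<Rightarrow> real" where "F a = - k / 2 * (LINT c|D. sgn (a - c))"

definition e0 :: "real \<Rightarrow> real" where "e0 a = u0' a + (LINT c|D. psi (a - c))"

text \<open>Without the subtracted \<open>Psi (a - c)\<close> the integrand would grow like
  \<open>c\<close> and might fail to be integrable when \<open>rho0\<close> has no first moment. The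
  difference is controlled by the displacements of \<open>a\<close> and \<open>c\<close>, hence by
  \<open>w\<close>.\<close>

definition S :: "(real \<Rightarrow> real) \<Rightarrow> real \<Rightarrow> real" where
  "S f a = (LINT c|D. Psi (f a - f c) - Psi (a - c))"

definition W :: real where "W = (LINT c|D. w c)"

text \<open>Lipschitz constant of \<open>S\<close> in the norm \<open>sup \<bar>f\<bar> / w\<close>:
  the label \<open>a\<close> contributes \<open>M\<close>, the average over \<open>c\<close>
  contributes \<open>M * W\<close>, and \<open>1 \<le> w\<close> turns the latter into a multiple of
  the weight.\<close>

definition L :: real where "L = M * (1 + W)"

lemma rho0_nonneg: "0 \<le> rho0 x" using rho0_prob by (simp add: prob_density_def)

lemma rho0_cont: "continuous_on UNIV rho0"
  using rho0_deriv by (auto simp: continuous_on_eq_continuous_at intro: DERIV_isCont)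

lemma rho0_meas[measurable]: "rho0 \<in> borel_measurable borel"
  using rho0_cont by (rule borel_measurable_continuous_onI)

lemma u0_cont: "continuous_on UNIV u0"
  using u0_deriv by (auto simp: continuous_on_eq_continuous_at intro: DERIV_isCont)

lemma u0_meas[measurable]: "u0 \<in> borel_measurable borel"
  using u0_cont by (rule borel_measurable_continuous_onI)

lemma w_cont: "continuous_on UNIV w"
  unfolding w_def[abs_def] by (intro continuous_intros u0_cont)

lemma w_meas[measurable]: "w \<in> borel_measurable borel"
  using w_cont by (rule borel_measurable_continuous_onI)

lemma w_ge1: "1 \<le> w a" by (simp add: w_def)

lemma w_pos: "0 < w a" "w a \<noteq> 0" "0 \<le> w a" using w_ge1[of a] by auto

lemma B_nonneg: "0 \<le> B" using psi'_le[of 0] by simp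

lemma Psi_cont: "continuous_on UNIV Psi"
  using Psi by (auto simp: continuous_on_eq_continuous_at intro: DERIV_isCont)

lemma Psi_meas[measurable]: "Psi \<in> borel_measurable borel"
  using Psi_cont by (rule borel_measurable_continuous_onI)

lemma psi_abs_le: "\<bar>psi x\<bar> \<le> M" using psi_nonneg[of x] psi_le[of x] by simp

lemma Psi_lip: "\<bar>Psi x - Psi y\<bar> \<le> M * \<bar>x - y\<bar>"
  using field_differentiable_bound[of UNIV Psi psi M x y] Psi psi_abs_le by auto

lemma psi_lip: "\<bar>psi x - psi y\<bar> \<le> B * \<bar>x - y\<bar>"
  by (rule primitive_lipschitz[OF psi_diff psi'_le])

lemma psi_cont: "continuous_on UNIV psi"
  by (rule lipschitz_on_continuous_on[of B]) (auto simp: lipschitz_on_def dist_real_def psi_lip B_nonneg)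

lemma psi_meas[measurable]: "psi \<in> borel_measurable borel"
  using psi_cont by (rule borel_measurable_continuous_onI)

lemma sets_D[measurable_cong]: "sets D = sets borel" by (simp add: D_def)

lemma space_D[simp]: "space D = UNIV" by (simp add: D_def)

lemma integral_D:
  assumes [measurable]: "f \<in> borel_measurable borel"
  shows "integral\<^sup>L D f = (LINT x|lborel. rho0 x * f x)"
    and "integrable D f \<longleftrightarrow> integrable lborel (\<lambda>x. rho0 x * f x)"
  unfolding D_def using rho0_nonneg
  by (simp_all add: integral_density integrable_density)

lemma emeasure_D: "emeasure D UNIV = 1"
proof -
  have "emeasure D UNIV = (\<integral>\<^sup>+x. ennreal (rho0 x) \<partial>lborel)"
    by (simp add: D_def emeasure_density)
  also have "\<dots> = ennreal (LINT x|lborel. rho0 x)"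
    using rho0_prob by (intro nn_integral_eq_integral) (auto simp: prob_density_def)
  finally show ?thesis using rho0_prob by (simp add: prob_density_def)
qed

lemma measure_D[simp]: "measure D UNIV = 1"
  by (simp add: measure_def emeasure_D)

sublocale finite_measure D
  by standard (simp add: emeasure_D)

lemma w_int: "integrable D w"
proof -
  have "integrable lborel (\<lambda>x. rho0 x + \<bar>u0 x * rho0 x\<bar>)"
    using rho0_prob u0_int by (auto simp: prob_density_def)
  moreover have "rho0 x + \<bar>u0 x * rho0 x\<bar> = rho0 x * w x" for x
    using rho0_nonneg[of x] by (simp add: w_def abs_mult algebra_simps)
  ultimately show ?thesis by (simp add: integral_D(2))
qed

lemma W_ge1: "1 \<le> W"
proof -
  have "(LINT c|D. 1) \<le> W"
    unfolding W_def by (intro integral_mono w_int w_ge1) auto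
  then show ?thesis by simp
qed

lemma L_pos: "0 < L" using M W_ge1 by (simp add: L_def)

lemma integrable_D_bound:
  assumes [measurable]: "f \<in> borel_measurable borel" and "\<And>c. \<bar>f c\<bar> \<le> K1 + K2 * w c"
  shows "integrable D f"
  by (rule Bochner_Integration.integrable_bound[of _ "\<lambda>c. K1 + K2 * w c"])
    (use assms(2) w_int in \<open>auto intro: order_trans[OF _ abs_ge_self]\<close>)

lemma integral_D_const_add: "(LINT c|D. K1 + K2 * w c) = K1 + K2 * W"
  using w_int by (simp add: W_def)

lemma F_deriv: "(F has_real_derivative - k * rho0 a) (at a)"
proof -
  have "F = (\<lambda>a. - k / 2 * (LINT c|lborel. sgn (a - c) * rho0 c))"
    by (simp add: F_def fun_eq_iff integral_D mult.commute)
  then show ?thesis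
    using DERIV_cmult[OF DERIV_sgn_integral[OF _ rho0_cont], of "- k / 2" a] rho0_prob
    by (simp add: prob_density_def)
qed

lemma F_cont: "continuous_on UNIV F"
  using F_deriv by (auto simp: continuous_on_eq_continuous_at intro: DERIV_isCont)

lemma F_le: "\<bar>F a\<bar> \<le> \<bar>k\<bar>"
proof -
  have "\<bar>LINT c|D. sgn (a - c)\<bar> \<le> (LINT c|D. \<bar>sgn (a - c)\<bar>)" by (rule integral_abs_bound)
  also have "\<dots> \<le> (LINT c|D. 1)"
    by (intro integral_mono integrable_const_bound[where B=1]) (auto simp: sgn_if)
  finally have "\<bar>LINT c|D. sgn (a - c)\<bar> \<le> 1" by simp
  then have "\<bar>k\<bar> / 2 * \<bar>LINT c|D. sgn (a - c)\<bar> \<le> \<bar>k\<bar> / 2 * 1" by (intro mult_left_mono) auto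
  then show ?thesis by (simp add: F_def abs_mult)
qed

section \<open>Estimates for the integrated alignment term\<close>

lemma S_integrable:
  assumes f: "f \<in> borel_measurable borel" "\<And>a. \<bar>f a - a\<bar> \<le> K * w a"
  shows "integrable D (\<lambda>c. Psi (f a - f c) - Psi (a - c))"
proof (rule integrable_D_bound[where ?K1.0="M * (K * w a)" and ?K2.0="M * K"])
  fix c
  have "\<bar>Psi (f a - f c) - Psi (a - c)\<bar> \<le> M * \<bar>(f a - f c) - (a - c)\<bar>" by (rule Psi_lip)
  also have "\<dots> \<le> M * (K * w a + K * w c)" using f(2)[of a] f(2)[of c] M by (intro mult_left_mono) auto
  finally show "\<bar>Psi (f a - f c) - Psi (a - c)\<bar> \<le> M * (K * w a) + M * K * w c" by (simp add: algebra_simps)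
qed (use f(1) in measurable)

lemma S_diff_le:
  assumes f: "f \<in> borel_measurable borel" "\<And>a. \<bar>f a - a\<bar> \<le> K * w a"
    and g: "g \<in> borel_measurable borel" "\<And>a. \<bar>g a - a\<bar> \<le> K' * w a"
    and d: "\<And>a. \<bar>f a - g a\<bar> \<le> E * w a"
  shows "\<bar>S f a - S g a\<bar> \<le> L * E * w a"
proof -
  have E: "0 \<le> E" using d[of 0] w_pos(1)[of 0] by (smt (verit) zero_le_mult_iff)
  have [measurable]: "f \<in> borel_measurable borel" "g \<in> borel_measurable borel" by fact+
  have i: "integrable D (\<lambda>c. (Psi (f a - f c) - Psi (a - c)) - (Psi (g a - g c) - Psi (a - c)))"
    by (intro Bochner_Integration.integrable_diff S_integrable[OF f] S_integrable[OF g])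
  have "\<bar>S f a - S g a\<bar> = \<bar>LINT c|D. (Psi (f a - f c) - Psi (a - c)) - (Psi (g a - g c) - Psi (a - c))\<bar>"
    unfolding S_def by (subst Bochner_Integration.integral_diff[OF S_integrable[OF f] S_integrable[OF g]]) simp
  also have "\<dots> \<le> (LINT c|D. \<bar>(Psi (f a - f c) - Psi (a - c)) - (Psi (g a - g c) - Psi (a - c))\<bar>)"
    by (rule integral_abs_bound)
  also have "\<dots> \<le> (LINT c|D. M * E * w a + M * E * w c)"
  proof (rule integral_mono)
    show "integrable D (\<lambda>c. \<bar>(Psi (f a - f c) - Psi (a - c)) - (Psi (g a - g c) - Psi (a - c))\<bar>)"
      using i by (rule integrable_abs)
    show "integrable D (\<lambda>c. M * E * w a + M * E * w c)" using w_int by auto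
    fix c
    have "\<bar>Psi (f a - f c) - Psi (g a - g c)\<bar> \<le> M * \<bar>(f a - f c) - (g a - g c)\<bar>" by (rule Psi_lip)
    also have "\<dots> \<le> M * (E * w a + E * w c)" using d[of a] d[of c] M by (intro mult_left_mono) auto
    finally show "\<bar>(Psi (f a - f c) - Psi (a - c)) - (Psi (g a - g c) - Psi (a - c))\<bar> \<le> M * E * w a + M * E * w c"
      by (simp add: algebra_simps)
  qed
  also have "\<dots> = M * E * w a + M * E * W" by (rule integral_D_const_add)
  also have "\<dots> \<le> M * E * w a + M * E * (W * w a)"
    using M E W_ge1 w_ge1[of a] by (intro add_left_mono mult_left_mono) (auto simp: mult_le_cancel_left1)
  finally show ?thesis by (simp add: L_def algebra_simps)
qed

text \<open>In \<open>S f b - S f a\<close> the contributions of \<open>f c\<close> and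
  \<open>c\<close> cancel inside the Lipschitz estimate of \<open>Psi\<close>, so the modulus of
  continuity involves only \<open>f b - f a\<close> and \<open>b - a\<close>, uniformly in
  \<open>c\<close>.\<close>

lemma S_cont:
  assumes f: "continuous_on UNIV f" "\<And>a. \<bar>f a - a\<bar> \<le> K * w a"
  shows "continuous_on UNIV (S f)"
  unfolding continuous_on_eq_continuous_at[OF open_UNIV] isCont_def
proof
  fix a
  have fm: "f \<in> borel_measurable borel" using f(1) by (rule borel_measurable_continuous_onI)
  have le: "\<bar>S f b - S f a\<bar> \<le> M * (\<bar>f b - f a\<bar> + \<bar>b - a\<bar>)" for b
  proof -
    have "\<bar>S f b - S f a\<bar> = \<bar>LINT c|D. (Psi (f b - f c) - Psi (b - c)) - (Psi (f a - f c) - Psi (a - c))\<bar>"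
      unfolding S_def by (subst Bochner_Integration.integral_diff[OF S_integrable[OF fm f(2)] S_integrable[OF fm f(2)]]) simp
    also have "\<dots> \<le> (LINT c|D. \<bar>(Psi (f b - f c) - Psi (b - c)) - (Psi (f a - f c) - Psi (a - c))\<bar>)"
      by (rule integral_abs_bound)
    also have "\<dots> \<le> (LINT c|D. M * (\<bar>f b - f a\<bar> + \<bar>b - a\<bar>))"
    proof (rule integral_mono)
      show "integrable D (\<lambda>c. \<bar>(Psi (f b - f c) - Psi (b - c)) - (Psi (f a - f c) - Psi (a - c))\<bar>)"
        by (intro integrable_abs Bochner_Integration.integrable_diff S_integrable[OF fm f(2)])
      fix c
      show "\<bar>(Psi (f b - f c) - Psi (b - c)) - (Psi (f a - f c) - Psi (a - c))\<bar> \<le> M * (\<bar>f b - f a\<bar> + \<bar>b - a\<bar>)"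
        using Psi_lip[of "f b - f c" "f a - f c"] Psi_lip[of "b - c" "a - c"] by (simp add: algebra_simps)
    qed simp
    finally show ?thesis by simp
  qed
  have "(f \<longlongrightarrow> f a) (at a)" using f(1) by (simp add: continuous_on_eq_continuous_at isCont_def)
  then have "((\<lambda>b. M * (\<bar>f b - f a\<bar> + \<bar>b - a\<bar>)) \<longlongrightarrow> M * (\<bar>f a - f a\<bar> + \<bar>a - a\<bar>)) (at a)"
    by (intro tendsto_intros)
  then have "((\<lambda>b. M * (\<bar>f b - f a\<bar> + \<bar>b - a\<bar>)) \<longlongrightarrow> 0) (at a)" by simp
  then have "((\<lambda>b. S f b - S f a) \<longlongrightarrow> 0) (at a)"
    by (rule Lim_null_comparison[rotated]) (simp add: le)
  then show "(S f \<longlongrightarrow> S f a) (at a)" by (simp add: LIM_zero_iff)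
qed

lemma S_le:
  assumes f: "f \<in> borel_measurable borel" "\<And>a. \<bar>f a - a\<bar> \<le> K * w a"
  shows "\<bar>S f a\<bar> \<le> L * K * w a"
proof -
  have "S (\<lambda>a. a) a = 0" by (simp add: S_def)
  then show ?thesis using S_diff_le[OF f, of "\<lambda>a. a" 0 K a] f(2) by simp
qed

text \<open>Recovers the alignment force from its primitive. The bound on \<open>v\<close> by
  \<open>w\<close> dominates the differentiated integrand; the bound on \<open>Z\<close> makes
  \<open>S\<close> converge.\<close>

lemma S_deriv:
  assumes Z: "\<And>s a. s \<in> {0..\<tau>} \<Longrightarrow> ((\<lambda>s. Z s a) has_real_derivative v s a) (at s within {0..})"
    and Zm: "\<And>s. s \<in> {0..\<tau>} \<Longrightarrow> Z s \<in> borel_measurable borel"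
    and Zb: "\<And>s a. s \<in> {0..\<tau>} \<Longrightarrow> \<bar>Z s a - a\<bar> \<le> K' * w a"
    and vm: "v t \<in> borel_measurable borel"
    and vb: "\<And>s a. s \<in> {0..\<tau>} \<Longrightarrow> \<bar>v s a\<bar> \<le> K * w a"
    and t: "0 \<le> t" "t < \<tau>"
  shows "((\<lambda>s. S (Z s) a) has_real_derivative (LINT c|D. psi (Z t a - Z t c) * (v t a - v t c))) (at t within {0..})"
proof -
  have [measurable]: "Z t \<in> borel_measurable borel" "v t \<in> borel_measurable borel"
    using t by (auto intro: Zm vm)
  have "((\<lambda>s. LINT c|D. Psi (Z s a - Z s c) - Psi (a - c)) has_real_derivative
      (LINT c|D. psi (Z t a - Z t c) * (v t a - v t c))) (at t within {0..\<tau>})"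
  proof (rule DERIV_integral_dominated[where g="\<lambda>c. M * K * w a + M * K * w c"])
    fix s c assume s: "s \<in> {0..\<tau>}"
    show "((\<lambda>s. Psi (Z s a - Z s c) - Psi (a - c)) has_real_derivative psi (Z s a - Z s c) * (v s a - v s c)) (at s within {0..\<tau>})"
      by (rule derivative_eq_intros DERIV_chain2[OF Psi] has_field_derivative_subset[OF Z[OF s]] refl | simp)+
    have "\<bar>psi (Z s a - Z s c) * (v s a - v s c)\<bar> \<le> M * (K * w a + K * w c)"
      unfolding abs_mult
      using vb[OF s, of a] vb[OF s, of c] by (intro mult_mono psi_abs_le) (use M in auto)
    then show "\<bar>psi (Z s a - Z s c) * (v s a - v s c)\<bar> \<le> M * K * w a + M * K * w c"
      by (simp add: algebra_simps)
  next
    fix s assume s: "s \<in> {0..\<tau>}"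
    show "integrable D (\<lambda>c. Psi (Z s a - Z s c) - Psi (a - c))"
      by (rule S_integrable[OF Zm[OF s] Zb[OF s]])
  qed (use t w_int in auto)
  then show ?thesis
    using t by (simp add: S_def at_within_atLeastAtMost_eq)
qed

text \<open>The growth bound puts \<open>X\<close> into the class where \<open>S\<close> converges
  and is Lipschitz, and uniqueness holds within this class.\<close>

definition flow :: "(real \<Rightarrow> real \<Rightarrow> real) \<Rightarrow> bool" where
  "flow X \<longleftrightarrow> (\<forall>a. X 0 a = a) \<and> (\<forall>t\<ge>0. continuous_on UNIV (X t)) \<and>
     (\<forall>\<tau>. \<exists>K. \<forall>t\<in>{0..\<tau>}. \<forall>a. \<bar>X t a - a\<bar> \<le> K * w a) \<and>
     (\<forall>t\<ge>0. \<forall>a. ((\<lambda>s. X s a) has_real_derivative (u0 a + t * F a - S (X t) a)) (at t within {0..}))"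

text \<open>
  The flow is obtained as \<open>X(t,a) = a + w(a) y(t,a)\<close>, where \<open>y\<close> solves a Lipschitz differential
  equation in the Banach space of bounded continuous functions.
\<close>

lemma flow_exists: "\<exists>X. flow X"
proof -
  define E where "E y a = a + w a * apply_bcontfun y a" for y :: "real \<Rightarrow>\<^sub>C real" and a
  have Econt: "continuous_on UNIV (E y)" for y
    unfolding E_def[abs_def] by (intro continuous_intros w_cont) auto
  have Em: "E y \<in> borel_measurable borel" for y
    using Econt by (rule borel_measurable_continuous_onI)
  have Ebd: "\<bar>E y a - a\<bar> \<le> norm y * w a" for y a
    using norm_bounded[of y a] w_pos[of a] by (simp add: E_def abs_mult mult.commute)
  have Ediff: "\<bar>E y a - E z a\<bar> \<le> norm (y - z) * w a" for y z a
  proof -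
    have "\<bar>E y a - E z a\<bar> = w a * \<bar>apply_bcontfun (y - z) a\<bar>"
      using w_pos[of a] by (simp add: E_def abs_mult flip: right_diff_distrib)
    then show ?thesis using norm_bounded[of "y - z" a] w_pos[of a] by (simp add: mult.commute)
  qed
  \<comment> \<open>Divided by \<open>w\<close>, the equation for \<open>X\<close> reads
    \<open>y' = b0 + t b1 - A y\<close>. The weight contains \<open>\<bar>u0\<bar>\<close> so that
    \<open>u0 / w\<close> is bounded, and the constant 1 so that \<open>F / w\<close> is.\<close>
  define b0 where "b0 = Bcontfun (\<lambda>a. u0 a / w a)"
  define b1 where "b1 = Bcontfun (\<lambda>a. F a / w a)"
  define A where "A y = Bcontfun (\<lambda>a. S (E y) a / w a)" for y
  have b0: "apply_bcontfun b0 a = u0 a / w a" for a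
    unfolding b0_def
  proof (subst Bcontfun_inverse, rule bcontfun_normI[where b=1])
    show "continuous_on UNIV (\<lambda>a. u0 a / w a)" by (intro continuous_intros u0_cont w_cont) (auto simp: w_pos)
    show "norm (u0 a / w a) \<le> 1" for a by (simp add: w_def)
  qed simp
  have b1: "apply_bcontfun b1 a = F a / w a" for a
    unfolding b1_def
  proof (subst Bcontfun_inverse, rule bcontfun_normI[where b="\<bar>k\<bar>"])
    show "continuous_on UNIV (\<lambda>a. F a / w a)" by (intro continuous_intros F_cont w_cont) (auto simp: w_pos)
    show "norm (F a / w a) \<le> \<bar>k\<bar>" for a
      using F_le[of a] w_ge1[of a] mult_left_mono[of 1 "w a" "\<bar>k\<bar>"] by (simp add: divide_simps)
  qed simp
  have Sid: "S (\<lambda>a. a) a = 0" for a by (simp add: S_def)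
  have A: "apply_bcontfun (A y) a = S (E y) a / w a" for y a
    unfolding A_def
  proof (subst Bcontfun_inverse, rule bcontfun_normI[where b="L * norm y"])
    show "continuous_on UNIV (\<lambda>a. S (E y) a / w a)"
      by (intro continuous_intros S_cont[OF Econt Ebd] w_cont) (auto simp: w_pos)
    show "norm (S (E y) a / w a) \<le> L * norm y" for a
      using S_diff_le[OF Em[of y] Ebd, of "\<lambda>a. a" 0 "norm y" a] Ebd[of y] Sid[of a] w_pos[of a] by (simp add: divide_simps)
  qed simp
  have Alip: "norm (A y - A z) \<le> L * norm (y - z)" for y z
  proof (rule norm_bound)
    fix a
    have "norm (apply_bcontfun (A y - A z) a) = \<bar>S (E y) a - S (E z) a\<bar> / w a"
      using w_pos[of a] by (simp add: A flip: diff_divide_distrib)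
    also have "\<dots> \<le> L * norm (y - z)"
      using S_diff_le[OF Em[of y] Ebd Em[of z] Ebd Ediff, of a] w_pos[of a] by (simp add: divide_simps)
    finally show "norm (apply_bcontfun (A y - A z) a) \<le> L * norm (y - z)" .
  qed
  have Acont: "continuous_on UNIV A"
    by (rule lipschitz_on_continuous_on[of L]) (use Alip L_pos in \<open>auto simp: lipschitz_on_def dist_norm\<close>)
  have "\<exists>y. y 0 = 0 \<and> (\<forall>t\<ge>0. (y has_vector_derivative b0 + t *\<^sub>R b1 - A (y t)) (at t within {0..}))"
  proof (rule picard[where f="\<lambda>t x. b0 + t *\<^sub>R b1 - A x" and ?x0.0=0 and L=L and c="L+1" and B="norm b0 + norm b1 + norm (A 0)"])
    show "continuous_on ({0..} \<times> UNIV) (\<lambda>(t, x). b0 + t *\<^sub>R b1 - A x)"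
      unfolding split_beta' by (intro continuous_intros continuous_on_compose2[OF Acont]) auto
    show "norm (b0 + t *\<^sub>R b1 - A x - (b0 + t *\<^sub>R b1 - A y)) \<le> L * norm (x - y)" for t x y
      using Alip[of y x] by (simp add: norm_minus_commute)
    show "norm (b0 + t *\<^sub>R b1 - A 0) \<le> (norm b0 + norm b1 + norm (A 0)) * exp ((L + 1) * t)" if t: "0 \<le> t" for t
    proof -
      have "t \<le> (L + 1) * t" using t L_pos by (simp add: algebra_simps)
      then have e: "1 \<le> exp ((L + 1) * t)" "t \<le> exp ((L + 1) * t)"
        using t exp_ge_add_one_self[of "(L + 1) * t"] by linarith+
      have "norm (b0 + t *\<^sub>R b1 - A 0) \<le> norm b0 + t * norm b1 + norm (A 0)"
        using norm_triangle_ineq4[of "b0 + t *\<^sub>R b1" "A 0"] norm_triangle_ineq[of b0 "t *\<^sub>R b1"] t by simp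
      also have "\<dots> \<le> norm b0 * exp ((L + 1) * t) + exp ((L + 1) * t) * norm b1 + norm (A 0) * exp ((L + 1) * t)"
        using e by (intro add_mono mult_right_mono) (auto simp: mult_le_cancel_left1)
      finally show ?thesis by (simp add: algebra_simps)
    qed
  qed (use L_pos in auto)
  then obtain y where y0: "y 0 = 0"
    and y: "\<And>t. 0 \<le> t \<Longrightarrow> (y has_vector_derivative b0 + t *\<^sub>R b1 - A (y t)) (at t within {0..})" by blast
  have nb: "\<bar>apply_bcontfun f a\<bar> \<le> norm f" for f :: "real \<Rightarrow>\<^sub>C real" and a
    using norm_bounded[of f a] by simp
  \<comment> \<open>Evaluation at a label is bounded and linear, so the derivative in the Banach
    space yields the equation label by label.\<close>
  have ev: "bounded_linear (\<lambda>f :: real \<Rightarrow>\<^sub>C real. apply_bcontfun f a)" for a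
    by (rule bounded_linear_intro[where K=1]) (auto simp: nb)
  have "flow (\<lambda>t. E (y t))"
    unfolding flow_def
  proof (intro conjI allI impI)
    show "E (y 0) a = a" for a by (simp add: E_def y0)
    show "continuous_on UNIV (E (y t))" for t by (rule Econt)
    show "\<exists>K. \<forall>t\<in>{0..\<tau>}. \<forall>a. \<bar>E (y t) a - a\<bar> \<le> K * w a" for \<tau>
    proof -
      have "continuous_on {0..\<tau>} y"
        unfolding continuous_on_eq_continuous_within
        by (auto intro: continuous_within_subset[OF has_vector_derivative_continuous[OF y]])
      then have "bounded (y ` {0..\<tau>})" by (intro compact_imp_bounded compact_continuous_image) auto
      then obtain K where K: "\<And>t. t \<in> {0..\<tau>} \<Longrightarrow> norm (y t) \<le> K" unfolding bounded_iff by fastforce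
      have "\<bar>E (y t) a - a\<bar> \<le> K * w a" if "t \<in> {0..\<tau>}" for t a
        using order_trans[OF Ebd mult_right_mono[OF K[OF that] w_pos(3)]] .
      then show ?thesis by blast
    qed
    fix t a :: real assume t: "0 \<le> t"
    have "((\<lambda>s. apply_bcontfun (y s) a) has_vector_derivative apply_bcontfun (b0 + t *\<^sub>R b1 - A (y t)) a) (at t within {0..})"
      by (rule bounded_linear.has_vector_derivative[OF ev y[OF t]])
    then have "((\<lambda>s. apply_bcontfun (y s) a) has_real_derivative (u0 a + t * F a - S (E (y t)) a) / w a) (at t within {0..})"
      by (simp add: has_real_derivative_iff_has_vector_derivative b0 b1 A add_divide_distrib diff_divide_distrib)
    from DERIV_add[OF DERIV_const[of a] DERIV_cmult[OF this, of "w a"]]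
    show "((\<lambda>s. E (y s) a) has_real_derivative u0 a + t * F a - S (E (y t)) a) (at t within {0..})"
      using w_pos[of a] by (simp add: E_def)
  qed
  then show ?thesis by blast
qed

text \<open>\<open>Z\<close> is only measurable in the label, so it is no curve in the Banach space
  of \<open>flow_exists\<close>, and the difference is estimated pointwise. Inserting a bound
  \<open>c * exp (2 * L * t) * w a\<close> into the Lipschitz estimate and integrating in time
  halves it, thanks to the factor \<open>2 * L\<close> in the exponent; iteration forces the
  difference to zero.\<close>

lemma flow_unique:
  assumes X: "flow X"
    and Z0: "\<And>a. Z 0 a = a"
    and Zm: "\<And>t. t \<in> {0..\<tau>} \<Longrightarrow> Z t \<in> borel_measurable borel"
    and Zb: "\<And>t a. t \<in> {0..\<tau>} \<Longrightarrow> \<bar>Z t a - a\<bar> \<le> K * w a"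
    and Zd: "\<And>t a. t \<in> {0..\<tau>} \<Longrightarrow> ((\<lambda>s. Z s a) has_real_derivative (u0 a + t * F a - S (Z t) a)) (at t within {0..})"
    and t: "t \<in> {0..\<tau>}"
  shows "Z t a = X t a"
proof -
  from X obtain K' where Xb: "\<And>t a. t \<in> {0..\<tau>} \<Longrightarrow> \<bar>X t a - a\<bar> \<le> K' * w a" unfolding flow_def by blast
  have Xm: "X t \<in> borel_measurable borel" if "t \<in> {0..\<tau>}" for t
    using X that by (auto simp: flow_def intro: borel_measurable_continuous_onI)
  have KK: "0 \<le> K + K'"
    using Zb[OF t, of 0] Xb[OF t, of 0] w_pos(1)[of 0] by (smt (verit) distrib_right zero_le_mult_iff)
  have "\<bar>Z t a - X t a\<bar> \<le> (K + K') / 2 ^ n * exp (2 * L * t) * w a" if "t \<in> {0..\<tau>}" for n t a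
    using that
  proof (induction n arbitrary: t a)
    case 0
    have "\<bar>Z t a - X t a\<bar> \<le> (K + K') * w a" using Zb[OF 0, of a] Xb[OF 0, of a] by (simp add: algebra_simps)
    also have "\<dots> = (K + K') * 1 * w a" by simp
    also have "\<dots> \<le> (K + K') * exp (2 * L * t) * w a"
      using 0 L_pos KK w_pos[of a] by (intro mult_right_mono mult_left_mono) auto
    finally show ?case by simp
  next
    case (Suc n)
    define c where "c = (K + K') / 2 ^ n"
    define p where "p s = c * exp (2 * L * s) / 2 * w a" for s
    have "\<bar>(\<lambda>s. Z s a - X s a) t - (\<lambda>s. Z s a - X s a) 0\<bar> \<le> p t - p 0"
    proof (rule real_derivative_bound[where \<tau>=\<tau> and h="\<lambda>s. Z s a - X s a" and p=p])
      fix s assume s: "s \<in> {0..\<tau>}"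
      show "((\<lambda>s. Z s a - X s a) has_real_derivative (u0 a + s * F a - S (Z s) a) - (u0 a + s * F a - S (X s) a)) (at s within {0..})"
        using X s by (intro DERIV_diff Zd) (auto simp: flow_def)
      show "(p has_real_derivative L * (c * exp (2 * L * s)) * w a) (at s within {0..})"
        unfolding p_def by (rule derivative_eq_intros refl | simp)+
    next
      fix s assume "0 < s" "s < \<tau>"
      then have s: "s \<in> {0..\<tau>}" by auto
      show "\<bar>u0 a + s * F a - S (Z s) a - (u0 a + s * F a - S (X s) a)\<bar> \<le> L * (c * exp (2 * L * s)) * w a"
        using S_diff_le[OF Zm[OF s] Zb[OF s] Xm[OF s] Xb[OF s] Suc.IH[OF s], of a]
        by (simp add: c_def abs_minus_commute)
    qed (use Suc.prems in auto)
    also have "p t - p 0 \<le> p t" using KK w_pos[of a] by (simp add: p_def c_def)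
    finally show ?case using X by (simp add: Z0 flow_def p_def c_def mult_ac)
  qed
  then have le: "\<bar>Z t a - X t a\<bar> \<le> (K + K') / 2 ^ n * exp (2 * L * t) * w a" for n using t by blast
  have "(\<lambda>n. (K + K') / 2 ^ n * exp (2 * L * t) * w a) \<longlonglongrightarrow> 0 * exp (2 * L * t) * w a"
    by (intro tendsto_intros LIMSEQ_divide_realpow_zero) auto
  then have "\<bar>Z t a - X t a\<bar> \<le> 0"
    by (intro LIMSEQ_le_const[where X="\<lambda>n. (K + K') / 2 ^ n * exp (2 * L * t) * w a"]) (use le in auto)
  then show ?thesis by simp
qed

end

section \<open>Regularity of the flow\<close>

locale epa_flow = epa_data +
  fixes X :: "real \<Rightarrow> real \<Rightarrow> real"
  assumes flow_X: "flow X"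
begin

text \<open>
  \<open>q = Q(X)\<close> is the convolution \<open>\<psi> \<star> \<rho>\<close> along the flow, \<open>qt\<close> its primitive in time, and \<open>G\<close> is the
  variation-of-constants formula for \<open>\<partial>\<^sub>t G = e\<^sub>0 - k t \<rho>\<^sub>0 - q G\<close>; \<open>Gt\<close> and \<open>Acc\<close> are the time
  derivatives of \<open>G\<close> and of the velocity \<open>V = \<partial>\<^sub>t X\<close>.
\<close>

definition V :: "real \<Rightarrow> real \<Rightarrow> real" where "V t a = u0 a + t * F a - S (X t) a"
definition Q :: "real \<Rightarrow> real \<Rightarrow> real" where "Q t x = (LINT c|D. psi (x - X t c))"
definition N :: "real \<Rightarrow> real \<Rightarrow> real" where "N t x = (LINT c|D. Psi (x - X t c) - Psi (- c))"
definition q :: "real \<Rightarrow> real \<Rightarrow> real" where "q t a = Q t (X t a)"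
definition qt :: "real \<Rightarrow> real \<Rightarrow> real" where "qt t a = integral {0..t} (\<lambda>s. q s a)"
definition I1 :: "real \<Rightarrow> real \<Rightarrow> real" where "I1 t a = integral {0..t} (\<lambda>s. exp (qt s a))"
definition I2 :: "real \<Rightarrow> real \<Rightarrow> real" where "I2 t a = integral {0..t} (\<lambda>s. s * exp (qt s a))"
definition G :: "real \<Rightarrow> real \<Rightarrow> real" where
  "G t a = exp (- qt t a) * (1 + e0 a * I1 t a - k * rho0 a * I2 t a)"
definition Gt :: "real \<Rightarrow> real \<Rightarrow> real" where "Gt t a = e0 a - k * t * rho0 a - q t a * G t a"
definition Acc :: "real \<Rightarrow> real \<Rightarrow> real" where
  "Acc t a = F a - (LINT c|D. psi (X t a - X t c) * (V t a - V t c))"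

lemma X_0[simp]: "X 0 a = a" using flow_X by (simp add: flow_def)

lemma X_deriv: "0 \<le> t \<Longrightarrow> ((\<lambda>s. X s a) has_real_derivative V t a) (at t within {0..})"
  using flow_X by (simp add: flow_def V_def)

lemma X_cont_space: "0 \<le> t \<Longrightarrow> continuous_on UNIV (X t)"
  using flow_X by (simp add: flow_def)

lemma X_meas: "0 \<le> t \<Longrightarrow> X t \<in> borel_measurable borel"
  by (intro borel_measurable_continuous_onI X_cont_space)

lemma X_bound:
  obtains K where "0 \<le> K" "\<And>t a. t \<in> {0..\<tau>} \<Longrightarrow> \<bar>X t a - a\<bar> \<le> K * w a"
proof -
  obtain K where K: "\<And>t a. t \<in> {0..\<tau>} \<Longrightarrow> \<bar>X t a - a\<bar> \<le> K * w a"
    using flow_X unfolding flow_def by blast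
  have "\<bar>X t a - a\<bar> \<le> max 0 K * w a" if "t \<in> {0..\<tau>}" for t a
    using K[OF that, of a] mult_right_mono[of K "max 0 K" "w a"] w_pos(3)[of a] by linarith
  then show thesis using that[of "max 0 K"] by auto
qed

lemma X_cont_time: "continuous_on {0..} (\<lambda>s. X s a)"
  using X_deriv by (auto simp: continuous_on_eq_continuous_within intro: DERIV_continuous)

lemma V_bound:
  obtains K where "0 \<le> K" "\<And>t a. t \<in> {0..\<tau>} \<Longrightarrow> \<bar>V t a\<bar> \<le> K * w a"
proof -
  obtain K where K: "0 \<le> K" "\<And>t a. t \<in> {0..\<tau>} \<Longrightarrow> \<bar>X t a - a\<bar> \<le> K * w a" using X_bound by blast
  define K' where "K' = 1 + \<bar>\<tau>\<bar> * \<bar>k\<bar> + L * K"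
  have "\<bar>V t a\<bar> \<le> K' * w a" if t: "t \<in> {0..\<tau>}" for t a
  proof -
    have "\<bar>S (X t) a\<bar> \<le> L * K * w a" using t K(2)[OF t] by (intro S_le X_meas) auto
    moreover have "\<bar>t * F a\<bar> \<le> \<bar>\<tau>\<bar> * \<bar>k\<bar>" unfolding abs_mult using t F_le[of a] by (intro mult_mono) auto
    moreover have "\<bar>\<tau>\<bar> * \<bar>k\<bar> \<le> \<bar>\<tau>\<bar> * \<bar>k\<bar> * w a" using mult_left_mono[OF w_ge1[of a], of "\<bar>\<tau>\<bar> * \<bar>k\<bar>"] by simp
    moreover have "\<bar>u0 a\<bar> \<le> w a" by (simp add: w_def)
    ultimately show ?thesis unfolding V_def K'_def distrib_right by linarith
  qed
  moreover have "0 \<le> K'" using K(1) L_pos by (simp add: K'_def)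
  ultimately show thesis using that by blast
qed

lemma Q_bounds: assumes "0 \<le> t" shows "0 \<le> Q t x" "Q t x \<le> M"
proof -
  have [measurable]: "X t \<in> borel_measurable borel" by (rule X_meas[OF assms])
  have "(LINT c|D. psi (x - X t c)) \<le> (LINT c|D. M)"
    by (intro integral_mono integrable_const_bound[where B=M]) (auto simp: psi_abs_le psi_le less_imp_le[OF M])
  then show "Q t x \<le> M" by (simp add: Q_def)
  show "0 \<le> Q t x" unfolding Q_def by (intro integral_nonneg_AE) (simp add: psi_nonneg)
qed

lemma Q_cont: "continuous_strip {0..} Q"
  unfolding Q_def split_beta'
proof (rule continuous_on_integral_dominated[where g="\<lambda>_. M"])
  fix z :: "real \<times> real" assume z: "z \<in> {0..} \<times> UNIV"
  have [measurable]: "X (fst z) \<in> borel_measurable borel" using z by (intro X_meas) auto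
  show "(\<lambda>c. psi (snd z - X (fst z) c)) \<in> borel_measurable D" by measurable
next
  fix c
  have "continuous_on ({0..} \<times> (UNIV :: real set)) (\<lambda>z. X (fst z) c)"
    by (rule continuous_on_compose2[OF X_cont_time]) (auto intro!: continuous_intros)
  then show "continuous_on ({0..} \<times> (UNIV :: real set)) (\<lambda>z. psi (snd z - X (fst z) c))"
    by (intro continuous_on_compose2[OF psi_cont] continuous_intros) auto
qed (auto simp: psi_abs_le)

lemma q_bounds: "0 \<le> t \<Longrightarrow> 0 \<le> q t a" "0 \<le> t \<Longrightarrow> q t a \<le> M"
  using Q_bounds by (auto simp: q_def)

lemma q_cont_time: "continuous_on {0..} (\<lambda>s. q s a)"
  unfolding q_def by (rule continuous_on_slice[OF Q_cont]) (auto intro: X_cont_time continuous_on_id)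

lemma qt_deriv: "0 \<le> t \<Longrightarrow> ((\<lambda>s. qt s a) has_real_derivative q t a) (at t within {0..})"
  unfolding qt_def by (rule integral_upto_deriv[OF q_cont_time])

lemma qt_cont_time: "continuous_on {0..} (\<lambda>s. qt s a)"
  by (rule continuous_on_half_line_if_deriv[OF qt_deriv])

lemma I1_deriv: "0 \<le> t \<Longrightarrow> ((\<lambda>s. I1 s a) has_real_derivative exp (qt t a)) (at t within {0..})"
  unfolding I1_def by (rule integral_upto_deriv) (intro continuous_intros qt_cont_time)

lemma I2_deriv: "0 \<le> t \<Longrightarrow> ((\<lambda>s. I2 s a) has_real_derivative t * exp (qt t a)) (at t within {0..})"
  unfolding I2_def by (rule integral_upto_deriv) (intro continuous_intros qt_cont_time)

lemma qt_0[simp]: "qt 0 a = 0" and I1_0[simp]: "I1 0 a = 0" and I2_0[simp]: "I2 0 a = 0"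
  by (simp_all add: qt_def I1_def I2_def)

lemma G_0[simp]: "G 0 a = 1" by (simp add: G_def)

lemma G_deriv_time: "0 \<le> t \<Longrightarrow> ((\<lambda>s. G s a) has_real_derivative Gt t a) (at t within {0..})"
  unfolding G_def Gt_def
  by (rule derivative_eq_intros qt_deriv I1_deriv I2_deriv refl | assumption)+
    (simp add: algebra_simps exp_minus)

lemma Q_0: "Q 0 a = e0 a - u0' a" by (simp add: Q_def e0_def)

lemma e0_le: "\<bar>e0 a\<bar> \<le> C0 + M"
  using Q_bounds[of 0 a] u0'_le[of a] Q_0[of a] by linarith

lemma e0_cont: "continuous_on UNIV e0"
proof -
  have "continuous_on UNIV (\<lambda>a. Q 0 a + u0' a)"
    by (intro continuous_intros u0'_cont continuous_on_slice[OF Q_cont]) auto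
  then show ?thesis by (simp add: Q_0)
qed

section \<open>Differentiability of the flow in the label\<close>

lemma N_integrable:
  assumes t: "0 \<le> t"
  shows "integrable D (\<lambda>c. Psi (x - X t c) - Psi (- c))"
proof -
  have [measurable]: "X t \<in> borel_measurable borel" by (rule X_meas[OF t])
  obtain K where K: "0 \<le> K" "\<And>s a. s \<in> {0..t} \<Longrightarrow> \<bar>X s a - a\<bar> \<le> K * w a" using X_bound by blast
  show ?thesis
  proof (rule integrable_D_bound[where ?K1.0="M * \<bar>x\<bar>" and ?K2.0="M * K"])
    fix c
    have "\<bar>Psi (x - X t c) - Psi (- c)\<bar> \<le> M * \<bar>(x - X t c) - (- c)\<bar>" by (rule Psi_lip)
    also have "\<dots> \<le> M * (\<bar>x\<bar> + K * w c)" using K(2)[of t c] t M by (intro mult_left_mono) auto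
    finally show "\<bar>Psi (x - X t c) - Psi (- c)\<bar> \<le> M * \<bar>x\<bar> + M * K * w c" by (simp add: algebra_simps)
  qed measurable
qed

lemma N_deriv:
  assumes t: "0 \<le> t"
  shows "(N t has_real_derivative Q t x) (at x)"
proof -
  have [measurable]: "X t \<in> borel_measurable borel" by (rule X_meas[OF t])
  have "((\<lambda>x. LINT c|D. Psi (x - X t c) - Psi (- c)) has_real_derivative (LINT c|D. psi (x - X t c))) (at x within UNIV)"
  proof (rule DERIV_integral_dominated[where g="\<lambda>_. M"])
    show "((\<lambda>x. Psi (x - X t c) - Psi (- c)) has_real_derivative psi (x - X t c)) (at x within UNIV)" for x c
      by (rule derivative_eq_intros DERIV_chain2[OF Psi] refl | simp)+
  qed (use N_integrable[OF t] psi_abs_le in auto)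
  then show ?thesis by (simp add: N_def[abs_def] Q_def)
qed

text \<open>Separates the label from the position: the velocity becomes
  \<open>u0 a + t * F a + N 0 a - N t (X t a)\<close>, the form required by
  \<open>flow_space_deriv\<close>. The term \<open>Psi (- c)\<close> makes each of the two integrals
  converge and cancels in their difference.\<close>

lemma S_eq_N:
  assumes t: "0 \<le> t"
  shows "S (X t) a = N t (X t a) - N 0 a"
proof -
  have "N t (X t a) - N 0 a = (LINT c|D. (Psi (X t a - X t c) - Psi (- c)) - (Psi (a - X 0 c) - Psi (- c)))"
    unfolding N_def by (intro Bochner_Integration.integral_diff[symmetric] N_integrable t) simp
  then show ?thesis by (simp add: S_def)
qed

text \<open>\<open>e0\<close> and \<open>rho0\<close> are bounded and
  \<open>0 \<le> q \<le> M\<close>, so Gronwall's inequality is uniform in the label.\<close>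

lemma G_Gt_bound:
  assumes "0 \<le> \<tau>"
  obtains C where "0 \<le> C" "\<And>t a. t \<in> {0..\<tau>} \<Longrightarrow> \<bar>G t a\<bar> \<le> C" "\<And>t a. t \<in> {0..\<tau>} \<Longrightarrow> \<bar>Gt t a\<bar> \<le> C"
proof -
  define A where "A = C0 + M + \<bar>k\<bar> * \<tau> * \<bar>R0\<bar>"
  have C0: "0 \<le> C0" using u0'_le[of 0] by simp
  have A: "0 \<le> A" using assms M C0 by (simp add: A_def)
  have src: "\<bar>e0 a - k * t * rho0 a\<bar> \<le> A" if "t \<in> {0..\<tau>}" for t a
  proof -
    have "\<bar>k * t * rho0 a\<bar> \<le> \<bar>k\<bar> * \<tau> * \<bar>R0\<bar>"
      unfolding abs_mult using that rho0_nonneg[of a] rho0_le[of a] by (intro mult_mono) auto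
    then show ?thesis using e0_le[of a] unfolding A_def by linarith
  qed
  have qG: "\<bar>q t a * G t a\<bar> \<le> M * \<bar>G t a\<bar>" if "t \<in> {0..\<tau>}" for t a
    unfolding abs_mult using q_bounds[of t a] that by (intro mult_right_mono) auto
  define E where "E = (1 + A) * exp ((M + 1) * (\<tau> + 1))"
  have GE: "\<bar>G t a\<bar> \<le> E" if t: "t \<in> {0..\<tau>}" for t a
  proof -
    have "\<bar>G t a\<bar> \<le> (\<bar>G 0 a\<bar> + A) * exp ((M + 1) * (\<tau> + 1))"
    proof (rule gronwall_abs[where y="\<lambda>t. G t a" and y'="\<lambda>t. Gt t a"])
      show "((\<lambda>t. G t a) has_real_derivative Gt s a) (at s within {0..})" if "s \<in> {0..\<tau>}" for s
        using that by (intro G_deriv_time) auto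
      show "\<bar>Gt s a\<bar> \<le> M * \<bar>G s a\<bar> + A" if "0 < s" "s < \<tau>" for s
        using src[of s a] qG[of s a] that unfolding Gt_def by auto
    qed (use M A t in auto)
    then show ?thesis by (simp add: E_def)
  qed
  have E: "0 \<le> E" using A by (simp add: E_def)
  have ME: "0 \<le> M * E" using M E by simp
  show thesis
  proof (rule that[of "A + M * E + E"])
    show "0 \<le> A + M * E + E" using A E ME by simp
    show "\<bar>G t a\<bar> \<le> A + M * E + E" if "t \<in> {0..\<tau>}" for t a using GE[OF that, of a] A ME by linarith
    show "\<bar>Gt t a\<bar> \<le> A + M * E + E" if t: "t \<in> {0..\<tau>}" for t a
    proof -
      have "M * \<bar>G t a\<bar> \<le> M * E" using GE[OF t, of a] M by (intro mult_left_mono) auto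
      then show ?thesis using src[OF t, of a] qG[OF t, of a] E unfolding Gt_def by linarith
    qed
  qed
qed

lemma G_bounded:
  assumes "0 \<le> \<tau>"
  shows "\<exists>C. \<forall>t\<in>{0..\<tau>}. \<forall>a. \<bar>G t a\<bar> \<le> C" "\<exists>C. \<forall>t\<in>{0..\<tau>}. \<forall>a. \<bar>Gt t a\<bar> \<le> C"
  using G_Gt_bound[OF assms] by meson+

lemma G_time_lipschitz:
  assumes "0 \<le> \<tau>"
  obtains C where "0 \<le> C" "\<And>s t a. s \<in> {0..\<tau>} \<Longrightarrow> t \<in> {0..\<tau>} \<Longrightarrow> \<bar>G t a - G s a\<bar> \<le> C * \<bar>t - s\<bar>"
proof -
  obtain C where C: "0 \<le> C" "\<And>t a. t \<in> {0..\<tau>} \<Longrightarrow> \<bar>Gt t a\<bar> \<le> C" using G_Gt_bound[OF assms] by metis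
  have "\<bar>G t a - G s a\<bar> \<le> C * \<bar>t - s\<bar>" if "s \<in> {0..\<tau>}" "t \<in> {0..\<tau>}" for s t a
  proof -
    have "((\<lambda>r. G r a) has_real_derivative Gt r a) (at r within {0..\<tau>})" if "r \<in> {0..\<tau>}" for r
      using that by (intro has_field_derivative_subset[OF G_deriv_time]) auto
    then show ?thesis
      using field_differentiable_bound[of "{0..\<tau>}" "\<lambda>r. G r a" "\<lambda>r. Gt r a" C t s] C that by auto
  qed
  then show thesis using that C(1) by blast
qed

lemma source_deriv:
  "((\<lambda>a. u0 a + s * F a + N 0 a) has_real_derivative e0 a - k * s * rho0 a) (at a)"
  by (rule derivative_eq_intros u0_deriv F_deriv N_deriv refl | simp add: Q_0)+

text \<open>\<open>G\<close> was defined by an explicit formula before any differentiability of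
  \<open>X\<close> is known; it solves the linearised equation with initial value 1, and
  \<open>flow_space_deriv\<close> identifies it with the label derivative.\<close>

lemma X_deriv_space:
  assumes t: "0 \<le> t"
  shows "(X t has_real_derivative G t a) (at a)"
proof (rule flow_space_deriv[where \<tau>=t and p="\<lambda>s a. u0 a + s * F a + N 0 a" and n="\<lambda>s x. - N s x"
      and p'="\<lambda>s a. e0 a - k * s * rho0 a" and n'="\<lambda>s x. - Q s x" and C=M and g="\<lambda>s. G s a"])
  fix s b assume "s \<in> {0..t}"
  then have s: "0 \<le> s" by simp
  show "((\<lambda>s. X s b) has_real_derivative u0 b + s * F b + N 0 b + - N s (X s b)) (at s within {0..})"
    using X_deriv[OF s, of b] S_eq_N[OF s, of b] by (simp add: V_def algebra_simps)
  show "((\<lambda>a. u0 a + s * F a + N 0 a) has_real_derivative e0 b - k * s * rho0 b) (at b)"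
    by (rule source_deriv)
  show "((\<lambda>x. - N s x) has_real_derivative - Q s b) (at b)"
    by (intro DERIV_minus N_deriv s)
  show "\<bar>- Q s b\<bar> \<le> M" using Q_bounds[OF s, of b] by simp
next
  fix s assume "s \<in> {0..t}"
  then show "((\<lambda>s. G s a) has_real_derivative e0 a - k * s * rho0 a + - Q s (X s a) * G s a) (at s within {0..})"
    using G_deriv_time[of s a] by (simp add: Gt_def q_def)
next
  show "continuous_on ({0..t} \<times> UNIV) (\<lambda>(s, a). e0 a - k * s * rho0 a)"
    unfolding split_beta'
    by (intro continuous_intros continuous_on_compose2[OF e0_cont] continuous_on_compose2[OF rho0_cont]) auto
  show "continuous_on ({0..t} \<times> UNIV) (\<lambda>(s, y). - Q s y)"
    unfolding split_beta' by (intro continuous_intros continuous_on_slice[OF Q_cont]) auto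
qed (use t in auto)

lemma X_cont: "continuous_strip {0..} X"
  by (rule slab_continuous[OF X_cont_time X_deriv_space]) (assumption | rule G_bounded)+

lemma q_cont: "continuous_strip {0..} q"
  unfolding q_def split_beta'
  by (rule continuous_on_slice[OF Q_cont])
    (use X_cont in \<open>auto intro!: continuous_intros simp: split_beta'\<close>)

lemma qt_cont: "continuous_strip {0..} qt"
  unfolding qt_def by (rule continuous_on_integral_upto[OF q_cont]) auto

lemma I1_cont: "continuous_strip {0..} I1"
  unfolding I1_def
  by (rule continuous_on_integral_upto) (use qt_cont in \<open>auto intro!: continuous_intros simp: split_beta'\<close>)

lemma I2_cont: "continuous_strip {0..} I2"
  unfolding I2_def
  by (rule continuous_on_integral_upto) (use qt_cont in \<open>auto intro!: continuous_intros simp: split_beta'\<close>)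

lemma G_cont: "continuous_strip {0..} G"
  unfolding G_def split_beta'
  by (intro continuous_intros continuous_on_compose2[OF e0_cont] continuous_on_compose2[OF rho0_cont])
    (use qt_cont I1_cont I2_cont in \<open>auto simp: split_beta'\<close>)

lemma Gt_cont: "continuous_strip {0..} Gt"
  unfolding Gt_def split_beta'
  by (intro continuous_intros continuous_on_compose2[OF e0_cont] continuous_on_compose2[OF rho0_cont])
    (use q_cont G_cont in \<open>auto simp: split_beta'\<close>)

lemma V_deriv_space:
  assumes t: "0 \<le> t"
  shows "(V t has_real_derivative Gt t a) (at a)"
proof -
  have "V t = (\<lambda>a. (u0 a + t * F a + N 0 a) - N t (X t a))"
    by (simp add: fun_eq_iff V_def S_eq_N[OF t])
  moreover have "((\<lambda>a. (u0 a + t * F a + N 0 a) - N t (X t a)) has_real_derivative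
      (e0 a - k * t * rho0 a) - Q t (X t a) * G t a) (at a)"
    by (intro DERIV_diff source_deriv DERIV_chain2[OF N_deriv[OF t] X_deriv_space[OF t]])
  ultimately show ?thesis by (simp add: Gt_def q_def)
qed

lemma V_cont_space: "0 \<le> t \<Longrightarrow> continuous_on UNIV (V t)"
  using V_deriv_space by (auto simp: continuous_on_eq_continuous_at intro: DERIV_isCont)

lemma V_meas: "0 \<le> t \<Longrightarrow> V t \<in> borel_measurable borel"
  by (intro borel_measurable_continuous_onI V_cont_space)

lemma V_deriv_time:
  assumes t: "0 \<le> t"
  shows "((\<lambda>s. V s a) has_real_derivative Acc t a) (at t within {0..})"
proof -
  obtain K where K: "0 \<le> K" "\<And>s a. s \<in> {0..t+1} \<Longrightarrow> \<bar>V s a\<bar> \<le> K * w a" using V_bound by blast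
  obtain K' where K': "0 \<le> K'" "\<And>s a. s \<in> {0..t+1} \<Longrightarrow> \<bar>X s a - a\<bar> \<le> K' * w a" using X_bound by blast
  have S': "((\<lambda>s. S (X s) a) has_real_derivative (LINT c|D. psi (X t a - X t c) * (V t a - V t c))) (at t within {0..})"
    by (rule S_deriv[where \<tau>="t+1" and v=V, OF _ _ K'(2) _ K(2)]) (use t X_deriv X_meas V_meas in auto)
  have "((\<lambda>s. (u0 a + s * F a) - S (X s) a) has_real_derivative
      F a - (LINT c|D. psi (X t a - X t c) * (V t a - V t c))) (at t within {0..})"
    by (rule DERIV_diff[OF _ S']) (rule derivative_eq_intros refl | simp)+
  then show ?thesis by (simp add: V_def[abs_def] Acc_def)
qed

lemma V_cont: "continuous_strip {0..} V"
  by (rule slab_continuous[OF continuous_on_half_line_if_deriv[OF V_deriv_time] V_deriv_space]) (assumption | rule G_bounded)+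

lemma Acc_cont: "continuous_strip {0..} Acc"
proof -
  \<comment> \<open>Splitting \<open>V t a - V t c\<close> isolates an integral in which the label
    enters only through the position \<open>X t a\<close>. Its joint continuity follows by
    domination with \<open>w\<close> on bounded strips and is then composed with
    \<open>X\<close>.\<close>
  define P where "P t x = (LINT c|D. psi (x - X t c) * V t c)" for t x
  have Pc: "continuous_strip {0..} P"
  proof (rule continuous_on_half_strip)
    fix \<tau> :: real assume \<tau>: "0 \<le> \<tau>"
    obtain K where K: "0 \<le> K" "\<And>t a. t \<in> {0..\<tau>} \<Longrightarrow> \<bar>V t a\<bar> \<le> K * w a" using V_bound by blast
    show "continuous_strip {0..\<tau>} P"
      unfolding P_def split_beta'
    proof (rule continuous_on_integral_dominated[where g="\<lambda>c. M * (K * w c)"])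
      fix z :: "real \<times> real" assume z: "z \<in> {0..\<tau>} \<times> UNIV"
      have [measurable]: "X (fst z) \<in> borel_measurable borel" "V (fst z) \<in> borel_measurable borel"
        using z by (auto intro: X_meas V_meas)
      show "(\<lambda>c. psi (snd z - X (fst z) c) * V (fst z) c) \<in> borel_measurable D" by measurable
      show "\<bar>psi (snd z - X (fst z) c) * V (fst z) c\<bar> \<le> M * (K * w c)" for c
        unfolding abs_mult using z M by (intro mult_mono psi_abs_le K) auto
    next
      fix c
      show "continuous_on ({0..\<tau>} \<times> (UNIV :: real set)) (\<lambda>z. psi (snd z - X (fst z) c) * V (fst z) c)"
        by (intro continuous_intros continuous_on_compose2[OF psi_cont] continuous_on_slice[OF X_cont] continuous_on_slice[OF V_cont]) auto
    qed (use w_int in auto)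
  qed
  have eq: "Acc t a = F a - (q t a * V t a - P t (X t a))" if t: "0 \<le> t" for t a
  proof -
    have [measurable]: "X t \<in> borel_measurable borel" "V t \<in> borel_measurable borel"
      using t by (auto intro: X_meas V_meas)
    obtain K where K: "0 \<le> K" "\<And>s a. s \<in> {0..t} \<Longrightarrow> \<bar>V s a\<bar> \<le> K * w a" using V_bound by blast
    have "integrable D (\<lambda>c. psi (X t a - X t c))"
      by (rule integrable_const_bound[where B=M]) (auto simp: psi_abs_le)
    moreover have "integrable D (\<lambda>c. psi (X t a - X t c) * V t c)"
    proof (rule integrable_D_bound[where ?K1.0=0 and ?K2.0="M * K"])
      show "\<bar>psi (X t a - X t c) * V t c\<bar> \<le> 0 + M * K * w c" for c
        using mult_mono[OF psi_abs_le K(2)[of t c], of "X t a - X t c"] t M by (auto simp: abs_mult mult.assoc)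
    qed measurable
    ultimately have "(LINT c|D. psi (X t a - X t c) * V t a - psi (X t a - X t c) * V t c) = q t a * V t a - P t (X t a)"
      by (simp add: q_def Q_def P_def)
    then show ?thesis by (simp add: Acc_def right_diff_distrib)
  qed
  have "continuous_on ({0..} \<times> UNIV) (\<lambda>z. F (snd z) - (q (fst z) (snd z) * V (fst z) (snd z) - P (fst z) (X (fst z) (snd z))))"
    by (intro continuous_intros continuous_on_compose2[OF F_cont] continuous_on_slice[OF q_cont] continuous_on_slice[OF V_cont]
        continuous_on_slice[OF Pc] continuous_on_slice[OF X_cont]) auto
  then show ?thesis
    by (subst continuous_on_cong[OF refl, where g="\<lambda>z. F (snd z) - (q (fst z) (snd z) * V (fst z) (snd z) - P (fst z) (X (fst z) (snd z)))"])
      (auto simp: eq)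
qed

end

section \<open>Classical solutions follow the Lagrangian flow\<close>

context epa_flow
begin

text \<open>Follows the particle paths \<open>Z\<close> of the given \<open>u\<close>. The
  continuity equation makes \<open>rho (Z) * g\<close> constant, the change of variables by
  \<open>Z\<close> turns both force integrals into integrals against \<open>D\<close>, and the
  momentum equation integrated once in time shows that \<open>Z\<close> solves the flow equation, so
  \<open>Z = X\<close> by uniqueness. The times stay strictly below \<open>\<tau>\<close> since a
  derivative at \<open>\<tau>\<close> would look beyond the strip on which the bounds are
  known.\<close>

lemma classical_solution_on_strip:
  assumes sol: "classical_solution psi k rho0 u0 T rho u" and \<tau>: "\<tau> \<in> time_dom T"
  obtains c where "0 < c" "\<And>t a. 0 \<le> t \<Longrightarrow> t < \<tau> \<Longrightarrow> c \<le> G t a"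
    "\<And>t a. 0 \<le> t \<Longrightarrow> t < \<tau> \<Longrightarrow> u t (X t a) = V t a"
    "\<And>t a. 0 \<le> t \<Longrightarrow> t < \<tau> \<Longrightarrow> rho t (X t a) * G t a = rho0 a"
proof -
  have \<tau>0: "0 \<le> \<tau>" using \<tau> by (simp add: time_dom_def)
  have td: "s \<in> time_dom T" if "s \<in> {0..\<tau>}" for s using time_dom_downward[OF \<tau>] that by auto
  have slabs: "C1_slab T rho" "C1_slab T u" using sol by (auto simp: classical_solution_def)
  obtain rt rx where
    rx_cont: "continuous_strip (time_dom T) rx"
    and rt: "\<And>t x. t \<in> time_dom T \<Longrightarrow> ((\<lambda>s. rho s x) has_real_derivative rt t x) (at t within time_dom T)"
    and rx: "\<And>t x. t \<in> time_dom T \<Longrightarrow> (rho t has_real_derivative rx t x) (at x)"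
    using slabs(1) unfolding C1_slab_def by blast
  obtain ut ux where
    ux_cont: "continuous_strip (time_dom T) ux"
    and ut: "\<And>t x. t \<in> time_dom T \<Longrightarrow> ((\<lambda>s. u s x) has_real_derivative ut t x) (at t within time_dom T)"
    and ux: "\<And>t x. t \<in> time_dom T \<Longrightarrow> (u t has_real_derivative ux t x) (at x)"
    using slabs(2) unfolding C1_slab_def by blast
  have u_cont: "continuous_strip (time_dom T) u"
    by (rule C1_slab_continuous[OF slabs(2)])
  have init: "rho 0 = rho0" "u 0 = u0" using sol by (auto simp: classical_solution_def)
  have prob: "prob_density (rho t)" "integrable lborel (\<lambda>y. u t y * rho t y)" if "t \<in> time_dom T" for t
    using sol that by (auto simp: classical_solution_def)
  have "\<exists>C. \<forall>t\<in>{0..\<tau>}. (\<forall>x. rho t x \<le> C \<and> \<bar>deriv (u t) x\<bar> \<le> C) \<and> (LINT y|lborel. \<bar>u t y\<bar> * rho t y) \<le> C"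
    using sol \<tau> unfolding classical_solution_def by blast
  then obtain C where C: "\<And>t x. t \<in> {0..\<tau>} \<Longrightarrow> \<bar>deriv (u t) x\<bar> \<le> C"
    "\<And>t. t \<in> {0..\<tau>} \<Longrightarrow> (LINT y|lborel. \<bar>u t y\<bar> * rho t y) \<le> C"
    by blast
  have ux_le: "\<bar>ux t x\<bar> \<le> C" if "t \<in> {0..\<tau>}" for t x
    using C(1)[OF that, of x] DERIV_imp_deriv[OF ux[OF td[OF that]]] by simp
  have C0: "0 \<le> C" using ux_le[of 0 0] \<tau>0 by auto
  obtain phi where
    phi: "\<And>t x. t \<in> time_dom T \<Longrightarrow> 0 < t \<Longrightarrow> (phi t has_real_derivative 1/2 * (LINT y|lborel. sgn (x - y) * rho t y)) (at x)"
    and mass_eq: "\<And>t x. t \<in> time_dom T \<Longrightarrow> 0 < t \<Longrightarrow> deriv (\<lambda>s. rho s x) t + deriv (\<lambda>y. rho t y * u t y) x = 0"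
    and mom_eq: "\<And>t x. t \<in> time_dom T \<Longrightarrow> 0 < t \<Longrightarrow> deriv (\<lambda>s. u s x) t + u t x * deriv (u t) x =
      - k * deriv (phi t) x + (LINT y|lborel. psi (x - y) * (u t y - u t x) * rho t y)"
    using sol unfolding classical_solution_def poisson_potential_def by blast

  \<comment> \<open>Freezing the time at \<open>\<tau>\<close> extends \<open>u\<close> to all later
    times with the same bounds, so the global \<open>picard\<close> applies.\<close>
  define cl where "cl t = min t \<tau>" for t
  have cl: "cl t \<in> {0..\<tau>}" if "0 \<le> t" for t using that \<tau>0 by (auto simp: cl_def)
  have cl_id: "cl t = t" if "t \<le> \<tau>" for t using that by (simp add: cl_def)
  define uc where "uc t x = u (cl t) x" for t x
  define uxc where "uxc t x = ux (cl t) x" for t x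
  have cl_cont: "continuous_on A (\<lambda>z. cl (fst z))" for A :: "(real \<times> real) set"
    unfolding cl_def by (intro continuous_intros)
  have uc_cont: "continuous_strip {0..} uc"
    unfolding uc_def split_beta'
    by (rule continuous_on_slice[OF u_cont]) (use cl td in \<open>auto intro!: continuous_intros cl_cont\<close>)
  have uxc_cont: "continuous_strip {0..} uxc"
    unfolding uxc_def split_beta'
    by (rule continuous_on_slice[OF ux_cont]) (use cl td in \<open>auto intro!: continuous_intros cl_cont\<close>)
  have uxc: "(uc t has_real_derivative uxc t x) (at x)" if "0 \<le> t" for t x
    unfolding uc_def[abs_def] uxc_def by (rule ux[OF td[OF cl[OF that]]])
  have uxc_le: "\<bar>uxc t x\<bar> \<le> C" if "0 \<le> t" for t x unfolding uxc_def by (rule ux_le[OF cl[OF that]])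
  have uc_lip: "\<bar>uc t x - uc t y\<bar> \<le> C * \<bar>x - y\<bar>" if "0 \<le> t" for t x y
    using field_differentiable_bound[of UNIV "uc t" "uxc t" C x y] uxc[OF that] uxc_le[OF that] by auto
  have "continuous_on {0..\<tau>} (\<lambda>t. u t 0)"
    by (rule continuous_on_slice[OF u_cont]) (use td in \<open>auto intro: continuous_on_id\<close>)
  then have "bounded ((\<lambda>t. u t 0) ` {0..\<tau>})" by (intro compact_imp_bounded compact_continuous_image) auto
  then obtain Bu where Bu: "\<And>t. t \<in> {0..\<tau>} \<Longrightarrow> \<bar>u t 0\<bar> \<le> Bu" unfolding bounded_iff by fastforce
  have Bu0: "0 \<le> Bu" using Bu[of 0] \<tau>0 by auto
  have "\<exists>y. y 0 = a \<and> (\<forall>t\<ge>0. (y has_vector_derivative uc t (y t)) (at t within {0..}))" for a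
  proof (rule picard[where f=uc and ?x0.0=a and L=C and c="C+1" and B=Bu, OF uc_cont])
    show "norm (uc t x - uc t y) \<le> C * norm (x - y)" if "0 \<le> t" for t x y using uc_lip[OF that] by simp
    show "norm (uc t 0) \<le> Bu * exp ((C + 1) * t)" if "0 \<le> t" for t
    proof -
      have "norm (uc t 0) \<le> Bu * 1" using Bu[OF cl[OF that]] by (simp add: uc_def)
      also have "\<dots> \<le> Bu * exp ((C + 1) * t)" using that C0 Bu0 by (intro mult_left_mono) auto
      finally show ?thesis .
    qed
  qed (use C0 Bu0 in auto)
  then obtain y where y: "\<And>a. y a 0 = a" "\<And>a t. 0 \<le> t \<Longrightarrow> (y a has_vector_derivative uc t (y a t)) (at t within {0..})"
    by metis
  define Z where "Z t a = y a t" for t a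
  have Z0: "Z 0 a = a" for a by (simp add: Z_def y)
  have Zt: "((\<lambda>s. Z s a) has_real_derivative uc t (Z t a)) (at t within {0..})" if "0 \<le> t" for t a
    using y(2)[OF that] by (simp add: Z_def has_real_derivative_iff_has_vector_derivative)
  have Z_time: "continuous_on {0..} (\<lambda>s. Z s a)" for a by (rule continuous_on_half_line_if_deriv[OF Zt])
  \<comment> \<open>Liouville's formula for the Jacobian of \<open>Z\<close>. The bound
    \<open>C\<close> on the space derivative of \<open>u\<close> makes it at least
    \<open>exp (- (C * \<tau>))\<close>, the lower bound eventually claimed for
    \<open>G\<close>.\<close>
  define g where "g t a = exp (integral {0..t} (\<lambda>s. uxc s (Z s a)))" for t a
  have g0: "g 0 a = 1" and gpos: "0 < g t a" for t a by (auto simp: g_def)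
  have J: "((\<lambda>t. integral {0..t} (\<lambda>s. uxc s (Z s a))) has_real_derivative uxc t (Z t a)) (at t within {0..})" if "0 \<le> t" for t a
    by (rule integral_upto_deriv[OF continuous_on_slice[OF uxc_cont] that]) (auto intro: Z_time continuous_on_id)
  have gt: "((\<lambda>s. g s a) has_real_derivative uxc t (Z t a) * g t a) (at t within {0..})" if "0 \<le> t" for t a
    unfolding g_def by (rule derivative_eq_intros J[OF that] refl | simp)+
  have Jb: "\<bar>integral {0..t} (\<lambda>s. uxc s (Z s a))\<bar> \<le> C * t" if "0 \<le> t" for t a
    using real_derivative_bound[where h="\<lambda>t. integral {0..t} (\<lambda>s. uxc s (Z s a))" and h'="\<lambda>t. uxc t (Z t a)"
        and p="\<lambda>t. C * t" and p'="\<lambda>_. C" and \<tau>=t and s=0 and t=t] J uxc_le that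
    by (auto intro!: derivative_eq_intros)
  have g_bounds: "exp (- (C * \<tau>')) \<le> g t a" "g t a \<le> exp (C * \<tau>')" if "t \<in> {0..\<tau>'}" for t a \<tau>'
  proof -
    have "C * t \<le> C * \<tau>'" using that C0 by (intro mult_left_mono) auto
    then show "exp (- (C * \<tau>')) \<le> g t a" "g t a \<le> exp (C * \<tau>')" using Jb[of t a] that by (auto simp: g_def)
  qed
  have Za: "(Z t has_real_derivative g t a) (at a)" if t: "0 \<le> t" for t a
  proof (rule flow_space_deriv[where \<tau>=t and p="\<lambda>_ _. 0" and p'="\<lambda>_ _. 0" and n=uc and n'=uxc and C=C and g="\<lambda>s. g s a"])
    show "((\<lambda>s. Z s b) has_real_derivative 0 + uc s (Z s b)) (at s within {0..})" if "s \<in> {0..t}" for s b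
      using Zt[of s b] that by simp
    show "((\<lambda>s. g s a) has_real_derivative 0 + uxc s (Z s a) * g s a) (at s within {0..})" if "s \<in> {0..t}" for s
      using gt[of s a] that by simp
    show "continuous_strip {0..t} uxc"
      by (rule continuous_on_subset[OF uxc_cont]) auto
  qed (use t Z0 g0 uxc uxc_le in \<open>auto simp: split_beta'\<close>)
  have Z_cont: "continuous_strip {0..} Z"
  proof (rule slab_continuous[OF Z_time Za])
    show "\<exists>C. \<forall>t\<in>{0..\<tau>'}. \<forall>a. \<bar>g t a\<bar> \<le> C" for \<tau>'
      using g_bounds(2) gpos by (intro exI[of _ "exp (C * \<tau>')"]) (auto simp: abs_of_pos)
  qed auto
  have g_cont: "continuous_strip {0..} g"
  proof -
    have "continuous_on ({0..} \<times> UNIV) (\<lambda>(s, a). uxc s (Z s a))"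
      unfolding split_beta'
      by (rule continuous_on_slice[OF uxc_cont]) (use Z_cont in \<open>auto intro!: continuous_intros simp: split_beta'\<close>)
    from continuous_on_integral_upto[OF this] have "continuous_on ({0..} \<times> UNIV) (\<lambda>(t, a). integral {0..t} (\<lambda>s. uxc s (Z s a)))" by auto
    then show ?thesis
      unfolding g_def split_beta' by (intro continuous_intros)
  qed
  have g_cont_space: "continuous_on UNIV (g t)" if "0 \<le> t" for t
    by (rule continuous_on_slice[OF g_cont, where h="\<lambda>a. a" and g="\<lambda>_. t"]) (use that in \<open>auto intro: continuous_on_id continuous_on_const\<close>)
  have Z_surj: "surj (Z t)" if "0 \<le> t" for t
    by (rule surj_if_deriv_ge[OF Za[OF that] g_bounds(1)[of t t]]) (use that in auto)
  have Z_mono: "Z t a < Z t b" if "0 \<le> t" "a < b" for t a b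
    by (rule DERIV_pos_imp_increasing[OF that(2)]) (use Za[OF that(1)] gpos in blast)
  have Zm: "Z t \<in> borel_measurable borel" if "0 \<le> t" for t
    using Za[OF that] by (intro borel_measurable_continuous_onI) (auto simp: continuous_on_eq_continuous_at intro: DERIV_isCont)
  have um: "u t \<in> borel_measurable borel" "rho t \<in> borel_measurable borel" if "t \<in> time_dom T" for t
    using borel_measurable_continuous_onI[OF continuous_on_UNIV_if_deriv[OF ux[OF that]]]
      borel_measurable_continuous_onI[OF continuous_on_UNIV_if_deriv[OF rx[OF that]]] by auto

  have int_at: "at t within {0..} = at t" if "0 < t" for t :: real
    using that by (intro at_within_interior) auto
  have mass: "rho t (Z t a) * g t a = rho0 a" if t: "t \<in> {0..\<tau>}" for t a
  proof -
    define h where "h s = rho s (Z s a) * g s a" for s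
    define h' where "h' s = (rt s (Z s a) + rx s (Z s a) * u s (Z s a)) * g s a + uxc s (Z s a) * g s a * rho s (Z s a)" for s
    have hd: "(h has_real_derivative h' s) (at s within {0..})" if s: "s \<in> {0..\<tau>}" for s
    proof -
      have w: "at s within time_dom T = at s within {0..}" by (rule at_within_time_dom[OF td[OF s]])
      have "((\<lambda>s. rho s (Z s a)) has_real_derivative rt s (Z s a) + rx s (Z s a) * u s (Z s a)) (at s within time_dom T)"
      proof (rule DERIV_along_curve[OF rt[OF td[OF s]] td[OF s] rx rx_cont])
        show "((\<lambda>s. Z s a) has_real_derivative u s (Z s a)) (at s within time_dom T)"
          using Zt[of s a] s cl_id[of s] by (simp add: w uc_def)
      qed
      then show ?thesis
        unfolding h_def h'_def using s by (intro DERIV_mult gt) (auto simp: w)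
    qed
    have h'0: "h' s = 0" if s: "0 < s" "s < \<tau>" for s
    proof -
      have sd: "s \<in> time_dom T" using s by (intro td) auto
      let ?x = "Z s a"
      have "((\<lambda>s. rho s ?x) has_real_derivative rt s ?x) (at s)"
        using rt[OF sd, of ?x] by (simp add: at_within_time_dom[OF sd] int_at s)
      moreover have "((\<lambda>y. rho s y * u s y) has_real_derivative rx s ?x * u s ?x + ux s ?x * rho s ?x) (at ?x)"
        by (intro DERIV_mult rx ux sd)
      ultimately have "rt s ?x + (rx s ?x * u s ?x + ux s ?x * rho s ?x) = 0"
        using mass_eq[OF sd s(1), of ?x] by (simp add: DERIV_imp_deriv)
      moreover have "uxc s ?x = ux s ?x" using s by (simp add: uxc_def cl_id)
      ultimately have "(rt s ?x + rx s ?x * u s ?x) + uxc s ?x * rho s ?x = 0" by simp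
      then have "((rt s ?x + rx s ?x * u s ?x) + uxc s ?x * rho s ?x) * g s a = 0" by simp
      then show ?thesis unfolding h'_def by (simp add: algebra_simps)
    qed
    have "\<bar>h t - h 0\<bar> \<le> (\<lambda>_. 0) t - (\<lambda>_. 0 :: real) 0"
      by (rule real_derivative_bound[where \<tau>=\<tau> and h=h and p="\<lambda>_. 0" and p'="\<lambda>_. 0", OF hd])
        (use h'0 t in \<open>auto intro: DERIV_const\<close>)
    then show ?thesis by (simp add: h_def Z0 g0 init)
  qed

  have change: "(LINT x|lborel. f x) = (LINT c|lborel. f (Z t c) * g t c)"
    if "0 \<le> t" "f \<in> borel_measurable borel" for t and f :: "real \<Rightarrow> real"
    using change_of_variables_UNIV(2)[OF Za[OF that(1)] gpos g_cont_space[OF that(1)] Z_surj[OF that(1)] that(2)] by auto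

  define v where "v t a = u t (Z t a)" for t a
  define acc where "acc t a = ut t (Z t a) + ux t (Z t a) * u t (Z t a)" for t a
  have Ztv: "((\<lambda>s. Z s a) has_real_derivative v t a) (at t within {0..})" if "t \<in> {0..\<tau>}" for t a
    using Zt[of t a] that by (simp add: v_def uc_def cl_id)
  have vm: "v t \<in> borel_measurable borel" if "t \<in> {0..\<tau>}" for t
    unfolding v_def using Zm[of t] um(1)[OF td[OF that]] that by (auto intro: measurable_compose)
  have vt: "((\<lambda>s. v s a) has_real_derivative acc t a) (at t within {0..})" if t: "t \<in> {0..\<tau>}" for t a
  proof -
    have w: "at t within time_dom T = at t within {0..}" by (rule at_within_time_dom[OF td[OF t]])
    have "((\<lambda>s. u s (Z s a)) has_real_derivative ut t (Z t a) + ux t (Z t a) * u t (Z t a)) (at t within time_dom T)"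
      by (rule DERIV_along_curve[OF ut[OF td[OF t]] td[OF t] ux ux_cont]) (use Ztv[OF t, of a] in \<open>simp_all add: w v_def\<close>)
    then show ?thesis by (simp add: w v_def acc_def)
  qed
  \<comment> \<open>Besides the formula a crude bound is needed: by Gronwall's inequality it puts
    \<open>v\<close>, and hence \<open>Z\<close>, into the class bounded by \<open>w\<close>, in
    which \<open>S\<close> may be differentiated along \<open>Z\<close>.\<close>
  have acc_eq: "acc t a = F a - (LINT c|D. psi (Z t a - Z t c) * (v t a - v t c))"
    and acc_le: "\<bar>acc t a\<bar> \<le> M * \<bar>v t a\<bar> + (\<bar>k\<bar> + M * C)"
    if t: "0 < t" "t < \<tau>" for t a
  proof -
    have t': "t \<in> {0..\<tau>}" "0 \<le> t" using t by auto
    have sd: "t \<in> time_dom T" by (rule td[OF t'(1)])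
    have [measurable]: "u t \<in> borel_measurable borel" "rho t \<in> borel_measurable borel" "Z t \<in> borel_measurable borel"
      "v t \<in> borel_measurable borel"
      using um[OF sd] Zm[OF t'(2)] vm[OF t'(1)] by auto
    let ?x = "Z t a"
    let ?I = "LINT y|lborel. psi (?x - y) * (u t y - u t ?x) * rho t y"
    have "((\<lambda>s. u s ?x) has_real_derivative ut t ?x) (at t)"
      using ut[OF sd, of ?x] by (simp add: at_within_time_dom[OF sd] int_at t)
    then have "acc t a = - k * deriv (phi t) ?x + ?I"
      using mom_eq[OF sd t(1), of ?x] DERIV_imp_deriv[OF ux[OF sd, of ?x]]
      by (simp add: DERIV_imp_deriv acc_def mult.commute)
    also have "deriv (phi t) ?x = 1/2 * (LINT y|lborel. sgn (?x - y) * rho t y)"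
      by (rule DERIV_imp_deriv[OF phi[OF sd t(1)]])
    also have "(LINT y|lborel. sgn (?x - y) * rho t y) = (LINT c|lborel. sgn (?x - Z t c) * rho t (Z t c) * g t c)"
      by (rule change[OF t'(2)]) measurable
    also have "\<dots> = (LINT c|D. sgn (a - c))"
    proof -
      have "sgn (?x - Z t c) = sgn (a - c)" for c
        using Z_mono[OF t'(2), of a c] Z_mono[OF t'(2), of c a] by (cases a c rule: linorder_cases) auto
      then show ?thesis by (simp add: integral_D mult.assoc mass[OF t'(1)]) (simp add: mult.commute)
    qed
    finally have accI: "acc t a = F a + ?I" by (simp add: F_def)
    have "?I = (LINT c|lborel. psi (?x - Z t c) * (u t (Z t c) - u t ?x) * rho t (Z t c) * g t c)"
      by (rule change[OF t'(2)]) measurable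
    also have "\<dots> = (LINT c|lborel. rho0 c * (psi (?x - Z t c) * (v t c - v t a)))"
      by (rule Bochner_Integration.integral_cong[OF refl])
        (simp add: v_def mult.assoc mass[OF t'(1)]; simp add: mult_ac)
    also have "\<dots> = (LINT c|D. psi (?x - Z t c) * (v t c - v t a))" by (simp add: integral_D)
    also have "\<dots> = (LINT c|D. - (psi (?x - Z t c) * (v t a - v t c)))"
      by (rule Bochner_Integration.integral_cong[OF refl]) (simp add: algebra_simps)
    also have "\<dots> = - (LINT c|D. psi (?x - Z t c) * (v t a - v t c))" by simp
    finally show "acc t a = F a - (LINT c|D. psi (?x - Z t c) * (v t a - v t c))" using accI by simp
    have rn: "0 \<le> rho t y" for y using prob(1)[OF sd] by (simp add: prob_density_def)
    have ir: "integrable lborel (rho t)" "(LINT y|lborel. rho t y) = 1" using prob(1)[OF sd] by (auto simp: prob_density_def)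
    have ia: "integrable lborel (\<lambda>y. \<bar>u t y\<bar> * rho t y)"
      using integrable_abs[OF prob(2)[OF sd]] rn by (simp add: abs_mult)
    have pw: "\<bar>psi (?x - y) * (u t y - u t ?x) * rho t y\<bar> \<le> M * (\<bar>u t y\<bar> * rho t y + \<bar>u t ?x\<bar> * rho t y)" for y
    proof -
      have "\<bar>psi (?x - y)\<bar> * \<bar>u t y - u t ?x\<bar> \<le> M * (\<bar>u t y\<bar> + \<bar>u t ?x\<bar>)"
        by (intro mult_mono psi_abs_le) (use M in auto)
      from mult_right_mono[OF this rn[of y]] show ?thesis
        unfolding abs_mult abs_of_nonneg[OF rn] by (simp add: distrib_left distrib_right mult_ac)
    qed
    have "\<bar>?I\<bar> \<le> (LINT y|lborel. \<bar>psi (?x - y) * (u t y - u t ?x) * rho t y\<bar>)" by (rule integral_abs_bound)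
    also have "\<dots> \<le> (LINT y|lborel. M * (\<bar>u t y\<bar> * rho t y + \<bar>u t ?x\<bar> * rho t y))"
    proof (rule integral_mono[OF _ _ pw])
      show int: "integrable lborel (\<lambda>y. M * (\<bar>u t y\<bar> * rho t y + \<bar>u t ?x\<bar> * rho t y))"
        using ia ir by auto
      show "integrable lborel (\<lambda>y. \<bar>psi (?x - y) * (u t y - u t ?x) * rho t y\<bar>)"
        by (rule Bochner_Integration.integrable_bound[OF int]) (use pw in \<open>auto intro: order_trans[OF _ abs_ge_self]\<close>)
    qed
    also have "\<dots> = M * ((LINT y|lborel. \<bar>u t y\<bar> * rho t y) + \<bar>u t ?x\<bar>)"
      using ia ir by simp
    also have "\<dots> \<le> M * (C + \<bar>v t a\<bar>)"
      using C(2)[OF t'(1)] M by (intro mult_left_mono) (auto simp: v_def)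
    finally have "\<bar>?I\<bar> \<le> M * C + M * \<bar>v t a\<bar>" by (simp add: algebra_simps)
    then show "\<bar>acc t a\<bar> \<le> M * \<bar>v t a\<bar> + (\<bar>k\<bar> + M * C)" using accI F_le[of a] by linarith
  qed
  define E where "E = (1 + (\<bar>k\<bar> + M * C)) * exp ((M + 1) * (\<tau> + 1))"
  have kMC: "0 \<le> \<bar>k\<bar> + M * C" using M C0 by simp
  have vb: "\<bar>v t a\<bar> \<le> E * w a" if t: "t \<in> {0..\<tau>}" for t a
  proof -
    have "\<bar>v t a\<bar> \<le> (\<bar>v 0 a\<bar> + (\<bar>k\<bar> + M * C)) * exp ((M + 1) * (\<tau> + 1))"
      by (rule gronwall_abs[where y="\<lambda>s. v s a" and y'="\<lambda>s. acc s a", OF vt]) (use acc_le M kMC t in auto)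
    also have "\<dots> \<le> ((1 + (\<bar>k\<bar> + M * C)) * w a) * exp ((M + 1) * (\<tau> + 1))"
    proof (rule mult_right_mono)
      have "v 0 a = u0 a" by (simp add: v_def init Z0)
      moreover have "(\<bar>k\<bar> + M * C) * 1 \<le> (\<bar>k\<bar> + M * C) * w a" using kMC w_ge1 by (intro mult_left_mono) auto
      ultimately show "\<bar>v 0 a\<bar> + (\<bar>k\<bar> + M * C) \<le> (1 + (\<bar>k\<bar> + M * C)) * w a"
        by (simp add: distrib_right) (simp add: w_def)
    qed simp
    finally show ?thesis by (simp add: E_def mult_ac)
  qed
  have E0: "0 \<le> E" using kMC by (simp add: E_def)
  have Zb: "\<bar>Z t a - a\<bar> \<le> E * \<tau> * w a" if t: "t \<in> {0..\<tau>}" for t a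
  proof -
    have "\<bar>(\<lambda>s. Z s a) t - (\<lambda>s. Z s a) 0\<bar> \<le> (\<lambda>s. E * w a * s) t - (\<lambda>s. E * w a * s) 0"
      by (rule real_derivative_bound[where \<tau>=\<tau> and h="\<lambda>s. Z s a" and p="\<lambda>s. E * w a * s" and p'="\<lambda>_. E * w a", OF Ztv])
        (use vb t in \<open>auto intro!: derivative_eq_intros\<close>)
    also have "\<dots> \<le> E * w a * \<tau>" using t E0 w_pos[of a] by (auto intro!: mult_left_mono)
    finally show ?thesis by (simp add: Z0 mult_ac)
  qed
  have v_eq: "v t a = u0 a + t * F a - S (Z t) a" if t: "0 \<le> t" "t < \<tau>" for t a
  proof -
    \<comment> \<open>The defect of the integrated momentum equation: it vanishes at 0, and
      \<open>acc_eq\<close> says that its derivative is 0.\<close>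
    define h where "h s = v s a - (u0 a + s * F a - S (Z s) a)" for s
    define h' where "h' s = acc s a - (F a - (LINT c|D. psi (Z s a - Z s c) * (v s a - v s c)))" for s
    have hd: "(h has_real_derivative h' s) (at s within {0..})" if s: "s \<in> {0..t}" for s
    proof -
      have S': "((\<lambda>s. S (Z s) a) has_real_derivative (LINT c|D. psi (Z s a - Z s c) * (v s a - v s c))) (at s within {0..})"
        by (rule S_deriv[where \<tau>=\<tau> and v=v, OF Ztv Zm Zb vm vb]) (use s t in auto)
      have vs: "((\<lambda>s. v s a) has_real_derivative acc s a) (at s within {0..})" using s t by (intro vt) auto
      show ?thesis unfolding h_def h'_def
        by (rule derivative_eq_intros S' vs refl | simp)+
    qed
    have "\<bar>h t - h 0\<bar> \<le> (\<lambda>_. 0) t - (\<lambda>_. 0 :: real) 0"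
      by (rule real_derivative_bound[where \<tau>=t and h=h and p="\<lambda>_. 0" and p'="\<lambda>_. 0", OF hd])
        (use acc_eq t in \<open>auto intro: DERIV_const simp: h'_def\<close>)
    moreover have "S (Z 0) a = 0" by (simp add: S_def Z0)
    moreover have "v 0 a = u0 a" by (simp add: v_def init Z0)
    ultimately show ?thesis by (simp add: h_def)
  qed
  have ZX: "Z t a = X t a" if t: "0 \<le> t" "t < \<tau>" for t a
  proof (rule flow_unique[where Z=Z and \<tau>=t and K="E * \<tau>", OF flow_X Z0])
    fix s b assume s: "s \<in> {0..t}"
    show "Z s \<in> borel_measurable borel" using s by (intro Zm) auto
    show "\<bar>Z s b - b\<bar> \<le> E * \<tau> * w b" using s t by (intro Zb) auto
    show "((\<lambda>s. Z s b) has_real_derivative u0 b + s * F b - S (Z s) b) (at s within {0..})"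
      using Ztv[of s b] v_eq[of s b] s t by auto
  qed (use t in auto)
  have gG: "g t a = G t a" if t: "0 \<le> t" "t < \<tau>" for t a
  proof -
    have "Z t = X t" using ZX[OF t] by auto
    then show ?thesis using Za[OF t(1), of a] X_deriv_space[OF t(1), of a] DERIV_unique by metis
  qed
  show thesis
  proof (rule that[of "exp (- (C * \<tau>))"])
    fix t a :: real assume t: "0 \<le> t" "t < \<tau>"
    show "exp (- (C * \<tau>)) \<le> G t a" using g_bounds(1)[of t \<tau> a] gG[OF t, of a] t by auto
    show "u t (X t a) = V t a"
    proof -
      have "Z t = X t" using ZX[OF t] by auto
      then show ?thesis using v_eq[OF t, of a] by (simp add: v_def V_def)
    qed
    show "rho t (X t a) * G t a = rho0 a" using mass[of t a] gG[OF t, of a] ZX[OF t, of a] t by auto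
  qed simp
qed

text \<open>Time domains are half-open, so a later time \<open>b\<close> in the domain exists and
  the strip result, strict at its right end, reaches \<open>t\<close> itself.\<close>

lemma classical_solution_lagrangian:
  assumes sol: "classical_solution psi k rho0 u0 T rho u" and t: "t \<in> time_dom T"
  shows "u t (X t a) = V t a" "rho t (X t a) * G t a = rho0 a" "\<exists>c>0. \<forall>s\<in>{0..t}. \<forall>a. c \<le> G s a"
proof -
  obtain b where b: "t < b" "b \<in> time_dom T" using time_dom_dense[OF t] .
  have t0: "0 \<le> t" using t by (simp add: time_dom_def)
  show "u t (X t a) = V t a" "rho t (X t a) * G t a = rho0 a" "\<exists>c>0. \<forall>s\<in>{0..t}. \<forall>a. c \<le> G s a"
    using classical_solution_on_strip[OF sol b(2)] b(1) t0 by (metis atLeastAtMost_iff le_less_trans)+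
qed

end

section \<open>Spatial regularity of the Eulerian density\<close>

context epa_data
begin

text \<open>
  \<open>WD J f\<close>: differentiability in the label on \<open>J \<times> \<real>\<close>, relative to the weight \<open>\<rho>\<^sub>0\<close>. As \<open>u\<^sub>0\<close>
  is only \<open>C\<^sup>1\<close>, the function \<open>e\<^sub>0\<close> need not be differentiable; what makes \<open>\<rho> = \<rho>\<^sub>0 / G\<close> a
  \<open>C\<^sup>1\<close> function is that \<open>\<rho>\<^sub>0 e\<^sub>0\<close> is \<open>C\<^sup>1\<close>, and this is inherited from any local classical solution.
\<close>

definition WD :: "real set \<Rightarrow> (real \<Rightarrow> real \<Rightarrow> real) \<Rightarrow> bool" where
  "WD J f \<longleftrightarrow> continuous_strip J f \<and>
     (\<exists>f'. continuous_strip J f' \<and>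
        (\<forall>t\<in>J. \<forall>a. ((\<lambda>x. rho0 x * f t x) has_real_derivative f' t a) (at a)))"

lemma WD_I:
  assumes "continuous_strip J f" "continuous_strip J f'"
    "\<And>t a. t \<in> J \<Longrightarrow> ((\<lambda>x. rho0 x * f t x) has_real_derivative f' t a) (at a)"
  shows "WD J f"
  using assms unfolding WD_def by blast

lemma WD_E:
  assumes "WD J f"
  obtains f' where "continuous_strip J f" "continuous_strip J f'"
    "\<And>t a. t \<in> J \<Longrightarrow> ((\<lambda>x. rho0 x * f t x) has_real_derivative f' t a) (at a)"
  using assms unfolding WD_def by blast

lemma WD_isCont: "WD J f \<Longrightarrow> t \<in> J \<Longrightarrow> isCont (f t) a"
  using continuous_on_space_slice[of J f t] by (simp add: WD_def continuous_on_eq_continuous_at)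

lemma WD_cong:
  assumes f: "WD J f" and eq: "\<And>t a. t \<in> J \<Longrightarrow> f t a = g t a"
  shows "WD J g"
proof -
  obtain f' where f': "continuous_strip J f" "continuous_strip J f'"
    "\<And>t a. t \<in> J \<Longrightarrow> ((\<lambda>x. rho0 x * f t x) has_real_derivative f' t a) (at a)"
    using WD_E[OF f] by metis
  show ?thesis
  proof (rule WD_I[OF _ f'(2)])
    show "continuous_strip J g"
      using f'(1) by (subst continuous_on_cong[OF refl, where g="\<lambda>(t, a). f t a"]) (auto simp: eq)
    show "((\<lambda>x. rho0 x * g t x) has_real_derivative f' t a) (at a)" if "t \<in> J" for t a
      using f'(3)[OF that, of a] by (simp add: eq[OF that])
  qed
qed

lemma WD_add:
  assumes f: "WD J f" and g: "WD J g"
  shows "WD J (\<lambda>t a. f t a + g t a)"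
proof -
  obtain f' where f': "continuous_strip J f" "continuous_strip J f'"
    "\<And>t a. t \<in> J \<Longrightarrow> ((\<lambda>x. rho0 x * f t x) has_real_derivative f' t a) (at a)"
    using WD_E[OF f] by metis
  obtain g' where g': "continuous_strip J g" "continuous_strip J g'"
    "\<And>t a. t \<in> J \<Longrightarrow> ((\<lambda>x. rho0 x * g t x) has_real_derivative g' t a) (at a)"
    using WD_E[OF g] by metis
  show ?thesis
  proof (rule WD_I[where f'="\<lambda>t a. f' t a + g' t a"])
    show "((\<lambda>x. rho0 x * (f t x + g t x)) has_real_derivative f' t a + g' t a) (at a)" if "t \<in> J" for t a
      unfolding distrib_left by (intro DERIV_add f'(3) g'(3) that)
  qed (use f'(1,2) g'(1,2) in \<open>auto simp: split_beta' intro!: continuous_on_add\<close>)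
qed

lemma WD_mult:
  assumes f: "WD J f" and g: "WD J g"
  shows "WD J (\<lambda>t a. f t a * g t a)"
proof -
  obtain f' where f': "continuous_strip J f" "continuous_strip J f'"
    "\<And>t a. t \<in> J \<Longrightarrow> ((\<lambda>x. rho0 x * f t x) has_real_derivative f' t a) (at a)"
    using WD_E[OF f] by metis
  obtain g' where g': "continuous_strip J g" "continuous_strip J g'"
    "\<And>t a. t \<in> J \<Longrightarrow> ((\<lambda>x. rho0 x * g t x) has_real_derivative g' t a) (at a)"
    using WD_E[OF g] by metis
  show ?thesis
  proof (rule WD_I[where f'="\<lambda>t a. f' t a * g t a + f t a * g' t a - rho0' a * f t a * g t a"])
    show "((\<lambda>x. rho0 x * (f t x * g t x)) has_real_derivative
        f' t a * g t a + f t a * g' t a - rho0' a * f t a * g t a) (at a)" if "t \<in> J" for t a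
      by (intro weighted_deriv_mult rho0_deriv f'(3) g'(3) WD_isCont[OF f] WD_isCont[OF g] that)
    show "continuous_on (J \<times> UNIV) (\<lambda>(t, a). f t a * g t a)"
      using f'(1) g'(1) by (auto simp: split_beta' intro!: continuous_on_mult)
    show "continuous_on (J \<times> UNIV) (\<lambda>(t, a). f' t a * g t a + f t a * g' t a - rho0' a * f t a * g t a)"
      using f'(1,2) g'(1,2) unfolding split_beta'
      by (intro continuous_intros continuous_on_snd_comp rho0'_cont)
  qed
qed

lemma WD_inverse:
  assumes f: "WD J f" and nz: "\<And>t a. t \<in> J \<Longrightarrow> f t a \<noteq> 0"
  shows "WD J (\<lambda>t a. inverse (f t a))"
proof -
  obtain f' where f': "continuous_strip J f" "continuous_strip J f'"
    "\<And>t a. t \<in> J \<Longrightarrow> ((\<lambda>x. rho0 x * f t x) has_real_derivative f' t a) (at a)"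
    using WD_E[OF f] by metis
  show ?thesis
  proof (rule WD_I[where f'="\<lambda>t a. 2 * rho0' a / f t a - f' t a / (f t a)\<^sup>2"])
    show "((\<lambda>x. rho0 x * inverse (f t x)) has_real_derivative 2 * rho0' a / f t a - f' t a / (f t a)\<^sup>2) (at a)"
      if "t \<in> J" for t a
      by (intro weighted_deriv_inverse rho0_deriv f'(3) WD_isCont[OF f] nz that)
    show "continuous_on (J \<times> UNIV) (\<lambda>(t, a). inverse (f t a))"
      using f'(1) nz by (auto simp: split_beta' intro!: continuous_on_inverse)
    show "continuous_on (J \<times> UNIV) (\<lambda>(t, a). 2 * rho0' a / f t a - f' t a / (f t a)\<^sup>2)"
      using f'(1,2) nz unfolding split_beta'
      by (intro continuous_intros continuous_on_snd_comp rho0'_cont) auto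
  qed
qed

lemma WD_C1:
  assumes c: "continuous_strip J f" "continuous_strip J fa"
    and d: "\<And>t a. t \<in> J \<Longrightarrow> (f t has_real_derivative fa t a) (at a)"
  shows "WD J f"
proof (rule WD_I[where f'="\<lambda>t a. rho0' a * f t a + fa t a * rho0 a", OF c(1)])
  show "((\<lambda>x. rho0 x * f t x) has_real_derivative rho0' a * f t a + fa t a * rho0 a) (at a)" if "t \<in> J" for t a
    by (intro DERIV_mult rho0_deriv d that)
  show "continuous_on (J \<times> UNIV) (\<lambda>(t, a). rho0' a * f t a + fa t a * rho0 a)"
    using c unfolding split_beta' by (intro continuous_intros continuous_on_snd_comp rho0'_cont rho0_cont)
qed

lemma WD_const: "WD J (\<lambda>_ _. c)"
  by (rule WD_C1[where fa="\<lambda>_ _. 0"]) (auto simp: split_beta')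

lemma WD_rho0: "WD J (\<lambda>_. rho0)"
  by (rule WD_C1[where fa="\<lambda>_. rho0'"])
    (auto simp: split_beta' intro!: rho0_deriv continuous_on_snd_comp rho0_cont rho0'_cont)

lemma WD_subset: "WD J f \<Longrightarrow> J' \<subseteq> J \<Longrightarrow> WD J' f"
  unfolding WD_def by (meson Sigma_mono continuous_on_subset subsetD subset_refl)

text \<open>Passes from a single positive time, where a local solution gives information on
  \<open>e0\<close>, to every strip.\<close>

lemma WD_time_independent:
  assumes "WD J (\<lambda>_. f)" "t \<in> J"
  shows "WD J' (\<lambda>_. f)"
proof -
  obtain f' where f': "continuous_on (J \<times> UNIV) (\<lambda>(t, a). (\<lambda>_. f) t a)" "continuous_strip J f'"
    "\<And>t a. t \<in> J \<Longrightarrow> ((\<lambda>x. rho0 x * (\<lambda>_. f) t x) has_real_derivative f' t a) (at a)"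
    using WD_E[OF assms(1)] by (metis (no_types))
  show ?thesis
  proof (rule WD_I[where f'="\<lambda>_. f' t"])
    have "continuous_on UNIV f" by (rule continuous_on_space_slice[OF f'(1) assms(2)])
    then show "continuous_on (J' \<times> UNIV) (\<lambda>(t, a). f a)"
      unfolding split_beta' by (rule continuous_on_snd_comp)
    show "continuous_on (J' \<times> UNIV) (\<lambda>(_, a). f' t a)"
      unfolding split_beta' by (rule continuous_on_snd_comp[OF continuous_on_space_slice[OF f'(2) assms(2)]])
    show "((\<lambda>x. rho0 x * f x) has_real_derivative f' t a) (at a)" for a using f'(3)[OF assms(2)] by simp
  qed
qed

end

section \<open>The inverse flow and the Eulerian fields\<close>

locale epa_pos = epa_flow +
  fixes T :: ereal
  assumes T_pos: "0 < T"
    and G_lower: "\<And>\<tau>. \<tau> \<in> time_dom T \<Longrightarrow> \<exists>c>0. \<forall>s\<in>{0..\<tau>}. \<forall>a. c \<le> G s a"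
begin

definition A :: "real \<Rightarrow> real \<Rightarrow> real" where "A t x = inv (X t) x"
definition rhoE :: "real \<Rightarrow> real \<Rightarrow> real" where "rhoE t x = rho0 (A t x) / G t (A t x)"
definition uE :: "real \<Rightarrow> real \<Rightarrow> real" where "uE t x = V t (A t x)"
text \<open>Candidate for the space derivative of \<open>Q\<close>, that is
  \<open>\<psi>' \<star> \<rho>\<close>, written over the labels.\<close>

definition R :: "real \<Rightarrow> real \<Rightarrow> real" where "R t x = (LINT c|D. psi' (x - X t c))"
definition qa :: "real \<Rightarrow> real \<Rightarrow> real" where "qa t a = R t (X t a) * G t a"
definition qta :: "real \<Rightarrow> real \<Rightarrow> real" where "qta t a = integral {0..t} (\<lambda>s. qa s a)"

lemma time_nonneg: "t \<in> time_dom T \<Longrightarrow> 0 \<le> t" by (simp add: time_dom_def)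

lemma zero_time: "0 \<in> time_dom T" using T_pos by (simp add: time_dom_def zero_ereal_def)

lemma time_dom_closed: "t \<in> time_dom T \<Longrightarrow> {0..t} \<subseteq> time_dom T" "time_dom T \<subseteq> {0..}"
  using time_dom_downward[of t T] by (auto simp: time_dom_def[of T])

lemma on_time_dom: "continuous_on ({0..} \<times> UNIV) f \<Longrightarrow> continuous_on (time_dom T \<times> UNIV) f"
  by (erule continuous_on_subset) (auto simp: time_dom_def)

lemma G_pos:
  assumes t: "t \<in> time_dom T"
  shows "0 < G t a"
proof -
  obtain c where "0 < c" "\<forall>s\<in>{0..t}. \<forall>a. c \<le> G s a" using G_lower[OF t] by blast
  then show ?thesis using time_nonneg[OF t] less_le_trans[of 0 c "G t a"] by auto
qed

lemma X_mono:
  assumes t: "t \<in> time_dom T"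
  shows "strict_mono (X t)"
proof (rule strict_monoI)
  fix a b :: real assume "a < b"
  then show "X t a < X t b"
    by (rule DERIV_pos_imp_increasing) (use X_deriv_space[OF time_nonneg[OF t]] G_pos[OF t] in blast)
qed

lemma X_surj: "t \<in> time_dom T \<Longrightarrow> surj (X t)"
proof -
  assume t: "t \<in> time_dom T"
  obtain c where c: "0 < c" "\<forall>s\<in>{0..t}. \<forall>a. c \<le> G s a" using G_lower[OF t] by blast
  show ?thesis
    by (rule surj_if_deriv_ge[OF X_deriv_space _ c(1)]) (use c(2) time_nonneg[OF t] in auto)
qed

lemma X_A: "t \<in> time_dom T \<Longrightarrow> X t (A t x) = x"
  unfolding A_def by (rule surj_f_inv_f[OF X_surj])

lemma A_X: "t \<in> time_dom T \<Longrightarrow> A t (X t a) = a"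
  unfolding A_def by (rule inv_f_f[OF strict_mono_imp_inj_on[OF X_mono]])

lemma A_0[simp]: "A 0 x = x" using X_A[OF zero_time, of x] by simp

lemma A_cont: "continuous_strip (time_dom T) A"
  by (rule inverse_jointly_continuous[OF on_time_dom[OF X_cont] X_mono X_A])

lemma along_A:
  assumes "continuous_strip (time_dom T) f"
  shows "continuous_on (time_dom T \<times> UNIV) (\<lambda>(t, x). f t (A t x))"
  unfolding split_beta'
  by (rule continuous_on_slice[OF assms]) (use A_cont in \<open>auto intro!: continuous_intros simp: split_beta'\<close>)

lemma A_deriv_space:
  assumes t: "t \<in> time_dom T"
  shows "(A t has_real_derivative inverse (G t (A t x))) (at x)"
proof (rule DERIV_inverse_function[where f="X t" and a="x-1" and b="x+1"])
  show "(X t has_real_derivative G t (A t x)) (at (A t x))" by (rule X_deriv_space[OF time_nonneg[OF t]])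
  show "G t (A t x) \<noteq> 0" using G_pos[OF t, of "A t x"] by simp
  show "isCont (A t) x"
    using continuous_on_space_slice[OF A_cont t] by (simp add: continuous_on_eq_continuous_at)
qed (auto simp: X_A[OF t])

lemma A_deriv_time:
  assumes t: "t \<in> time_dom T"
  shows "((\<lambda>s. A s x) has_real_derivative - V t (A t x) / G t (A t x)) (at t within time_dom T)"
proof (rule inverse_time_deriv[where X=X and x=x])
  show "continuous (at t within time_dom T) (\<lambda>s. A s x)"
  proof -
    have "continuous_on (time_dom T) (\<lambda>s. A s x)"
      by (rule continuous_on_slice[OF A_cont]) (auto intro: continuous_on_id continuous_on_const)
    then show ?thesis using t by (simp add: continuous_on_eq_continuous_within)
  qed
  show "((\<lambda>s. X s (A t x)) has_real_derivative V t (A t x)) (at t within time_dom T)"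
    using X_deriv[OF time_nonneg[OF t]] by (simp add: at_within_time_dom[OF t])
  show "continuous_strip (time_dom T) G" by (rule on_time_dom[OF G_cont])
qed (use t time_nonneg G_pos[OF t, of "A t x"] in \<open>auto simp: X_A intro: X_deriv_space\<close>)

lemma along_A_derivs:
  assumes ft: "\<And>t a. t \<in> time_dom T \<Longrightarrow> ((\<lambda>s. f s a) has_real_derivative ft t a) (at t within {0..})"
    and fa: "\<And>t a. t \<in> time_dom T \<Longrightarrow> (f t has_real_derivative fa t a) (at a)"
    and cont: "continuous_strip (time_dom T) fa"
    and t: "t \<in> time_dom T"
  shows "((\<lambda>s. f s (A s x)) has_real_derivative ft t (A t x) - fa t (A t x) * V t (A t x) / G t (A t x)) (at t within time_dom T)"
    and "((\<lambda>x. f t (A t x)) has_real_derivative fa t (A t x) / G t (A t x)) (at x)"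
proof -
  have "((\<lambda>s. f s (A t x)) has_real_derivative ft t (A t x)) (at t within time_dom T)"
    using ft[OF t] by (simp add: at_within_time_dom[OF t])
  from DERIV_along_curve[OF this t fa cont A_deriv_time[OF t]]
  show "((\<lambda>s. f s (A s x)) has_real_derivative ft t (A t x) - fa t (A t x) * V t (A t x) / G t (A t x)) (at t within time_dom T)"
    by simp
  show "((\<lambda>x. f t (A t x)) has_real_derivative fa t (A t x) / G t (A t x)) (at x)"
    using DERIV_chain2[OF fa[OF t] A_deriv_space[OF t]] by (simp add: divide_inverse)
qed

lemma C1_slab_along_A:
  assumes ft: "\<And>t a. t \<in> time_dom T \<Longrightarrow> ((\<lambda>s. f s a) has_real_derivative ft t a) (at t within {0..})"
    and fa: "\<And>t a. t \<in> time_dom T \<Longrightarrow> (f t has_real_derivative fa t a) (at a)"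
    and ct: "continuous_strip (time_dom T) ft"
    and ca: "continuous_strip (time_dom T) fa"
  shows "C1_slab T (\<lambda>t x. f t (A t x))"
  unfolding C1_slab_def
proof (intro exI conjI ballI allI)
  note * = along_A[OF ct] along_A[OF ca] along_A[OF on_time_dom[OF V_cont]] along_A[OF on_time_dom[OF G_cont]]
  have nz: "G t (A t x) \<noteq> 0" if "t \<in> time_dom T" for t x using G_pos[OF that, of "A t x"] by simp
  show "continuous_on (time_dom T \<times> UNIV) (\<lambda>(t, x). ft t (A t x) - fa t (A t x) * V t (A t x) / G t (A t x))"
    using * nz unfolding split_beta' by (intro continuous_intros) auto
  show "continuous_on (time_dom T \<times> UNIV) (\<lambda>(t, x). fa t (A t x) / G t (A t x))"
    using * nz unfolding split_beta' by (intro continuous_intros) auto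
  fix t x assume t: "t \<in> time_dom T"
  show "((\<lambda>s. f s (A s x)) has_real_derivative ft t (A t x) - fa t (A t x) * V t (A t x) / G t (A t x)) (at t within time_dom T)"
    by (rule along_A_derivs(1)[OF ft fa ca t])
  show "((\<lambda>x. f t (A t x)) has_real_derivative fa t (A t x) / G t (A t x)) (at x)"
    by (rule along_A_derivs(2)[OF ft fa ca t])
qed

lemma rhoE_cont: "continuous_strip (time_dom T) rhoE"
proof -
  have "continuous_on (time_dom T \<times> UNIV) (\<lambda>(t, a). rho0 a / G t a)"
    using on_time_dom[OF G_cont] G_pos unfolding split_beta'
    by (intro continuous_intros continuous_on_snd_comp rho0_cont) (auto simp: less_imp_neq[symmetric])
  from along_A[OF this] show ?thesis by (simp add: rhoE_def)
qed

lemma rhoE_X: "t \<in> time_dom T \<Longrightarrow> rhoE t (X t a) * G t a = rho0 a"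
  using G_pos[of t a] by (simp add: rhoE_def A_X)

lemma rhoE_nonneg: "t \<in> time_dom T \<Longrightarrow> 0 \<le> rhoE t x"
  using G_pos[of t "A t x"] rho0_nonneg[of "A t x"] by (simp add: rhoE_def)

lemma rhoE_meas: "t \<in> time_dom T \<Longrightarrow> rhoE t \<in> borel_measurable borel"
  by (rule borel_measurable_continuous_onI[OF continuous_on_space_slice[OF rhoE_cont]])

text \<open>The Jacobian of the flow cancels against the density, because
  \<open>rhoE t (X t c) * G t c = rho0 c\<close>. The lemma translates between integrals over
  positions and over labels.\<close>

lemma integral_rhoE:
  assumes t: "t \<in> time_dom T" and f[measurable]: "f \<in> borel_measurable borel"
  shows "integrable lborel (\<lambda>y. f y * rhoE t y) \<longleftrightarrow> integrable D (\<lambda>c. f (X t c))"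
    and "(LINT y|lborel. f y * rhoE t y) = (LINT c|D. f (X t c))"
proof -
  have t0: "0 \<le> t" by (rule time_nonneg[OF t])
  have [measurable]: "rhoE t \<in> borel_measurable borel" "X t \<in> borel_measurable borel"
    using rhoE_meas[OF t] X_meas[OF t0] by auto
  have eq: "f (X t c) * rhoE t (X t c) * G t c = rho0 c * f (X t c)" for c
    by (simp add: mult.assoc rhoE_X[OF t])
  note ch = change_of_variables_UNIV[OF X_deriv_space[OF t0] G_pos[OF t] continuous_on_space_slice[OF on_time_dom[OF G_cont] t]
      X_surj[OF t], of "\<lambda>y. f y * rhoE t y", unfolded eq]
  have m: "(\<lambda>c. f (X t c)) \<in> borel_measurable borel" by measurable
  show "integrable lborel (\<lambda>y. f y * rhoE t y) \<longleftrightarrow> integrable D (\<lambda>c. f (X t c))"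
    using ch(1) by (simp add: integral_D(2)[OF m])
  show "(LINT y|lborel. f y * rhoE t y) = (LINT c|D. f (X t c))"
    using ch(2) by (simp add: integral_D(1)[OF m])
qed

lemma rhoE_prob: "t \<in> time_dom T \<Longrightarrow> prob_density (rhoE t)"
  using integral_rhoE[of t "\<lambda>_. 1"] by (simp add: prob_density_def rhoE_nonneg)

text \<open>The reflection moves the translation from \<open>psi'\<close>, which may be
  discontinuous, to the continuous \<open>rhoE\<close>.\<close>

lemma R_eq: "t \<in> time_dom T \<Longrightarrow> R t x = (LINT z|lborel. psi' z * rhoE t (x - z))"
proof -
  assume t: "t \<in> time_dom T"
  have [measurable]: "rhoE t \<in> borel_measurable borel" by (rule rhoE_meas[OF t])
  have "R t x = (LINT y|lborel. psi' (x - y) * rhoE t y)"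
    unfolding R_def by (rule integral_rhoE(2)[OF t, symmetric]) measurable
  also have "\<dots> = (LINT z|lborel. psi' z * rhoE t (x - z))"
    by (subst lborel_integral_real_affine[where c="-1" and t=x]) auto
  finally show ?thesis .
qed

text \<open>
  Since \<open>\<psi>'\<close> is only bounded and measurable, continuity of \<open>R = \<psi>' \<star> \<rho>\<close> comes from the continuity
  of translates and time slices of \<open>\<rho>\<close> in \<open>L\<^sup>1\<close>: pointwise convergence of probability densities
  implies convergence in \<open>L\<^sup>1\<close>.
\<close>

lemma R_cont: "continuous_strip (time_dom T) R"
  unfolding continuous_on_sequentially comp_def
proof (intro allI ballI impI)
  fix z p assume p: "p \<in> time_dom T \<times> (UNIV :: real set)" and z: "(\<forall>n. z n \<in> time_dom T \<times> (UNIV :: real set)) \<and> z \<longlonglongrightarrow> p"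
  have zt: "fst (z n) \<in> time_dom T" for n using z by (auto simp: mem_Times_iff)
  have pt: "fst p \<in> time_dom T" using p by auto
  have prob: "prob_density (\<lambda>y. rhoE t (x - y))" if t: "t \<in> time_dom T" for t x
  proof -
    have [measurable]: "rhoE t \<in> borel_measurable borel" by (rule rhoE_meas[OF t])
    note r = rhoE_prob[OF t, unfolded prob_density_def]
    have "(LINT y|lborel. rhoE t (x - y)) = (LINT y|lborel. rhoE t y)"
      by (subst (2) lborel_integral_real_affine[where c="-1" and t=x]) auto
    moreover have "integrable lborel (\<lambda>y. rhoE t (x - y))"
      using lborel_integrable_real_affine[of "rhoE t" "-1" x] r by simp
    ultimately show ?thesis using r by (auto simp: prob_density_def)
  qed
  have "(\<lambda>n. LINT y|lborel. psi' y * rhoE (fst (z n)) (snd (z n) - y)) \<longlonglongrightarrow> (LINT y|lborel. psi' y * rhoE (fst p) (snd p - y))"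
  proof (rule tendsto_integral_prob_density[OF prob[OF zt] prob[OF pt] _ psi'_meas psi'_le])
    fix y
    have "continuous_on (time_dom T \<times> UNIV) (\<lambda>z. rhoE (fst z) (snd z - y))"
      by (rule continuous_on_slice[OF rhoE_cont]) (auto intro!: continuous_intros)
    then show "(\<lambda>n. rhoE (fst (z n)) (snd (z n) - y)) \<longlonglongrightarrow> rhoE (fst p) (snd p - y)"
      using p z by (auto simp: continuous_on_sequentially comp_def)
  qed
  then show "(\<lambda>n. case z n of (t, x) \<Rightarrow> R t x) \<longlonglongrightarrow> (case p of (t, x) \<Rightarrow> R t x)"
    by (simp add: split_beta' R_eq[OF zt] R_eq[OF pt])
qed

text \<open>As \<open>psi'\<close> is a derivative only in the integrated sense, \<open>Q\<close> is
  not differentiated under the integral. The increments of \<open>psi\<close> are written as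
  integrals of \<open>psi'\<close>, and Fubini's theorem exchanges them with the average over the
  labels.\<close>

lemma Q_increment:
  assumes t: "t \<in> time_dom T" and ab: "a \<le> b"
  shows "Q t b - Q t a = integral {a..b} (R t)"
proof -
  have [measurable]: "X t \<in> borel_measurable borel" by (rule X_meas[OF time_nonneg[OF t]])
  \<comment> \<open>Lebesgue measure restricted to \<open>{a..b}\<close>: a finite measure, so the
    bounded integrand is integrable on the product.\<close>
  define \<nu> where "\<nu> = density lborel (\<lambda>z. ennreal (indicator {a..b} z))"
  have [measurable_cong]: "sets \<nu> = sets borel" by (simp add: \<nu>_def)
  have i\<nu>: "integral\<^sup>L \<nu> h = (LINT z:{a..b}|lborel. h z)" if [measurable]: "h \<in> borel_measurable borel" for h :: "real \<Rightarrow> real"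
    unfolding \<nu>_def set_lebesgue_integral_def by (subst integral_density) auto
  interpret \<nu>: finite_measure \<nu>
  proof
    have "emeasure \<nu> (space \<nu>) = (\<integral>\<^sup>+z. indicator {a..b} z \<partial>lborel)"
      by (simp add: \<nu>_def emeasure_density ennreal_indicator)
    then show "emeasure \<nu> (space \<nu>) \<noteq> \<infinity>" by (simp add: emeasure_lborel_Icc_eq)
  qed
  interpret P: pair_sigma_finite D \<nu> ..
  interpret PF: finite_measure "D \<Otimes>\<^sub>M \<nu>"
    by (rule finite_measure_pair_measure) unfold_locales
  have shift: "psi (b - y) - psi (a - y) = (LINT z|\<nu>. psi' (z - y))" for y
  proof -
    have "psi (b - y) - psi (a - y) = (LINT z|lborel. indicator {a - y..b - y} z *\<^sub>R psi' z)"
      using psi_diff[of "a - y" "b - y"] ab by (simp add: set_lebesgue_integral_def)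
    also have "\<dots> = (LINT z|lborel. indicator {a - y..b - y} (- y + z) *\<^sub>R psi' (- y + z))"
      by (subst lborel_integral_real_affine[where c=1 and t="-y"]) auto
    also have "\<dots> = (LINT z:{a..b}|lborel. psi' (z - y))"
      unfolding set_lebesgue_integral_def
      by (rule Bochner_Integration.integral_cong[OF refl]) (auto simp: indicator_def)
    finally show ?thesis by (simp add: i\<nu>)
  qed
  have int: "integrable D (\<lambda>c. psi (x - X t c))" for x
    by (rule integrable_const_bound[where B=M]) (auto simp: psi_abs_le)
  have "Q t b - Q t a = (LINT c|D. psi (b - X t c) - psi (a - X t c))" by (simp add: Q_def int)
  also have "\<dots> = (LINT c|D. (LINT z|\<nu>. psi' (z - X t c)))" by (simp add: shift)
  also have "\<dots> = (LINT z|\<nu>. (LINT c|D. psi' (z - X t c)))"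
  proof (rule P.Fubini_integral[symmetric])
    show "integrable (D \<Otimes>\<^sub>M \<nu>) (\<lambda>(c, z). psi' (z - X t c))"
      by (rule PF.integrable_const_bound[where B=B]) (auto simp: psi'_le split_beta')
  qed
  also have "\<dots> = (LINT z|\<nu>. R t z)" by (simp add: R_def)
  also have "\<dots> = (LINT z:{a..b}|lborel. R t z)"
    by (rule i\<nu>) (rule borel_measurable_continuous_onI[OF continuous_on_space_slice[OF R_cont t]])
  also have "\<dots> = integral {a..b} (R t)"
  proof (rule set_borel_integral_eq_integral)
    have "integrable lborel (\<lambda>x. indicator {a..b} x *\<^sub>R R t x)"
      by (rule borel_integrable_compact) (auto intro: continuous_on_subset[OF continuous_on_space_slice[OF R_cont t]])
    then show "set_integrable lborel {a..b} (R t)" by (simp add: set_integrable_def)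
  qed
  finally show ?thesis .
qed

lemma Q_deriv:
  assumes t: "t \<in> time_dom T"
  shows "(Q t has_real_derivative R t x) (at x)"
proof -
  have "((\<lambda>u. integral {x-1..u} (R t)) has_real_derivative R t x) (at x within {x-1..x+1})"
    by (rule integral_has_real_derivative)
      (auto intro: continuous_on_subset[OF continuous_on_space_slice[OF R_cont t]])
  then have 1: "((\<lambda>u. Q t (x - 1) + integral {x-1..u} (R t)) has_real_derivative 0 + R t x) (at x)"
    by (intro DERIV_add) (auto simp: at_within_Icc_at)
  have "(Q t has_real_derivative 0 + R t x) (at x)"
    by (rule has_field_derivative_transform_within_open[OF 1, of "{x-1<..}"])
      (use Q_increment[OF t] in \<open>auto simp flip: Q_increment[OF t]\<close>)
  then show ?thesis by simp
qed

section \<open>Label derivatives of the coefficients of \<open>G\<close>\<close>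

lemma qa_cont: "continuous_strip (time_dom T) qa"
proof -
  have "continuous_on (time_dom T \<times> UNIV) (\<lambda>z. R (fst z) (X (fst z) (snd z)))"
    by (rule continuous_on_slice[OF R_cont])
      (use on_time_dom[OF X_cont] in \<open>auto intro!: continuous_intros simp: split_beta'\<close>)
  then show ?thesis
    using on_time_dom[OF G_cont] unfolding qa_def split_beta' by (intro continuous_intros)
qed

lemma q_deriv_space: "t \<in> time_dom T \<Longrightarrow> (q t has_real_derivative qa t a) (at a)"
  unfolding q_def[abs_def] qa_def
  by (rule DERIV_chain2[OF Q_deriv X_deriv_space]) (auto intro: time_nonneg)

lemma on_Icc:
  assumes "t \<in> time_dom T" "continuous_on (time_dom T \<times> UNIV) f"
  shows "continuous_on ({0..t} \<times> UNIV) f"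
  by (rule continuous_on_subset[OF assms(2)]) (use time_dom_closed(1)[OF assms(1)] in auto)

lemma qt_deriv_space:
  assumes t: "t \<in> time_dom T"
  shows "(qt t has_real_derivative qta t a) (at a)"
  unfolding qt_def[abs_def] qta_def
proof (rule DERIV_integral_upto)
  show "(q s has_real_derivative qa s a) (at a)" if "s \<in> {0..t}" for s a
    using that time_dom_closed(1)[OF t] by (intro q_deriv_space) auto
  show "continuous_on {0..t} (\<lambda>s. q s a)" for a by (rule continuous_on_subset[OF q_cont_time]) auto
qed (rule on_Icc[OF t qa_cont])

lemma qta_cont: "continuous_strip (time_dom T) qta"
  unfolding qta_def by (rule continuous_on_integral_upto[OF qa_cont time_dom_closed])

lemma WD_exp_qt: "WD (time_dom T) (\<lambda>t a. exp (qt t a))" "WD (time_dom T) (\<lambda>t a. exp (- qt t a))"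
proof -
  show "WD (time_dom T) (\<lambda>t a. exp (qt t a))"
  proof (rule WD_C1[where fa="\<lambda>t a. exp (qt t a) * qta t a"])
    show "((\<lambda>a. exp (qt t a)) has_real_derivative exp (qt t a) * qta t a) (at a)" if "t \<in> time_dom T" for t a
      by (rule derivative_eq_intros qt_deriv_space[OF that] refl)+
  qed (use on_time_dom[OF qt_cont] qta_cont in \<open>auto simp: split_beta' intro!: continuous_intros\<close>)
  show "WD (time_dom T) (\<lambda>t a. exp (- qt t a))"
  proof (rule WD_C1[where fa="\<lambda>t a. exp (- qt t a) * - qta t a"])
    show "((\<lambda>a. exp (- qt t a)) has_real_derivative exp (- qt t a) * - qta t a) (at a)" if "t \<in> time_dom T" for t a
      by (rule derivative_eq_intros qt_deriv_space[OF that] refl)+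
  qed (use on_time_dom[OF qt_cont] qta_cont in \<open>auto simp: split_beta' intro!: continuous_intros\<close>)
qed

lemma WD_I12: "WD (time_dom T) I1" "WD (time_dom T) I2"
proof -
  have c1: "continuous_on (time_dom T \<times> UNIV) (\<lambda>(s, a). exp (qt s a) * qta s a)"
    "continuous_on (time_dom T \<times> UNIV) (\<lambda>(s, a). s * (exp (qt s a) * qta s a))"
    using on_time_dom[OF qt_cont] qta_cont by (auto simp: split_beta' intro!: continuous_intros)
  have d: "((\<lambda>a. exp (qt s a)) has_real_derivative exp (qt s a) * qta s a) (at a)" if "s \<in> time_dom T" for s a
    by (rule derivative_eq_intros qt_deriv_space[OF that] refl)+
  have ct: "continuous_on {0..t} (\<lambda>s. qt s a)" for t a by (rule continuous_on_subset[OF qt_cont_time]) auto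
  show "WD (time_dom T) I1"
  proof (rule WD_C1[OF on_time_dom[OF I1_cont] continuous_on_integral_upto[OF c1(1) time_dom_closed]])
    fix t a assume t: "t \<in> time_dom T"
    show "(I1 t has_real_derivative integral {0..t} (\<lambda>s. exp (qt s a) * qta s a)) (at a)"
      unfolding I1_def[abs_def]
      by (rule DERIV_integral_upto[OF d _ on_Icc[OF t c1(1)]])
        (use time_dom_closed(1)[OF t] ct in \<open>auto intro!: continuous_intros\<close>)
  qed
  show "WD (time_dom T) I2"
  proof (rule WD_C1[OF on_time_dom[OF I2_cont] continuous_on_integral_upto[OF c1(2) time_dom_closed]])
    fix t a assume t: "t \<in> time_dom T"
    show "(I2 t has_real_derivative integral {0..t} (\<lambda>s. s * (exp (qt s a) * qta s a))) (at a)"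
      unfolding I2_def[abs_def]
      by (rule DERIV_integral_upto[OF DERIV_cmult[OF d] _ on_Icc[OF t c1(2)]])
        (use time_dom_closed(1)[OF t] ct in \<open>auto intro!: continuous_intros\<close>)
  qed
qed

lemma WD_G_if_e0:
  assumes e: "WD (time_dom T) (\<lambda>_. e0)"
  shows "WD (time_dom T) G"
proof (rule WD_cong)
  show "WD (time_dom T) (\<lambda>t a. exp (- qt t a) * ((1 + e0 a * I1 t a) + (- k) * (rho0 a * I2 t a)))"
    by (intro WD_mult WD_add WD_const WD_exp_qt WD_I12 e WD_rho0)
qed (simp add: G_def)

text \<open>The formula for \<open>G\<close> is solved for \<open>e0\<close>, namely
  \<open>e0 = (exp qt * G - 1 + k * rho0 * I2) / I1\<close>. The time must be positive because
  \<open>I1\<close> vanishes at 0; for positive \<open>t\<close> it is at least \<open>t\<close>, as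
  \<open>qt\<close> is nonnegative.\<close>

lemma WD_e0_if_G:
  assumes t: "t \<in> time_dom T" "0 < t" and G: "WD {t} G"
  shows "WD {t} (\<lambda>_. e0)"
proof -
  have tJ: "{t} \<subseteq> time_dom T" using t by auto
  have I1_pos: "0 < I1 t a" for a
  proof -
    have "(\<lambda>s. s) t - (\<lambda>s. s) 0 \<le> I1 t a - I1 0 a"
    proof -
      have "(\<lambda>s. s - I1 s a) t \<le> (\<lambda>s. s - I1 s a) 0"
      proof (rule nonincreasing_within[where \<tau>=t and h="\<lambda>s. s - I1 s a" and h'="\<lambda>s. 1 - exp (qt s a)"])
        show "((\<lambda>s. s - I1 s a) has_real_derivative 1 - exp (qt s a)) (at s within {0..})" if "s \<in> {0..t}" for s
          using that by (auto intro!: derivative_eq_intros I1_deriv)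
        show "1 - exp (qt s a) \<le> 0" if "0 < s" "s < t" for s
        proof -
          have "0 \<le> qt s a" unfolding qt_def
            using q_bounds(1) continuous_on_subset[OF q_cont_time, of "{0..s}" a]
            by (intro Henstock_Kurzweil_Integration.integral_nonneg integrable_continuous_interval) auto
          then show ?thesis by simp
        qed
      qed (use t in auto)
      then show ?thesis by simp
    qed
    then show ?thesis using t by simp
  qed
  have "WD {t} (\<lambda>s a. (exp (qt s a) * G s a + (- 1) + k * (rho0 a * I2 s a)) * inverse (I1 s a))"
    using I1_pos
    by (intro WD_mult WD_add WD_const WD_inverse WD_rho0 G WD_subset[OF WD_exp_qt(1) tJ] WD_subset[OF WD_I12(1) tJ] WD_subset[OF WD_I12(2) tJ])
      (auto simp: less_imp_neq[symmetric])
  then show "WD {t} (\<lambda>_. e0)"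
    by (rule WD_cong) (use I1_pos in \<open>auto simp: G_def exp_minus field_simps less_imp_neq[symmetric]\<close>)
qed

end

section \<open>Solutions, thresholds and blow-up\<close>

text \<open>In the variable \<open>z = m s / (k r)\<close>, positive for \<open>s < 0\<close>, the threshold equation is \<open>exp z - z = 1 - m\<^sup>2 / (k r)\<close>.\<close>

lemma threshold_root_iff:
  assumes k: "k < 0" and m: "0 < m" and r: "0 < r"
  shows "threshold_root k m r s \<longleftrightarrow> s < 0 \<and> exp (m * s / (k * r)) - m * s / (k * r) = 1 - m\<^sup>2 / (k * r)"
proof -
  have "1 / r - 1 / m\<^sup>2 * (k + m * (s / r) - k * exp (m * s / (k * r))) =
      - k / m\<^sup>2 * ((1 - m\<^sup>2 / (k * r)) - (exp (m * s / (k * r)) - m * s / (k * r)))"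
    using assms by (simp add: field_simps power2_eq_square)
  then show ?thesis using assms by (auto simp: threshold_root_def)
qed

lemma exp_minus_id_strict_mono:
  fixes x y :: real
  assumes "0 \<le> x" "x < y"
  shows "exp x - x < exp y - y"
proof (rule DERIV_pos_imp_increasing_open[OF assms(2)])
  show "\<exists>d. ((\<lambda>x. exp x - x) has_real_derivative d) (at z) \<and> 0 < d" if "x < z" "z < y" for z
    using that assms by (intro exI[of _ "exp z - 1"]) (auto intro!: derivative_eq_intros)
qed (auto intro!: continuous_intros)

text \<open>On \<open>z \<ge> 0\<close> the function \<open>exp z - z\<close> increases strictly
  from 1 without bound, and the right-hand side exceeds 1 because \<open>k < 0\<close>.\<close>

lemma threshold_root_unique:
  assumes k: "k < 0" and m: "0 < m" and r: "0 < r"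
  shows "\<exists>!s. threshold_root k m r s"
proof -
  define b where "b = 1 - m\<^sup>2 / (k * r)"
  have kr: "k * r < 0" using k r by (simp add: mult_neg_pos)
  have b: "1 < b" using kr m by (simp add: b_def divide_pos_neg)
  \<comment> \<open>\<open>2 * b\<close> serves as the right end for the intermediate value theorem,
    by the quadratic Taylor bound of \<open>exp\<close>.\<close>
  have "b \<le> exp (2 * b) - 2 * b"
  proof -
    have "b \<le> b * b" using b by (simp add: mult_le_cancel_left1)
    moreover have "1 + 2 * b + (2 * b)\<^sup>2 / 2 \<le> exp (2 * b)" using b by (intro exp_lower_Taylor_quadratic) auto
    moreover have "(2 * b)\<^sup>2 / 2 = 2 * (b * b)" by (simp add: power2_eq_square)
    ultimately show ?thesis using b by linarith
  qed
  moreover have "continuous_on {0..2 * b} (\<lambda>z. exp z - z)" by (intro continuous_intros)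
  ultimately obtain z where z: "0 \<le> z" "exp z - z = b"
    using IVT'[of "\<lambda>z. exp z - z" 0 b "2 * b"] b by auto
  have z0: "0 < z" using z b by (cases "z = 0") auto
  show ?thesis
  proof (rule ex1I)
    show "threshold_root k m r (k * r * z / m)"
      unfolding threshold_root_iff[OF assms]
      using z z0 kr m by (simp add: b_def mult_neg_pos divide_neg_pos)
    fix s assume "threshold_root k m r s"
    then have s: "s < 0" "exp (m * s / (k * r)) - m * s / (k * r) = b"
      by (auto simp: threshold_root_iff[OF assms] b_def)
    have "0 \<le> m * s / (k * r)" using s kr m by (simp add: divide_nonpos_neg mult_nonneg_nonpos)
    then have "m * s / (k * r) = z"
      using exp_minus_id_strict_mono[of z "m * s / (k * r)"] exp_minus_id_strict_mono[of "m * s / (k * r)" z] s z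
      by (cases "m * s / (k * r)" z rule: linorder_cases) auto
    then show "s = k * r * z / m" using kr m by (auto simp: field_simps)
  qed
qed

text \<open>Division by the negative \<open>k * r\<close> reverses the order: a value
  \<open>s\<close> above the root has a smaller \<open>z\<close>, where \<open>exp z - z\<close> is
  smaller.\<close>

lemma above_threshold:
  assumes k: "k < 0" and m: "0 < m" and r: "0 < r" and s: "sigma_plus k m r < s" "s < 0"
  shows "exp (m * s / (k * r)) - m * s / (k * r) < 1 - m\<^sup>2 / (k * r)"
proof -
  have kr: "k * r < 0" using k r by (simp add: mult_neg_pos)
  define s0 where "s0 = sigma_plus k m r"
  have "threshold_root k m r s0"
    using theI'[OF threshold_root_unique[OF k m r]] r by (simp add: s0_def sigma_plus_def)
  then have s0: "exp (m * s0 / (k * r)) - m * s0 / (k * r) = 1 - m\<^sup>2 / (k * r)"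
    by (simp add: threshold_root_iff[OF k m r])
  have "0 \<le> m * s / (k * r)" using s kr m by (simp add: divide_nonpos_neg mult_nonneg_nonpos)
  moreover have "m * s / (k * r) < m * s0 / (k * r)"
    using s kr m by (intro divide_strict_right_mono_neg) (auto simp: s0_def)
  ultimately show ?thesis using exp_minus_id_strict_mono[of "m * s / (k * r)" "m * s0 / (k * r)"] s0 by simp
qed

section \<open>The Eulerian fields solve the system\<close>

context epa_pos
begin

lemma V_0: "V 0 a = u0 a" by (simp add: V_def S_def)

lemma deriv_uE:
  assumes t: "t \<in> time_dom T"
  shows "(uE t has_real_derivative Gt t (A t x) / G t (A t x)) (at x)"
  unfolding uE_def[abs_def]
  by (rule along_A_derivs(2)[OF _ _ on_time_dom[OF Gt_cont] t, where ft=Acc])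
    (auto intro: V_deriv_time V_deriv_space time_nonneg)

text \<open>The condition on \<open>e0\<close> serves to make \<open>rho0 / G\<close> continuously
  differentiable in the label; the velocity \<open>V\<close> already is. Both equations are then
  verified at the label \<open>A t x\<close> by the chain rule along the inverse flow.\<close>

lemma classical_solution_rhoE_uE:
  assumes e0: "WD (time_dom T) (\<lambda>_. e0)"
  shows "classical_solution psi k rho0 u0 T rhoE uE"
proof -
  have "WD (time_dom T) (\<lambda>t a. inverse (G t a))"
    by (intro WD_inverse WD_G_if_e0[OF e0]) (use G_pos in \<open>auto simp: less_imp_neq[symmetric]\<close>)
  then obtain ha where ha_cont: "continuous_strip (time_dom T) ha"
    and ha: "\<And>t a. t \<in> time_dom T \<Longrightarrow> ((\<lambda>x. rho0 x * inverse (G t x)) has_real_derivative ha t a) (at a)"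
    unfolding WD_def by blast
  define h where "h t a = rho0 a * inverse (G t a)" for t a
  define ht where "ht t a = - (rho0 a * Gt t a / (G t a)\<^sup>2)" for t a
  have nz: "G t a \<noteq> 0" if "t \<in> time_dom T" for t a using G_pos[OF that, of a] by simp
  have rhoE_h: "rhoE t x = h t (A t x)" for t x by (simp add: rhoE_def h_def divide_inverse)
  have h_t: "((\<lambda>s. h s a) has_real_derivative ht t a) (at t within {0..})" if t: "t \<in> time_dom T" for t a
    unfolding h_def ht_def
    by (rule derivative_eq_intros G_deriv_time[OF time_nonneg[OF t]] nz[OF t] refl)+
      (simp add: divide_inverse power2_eq_square mult_ac)
  have h_a: "(h t has_real_derivative ha t a) (at a)" if t: "t \<in> time_dom T" for t a
    unfolding h_def[abs_def] by (rule ha[OF t])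
  have ht_cont: "continuous_strip (time_dom T) ht"
    using on_time_dom[OF G_cont] on_time_dom[OF Gt_cont] nz unfolding ht_def split_beta'
    by (intro continuous_intros continuous_on_snd_comp rho0_cont) auto
  have slab_rho: "C1_slab T rhoE"
  proof -
    have "C1_slab T (\<lambda>t x. h t (A t x))" by (rule C1_slab_along_A[OF h_t h_a ht_cont ha_cont])
    then show ?thesis by (simp add: rhoE_h[abs_def])
  qed
  have V_t: "((\<lambda>s. V s a) has_real_derivative Acc t a) (at t within {0..})"
    and V_a: "(V t has_real_derivative Gt t a) (at a)" if "t \<in> time_dom T" for t a
    using that by (auto intro: V_deriv_time V_deriv_space time_nonneg)
  have slab_u: "C1_slab T uE"
  proof -
    have "C1_slab T (\<lambda>t x. V t (A t x))"
      by (rule C1_slab_along_A[OF V_t V_a on_time_dom[OF Acc_cont] on_time_dom[OF Gt_cont]])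
    then show ?thesis by (simp add: uE_def[abs_def])
  qed
  have um: "uE t \<in> borel_measurable borel" if "t \<in> time_dom T" for t
    by (rule borel_measurable_continuous_onI[OF continuous_on_UNIV_if_deriv[OF deriv_uE[OF that]]])
  have uX: "uE t (X t c) = V t c" if "t \<in> time_dom T" for t c by (simp add: uE_def A_X[OF that])
  have V_int: "integrable D (V t)" if t: "t \<in> time_dom T" for t
  proof -
    obtain K where K: "0 \<le> K" "\<And>s a. s \<in> {0..t} \<Longrightarrow> \<bar>V s a\<bar> \<le> K * w a" using V_bound by blast
    show ?thesis
      by (rule integrable_D_bound[where ?K1.0=0 and ?K2.0=K])
        (use K(2)[of t] time_nonneg[OF t] V_meas in auto)
  qed
  have u_int: "integrable lborel (\<lambda>y. uE t y * rhoE t y)" if t: "t \<in> time_dom T" for t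
    using integral_rhoE(1)[OF t um[OF t]] V_int[OF t] by (simp add: uX[OF t])
  have bounds: "\<exists>C. \<forall>t\<in>{0..\<tau>}. (\<forall>x. rhoE t x \<le> C \<and> \<bar>deriv (uE t) x\<bar> \<le> C) \<and> (LINT y|lborel. \<bar>uE t y\<bar> * rhoE t y) \<le> C"
    if \<tau>: "\<tau> \<in> time_dom T" for \<tau>
  proof -
    obtain c where c: "0 < c" "\<And>s a. s \<in> {0..\<tau>} \<Longrightarrow> c \<le> G s a" using G_lower[OF \<tau>] by blast
    obtain C where C: "0 \<le> C" "\<And>t a. t \<in> {0..\<tau>} \<Longrightarrow> \<bar>Gt t a\<bar> \<le> C" using G_Gt_bound[OF time_nonneg[OF \<tau>]] by metis
    obtain K where K: "0 \<le> K" "\<And>s a. s \<in> {0..\<tau>} \<Longrightarrow> \<bar>V s a\<bar> \<le> K * w a" using V_bound by blast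
    have R0: "0 \<le> R0" using rho0_nonneg[of 0] rho0_le[of 0] by simp
    have KW: "0 \<le> K * W" using K W_ge1 by simp
    have "(\<forall>x. rhoE t x \<le> R0 / c + C / c + K * W \<and> \<bar>deriv (uE t) x\<bar> \<le> R0 / c + C / c + K * W) \<and>
        (LINT y|lborel. \<bar>uE t y\<bar> * rhoE t y) \<le> R0 / c + C / c + K * W" if t: "t \<in> {0..\<tau>}" for t
    proof (intro conjI allI)
      have td: "t \<in> time_dom T" using time_dom_closed(1)[OF \<tau>] t by auto
      have pos: "0 \<le> R0 / c" "0 \<le> C / c" using R0 C c by auto
      fix x
      have "rhoE t x \<le> R0 / c" unfolding rhoE_def
        using rho0_le c(1) c(2)[OF t] R0 by (intro frac_le) auto
      then show "rhoE t x \<le> R0 / c + C / c + K * W" using pos KW by linarith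
      have "\<bar>deriv (uE t) x\<bar> = \<bar>Gt t (A t x)\<bar> / G t (A t x)"
        using G_pos[OF td, of "A t x"] by (simp add: DERIV_imp_deriv[OF deriv_uE[OF td]] abs_divide)
      also have "\<dots> \<le> C / c" using C(2)[OF t] c(1) c(2)[OF t] C(1) by (intro frac_le) auto
      finally show "\<bar>deriv (uE t) x\<bar> \<le> R0 / c + C / c + K * W" using pos KW by linarith
    next
      have td: "t \<in> time_dom T" using time_dom_closed(1)[OF \<tau>] t by auto
      have pos: "0 \<le> R0 / c" "0 \<le> C / c" using R0 C c by auto
      have m: "(\<lambda>y. \<bar>uE t y\<bar>) \<in> borel_measurable borel" using um[OF td] by measurable
      have "(LINT y|lborel. \<bar>uE t y\<bar> * rhoE t y) = (LINT a|D. \<bar>V t a\<bar>)"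
        using integral_rhoE(2)[OF td m] by (simp add: uX[OF td])
      also have "\<dots> \<le> (LINT a|D. K * w a)"
        using K(2)[OF t] V_int[OF td] w_int by (intro integral_mono) auto
      also have "\<dots> = K * W" by (simp add: W_def)
      finally show "(LINT y|lborel. \<bar>uE t y\<bar> * rhoE t y) \<le> R0 / c + C / c + K * W" using pos by linarith
    qed
    then show ?thesis by blast
  qed
  define f where "f t x = 1/2 * (LINT y|lborel. sgn (x - y) * rhoE t y)" for t x
  have f: "(f t has_real_derivative rhoE t x) (at x)" if t: "t \<in> time_dom T" for t x
    using DERIV_cmult[OF DERIV_sgn_integral[OF _ continuous_on_space_slice[OF rhoE_cont t]], of "1/2"] rhoE_prob[OF t]
    by (simp add: f_def[abs_def] prob_density_def)
  \<comment> \<open>Any antiderivative of the force serves as a potential; its constant may vary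
    with time, since only \<open>deriv (phi t)\<close> enters the equations.\<close>
  define phi where "phi t = (SOME h. \<forall>x. (h has_real_derivative f t x) (at x))" for t
  have phi: "(phi t has_real_derivative f t x) (at x)" if t: "t \<in> time_dom T" for t x
    using someI_ex[OF antiderivative_exists[OF continuous_on_UNIV_if_deriv[OF f[OF t]]]] by (simp add: phi_def)
  have "poisson_potential (rhoE t) (phi t) \<and>
      (\<forall>x. deriv (\<lambda>s. rhoE s x) t + deriv (\<lambda>y. rhoE t y * uE t y) x = 0 \<and>
        deriv (\<lambda>s. uE s x) t + uE t x * deriv (uE t) x =
          - k * deriv (phi t) x + (LINT y|lborel. psi (x - y) * (uE t y - uE t x) * rhoE t y))"
    if t: "t \<in> time_dom T" "0 < t" for t
  proof (intro conjI allI)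
    note td = t(1)
    have t0: "0 \<le> t" using t by simp
    have at: "at t within time_dom T = at t"
      unfolding at_within_time_dom[OF td] by (rule at_within_interior) (use t in auto)
    have dphi: "deriv (phi t) = f t" by (rule ext) (rule DERIV_imp_deriv[OF phi[OF td]])
    show "poisson_potential (rhoE t) (phi t)"
      unfolding poisson_potential_def
    proof (intro conjI allI)
      show "(phi t has_real_derivative 1/2 * (LINT y|lborel. sgn (x - y) * rhoE t y)) (at x)" for x
        using phi[OF td, of x] by (simp only: f_def)
      show "(deriv (phi t) has_real_derivative rhoE t x) (at x)" for x
        unfolding dphi by (rule f[OF td])
    qed
    fix x
    define a where "a = A t x"
    have Ga: "G t a \<noteq> 0" by (rule nz[OF td])
    have d1: "((\<lambda>s. rhoE s x) has_real_derivative ht t a - ha t a * V t a / G t a) (at t)"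
      using along_A_derivs(1)[OF h_t h_a ha_cont td, of x] by (simp add: rhoE_h at a_def)
    have d2: "(rhoE t has_real_derivative ha t a / G t a) (at x)"
      using along_A_derivs(2)[OF h_t h_a ha_cont td, of x] by (simp add: rhoE_h[abs_def] a_def)
    have d3: "(uE t has_real_derivative Gt t a / G t a) (at x)" using deriv_uE[OF td, of x] by (simp add: a_def)
    have d4: "((\<lambda>s. uE s x) has_real_derivative Acc t a - Gt t a * V t a / G t a) (at t)"
      using along_A_derivs(1)[OF V_t V_a on_time_dom[OF Gt_cont] td, of x] by (simp add: uE_def at a_def)
    have ua: "uE t x = V t a" and ra: "rhoE t x = rho0 a / G t a" by (simp_all add: uE_def rhoE_def a_def)
    show "deriv (\<lambda>s. rhoE s x) t + deriv (\<lambda>y. rhoE t y * uE t y) x = 0"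
      unfolding DERIV_imp_deriv[OF d1] DERIV_imp_deriv[OF DERIV_mult[OF d2 d3]] ua ra ht_def
      using Ga by (simp add: field_simps power2_eq_square)
    have Xm: "X t \<in> borel_measurable borel" and Vm: "V t \<in> borel_measurable borel" and um': "uE t \<in> borel_measurable borel"
      using X_meas[OF t0] V_meas[OF t0] um[OF td] by auto
    note [measurable] = Xm Vm um'
    have xa: "x = X t a" by (simp add: a_def X_A[OF td])
    have "(LINT y|lborel. sgn (x - y) * rhoE t y) = (LINT c|D. sgn (x - X t c))"
      by (rule integral_rhoE(2)[OF td]) measurable
    also have "\<dots> = (LINT c|D. sgn (a - c))"
    proof (rule Bochner_Integration.integral_cong[OF refl])
      fix c show "sgn (x - X t c) = sgn (a - c)"
        using strict_mono_less[OF X_mono[OF td], of a c] strict_mono_less[OF X_mono[OF td], of c a]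
        by (cases a c rule: linorder_cases) (auto simp: xa)
    qed
    finally have Fa: "- k * f t x = F a" by (simp add: f_def F_def)
    have "(LINT y|lborel. psi (x - y) * (uE t y - uE t x) * rhoE t y) = (LINT c|D. psi (x - X t c) * (uE t (X t c) - uE t x))"
      by (rule integral_rhoE(2)[OF td]) measurable
    also have "\<dots> = (LINT c|D. - (psi (X t a - X t c) * (V t a - V t c)))"
      by (rule Bochner_Integration.integral_cong[OF refl]) (simp add: uX[OF td] ua xa[symmetric] algebra_simps)
    also have "\<dots> = - (LINT c|D. psi (X t a - X t c) * (V t a - V t c))" by simp
    finally have "Acc t a = - k * f t x + (LINT y|lborel. psi (x - y) * (uE t y - uE t x) * rhoE t y)"
      using Fa by (simp add: Acc_def)
    then show "deriv (\<lambda>s. uE s x) t + uE t x * deriv (uE t) x =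
        - k * deriv (phi t) x + (LINT y|lborel. psi (x - y) * (uE t y - uE t x) * rhoE t y)"
      unfolding DERIV_imp_deriv[OF d4] DERIV_imp_deriv[OF d3] ua dphi by simp
  qed
  moreover have "rhoE 0 = rho0" "uE 0 = u0" by (auto simp: rhoE_def uE_def V_0)
  ultimately show ?thesis
    unfolding classical_solution_def using slab_rho slab_u rhoE_prob u_int bounds by blast
qed

end

section \<open>Loss of the lower bound and the maximal time of existence\<close>

context epa_flow
begin

text \<open>Quantifying over the whole past makes the property pass to earlier times, so the times
  at which it fails are closed upwards.\<close>

definition nondegenerate :: "real \<Rightarrow> bool" where "nondegenerate t \<longleftrightarrow> (\<exists>c>0. \<forall>s\<in>{0..t}. \<forall>a. c \<le> G s a)"

lemma epa_pos_I: "0 < T \<Longrightarrow> (\<And>t. t \<in> time_dom T \<Longrightarrow> nondegenerate t) \<Longrightarrow> epa_pos k M B R0 C0 psi psi' Psi rho0 rho0' u0 u0' X T"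
  by unfold_locales (auto simp: nondegenerate_def)

lemma nondegenerate_0: "nondegenerate 0" unfolding nondegenerate_def by (rule exI[of _ 1]) auto

lemma nondegenerate_mono: "nondegenerate t \<Longrightarrow> s \<le> t \<Longrightarrow> nondegenerate s"
  unfolding nondegenerate_def by (meson atLeastAtMost_iff order_trans)

text \<open>\<open>G\<close> is Lipschitz in time uniformly in the label, so for a short while at
  most half of the lower bound is lost.\<close>

lemma nondegenerate_extend:
  assumes t: "0 \<le> t" "nondegenerate t"
  shows "\<exists>d>0. nondegenerate (t + d)"
proof -
  obtain c where c: "0 < c" "\<And>s a. s \<in> {0..t} \<Longrightarrow> c \<le> G s a" using t(2) unfolding nondegenerate_def by blast
  have "0 \<le> t + 1" using t by simp
  then obtain C where C: "0 \<le> C" "\<And>s r a. s \<in> {0..t+1} \<Longrightarrow> r \<in> {0..t+1} \<Longrightarrow> \<bar>G r a - G s a\<bar> \<le> C * \<bar>r - s\<bar>"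
    by (rule G_time_lipschitz) blast
  \<comment> \<open>\<open>C\<close> may be 0; the summand 1 keeps the quotient in \<open>d\<close>
    positive.\<close>
  define E where "E = C + 1"
  have E: "0 < E" "C \<le> E" using C by (auto simp: E_def)
  define d where "d = min 1 (c / (2 * E))"
  have d: "0 < d" "d \<le> 1" using c E by (auto simp: d_def)
  have Cd: "C * d \<le> c / 2"
  proof -
    have "C * d \<le> E * (c / (2 * E))" using E d by (intro mult_mono) (auto simp: d_def)
    then show ?thesis using E by simp
  qed
  have "c / 2 \<le> G s a" if s: "s \<in> {0..t + d}" for s a
  proof (cases "s \<le> t")
    case True
    then show ?thesis using c(2)[of s a] c(1) s by auto
  next
    case False
    have "\<bar>G s a - G t a\<bar> \<le> C * \<bar>s - t\<bar>" using s d t by (intro C) auto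
    also have "\<dots> \<le> C * d" using s False C by (intro mult_left_mono) auto
    finally show ?thesis using Cd c(2)[of t a] t by auto
  qed
  then show ?thesis using d c unfolding nondegenerate_def by (meson half_gt_zero)
qed

text \<open>At a positive time \<open>rho0 / G = rho (X)\<close> is continuously differentiable in
  the label, so \<open>1 / G\<close> is differentiable relative to the weight; inversion gives
  \<open>G\<close>, and the formula for \<open>G\<close> gives \<open>e0\<close>.\<close>

lemma WD_e0:
  assumes sol: "classical_solution psi k rho0 u0 T rho u" and T: "0 < T"
  shows "WD J (\<lambda>_. e0)"
proof -
  interpret epa_pos k M B R0 C0 psi psi' Psi rho0 rho0' u0 u0' X T
    by (rule epa_pos_I[OF T]) (use classical_solution_lagrangian(3)[OF sol] in \<open>auto simp: nondegenerate_def\<close>)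
  obtain t where t: "0 < t" "t \<in> time_dom T" using time_dom_dense[OF zero_time] .
  have "C1_slab T rho" using sol by (simp add: classical_solution_def)
  then obtain rx where rx_cont: "continuous_strip (time_dom T) rx"
    and rx: "\<And>t x. t \<in> time_dom T \<Longrightarrow> (rho t has_real_derivative rx t x) (at x)"
    unfolding C1_slab_def by blast
  have eq: "rho0 a * inverse (G t a) = rho t (X t a)" for a
    using classical_solution_lagrangian(2)[OF sol t(2), of a] G_pos[OF t(2), of a] by (simp add: field_simps)
  have "WD {t} (\<lambda>t a. inverse (G t a))"
  proof (rule WD_I[where f'="\<lambda>t a. rx t (X t a) * G t a"])
    have Gc: "continuous_on ({t} \<times> UNIV) (\<lambda>z. G (fst z) (snd z))"
      using continuous_on_subset[OF on_time_dom[OF G_cont], of "{t} \<times> UNIV"] t by (auto simp: split_beta')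
    then show "continuous_on ({t} \<times> UNIV) (\<lambda>(t, a). inverse (G t a))"
      using G_pos[OF t(2)] unfolding split_beta' by (intro continuous_on_inverse) (auto simp: less_imp_neq[symmetric])
    have "continuous_on ({t} \<times> UNIV) (\<lambda>z. X (fst z) (snd z))"
      using continuous_on_subset[OF on_time_dom[OF X_cont], of "{t} \<times> UNIV"] t by (auto simp: split_beta')
    then have "continuous_on ({t} \<times> UNIV) (\<lambda>z. rx (fst z) (X (fst z) (snd z)))"
      by (intro continuous_on_slice[OF rx_cont]) (use t in \<open>auto intro!: continuous_intros\<close>)
    then show "continuous_on ({t} \<times> UNIV) (\<lambda>(t, a). rx t (X t a) * G t a)"
      using Gc unfolding split_beta' by (intro continuous_on_mult)
    show "((\<lambda>x. rho0 x * inverse (G s x)) has_real_derivative rx s (X s a) * G s a) (at a)" if "s \<in> {t}" for s a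
    proof -
      have "((\<lambda>x. rho t (X t x)) has_real_derivative rx t (X t a) * G t a) (at a)"
        by (rule DERIV_chain2[OF rx[OF t(2)] X_deriv_space[OF time_nonneg[OF t(2)]]])
      then show ?thesis using that by (simp add: eq)
    qed
  qed
  then have "WD {t} (\<lambda>t a. inverse (inverse (G t a)))"
    by (rule WD_inverse) (use G_pos[OF t(2)] in \<open>auto simp: less_imp_neq[symmetric]\<close>)
  then have "WD {t} G" by simp
  then have "WD {t} (\<lambda>_. e0)" by (rule WD_e0_if_G[OF t(2,1)])
  then show ?thesis by (rule WD_time_independent) simp
qed

lemma global_if_nondegenerate:
  assumes e: "\<And>J. WD J (\<lambda>_. e0)" and g: "\<And>t. 0 \<le> t \<Longrightarrow> nondegenerate t"
  shows "global_classical_solution_exists psi k rho0 u0"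
proof -
  interpret epa_pos k M B R0 C0 psi psi' Psi rho0 rho0' u0 u0' X \<infinity>
    by (rule epa_pos_I) (auto simp: time_dom_def intro: g)
  show ?thesis
    unfolding global_classical_solution_exists_def using classical_solution_rhoE_uE[OF e] by blast
qed

text \<open>\<open>\<tau>\<close> is the infimum of the times at which the lower bound fails. It
  fails at \<open>\<tau>\<close> itself, since otherwise it would persist a little longer; before
  \<open>\<tau>\<close> the Eulerian fields solve the system. A bound \<open>C\<close> on the space
  derivative of \<open>uE\<close> means \<open>Gt \<ge> - C * G\<close>, hence
  \<open>G \<ge> exp (- (C * \<tau>))\<close> up to and including \<open>\<tau>\<close>, a
  contradiction. A solution living beyond \<open>\<tau>\<close> would force the lower bound at
  \<open>\<tau>\<close> as well.\<close>

lemma blowup_if_degenerate: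
  assumes e: "\<And>J. WD J (\<lambda>_. e0)" and t: "0 \<le> t" "\<not> nondegenerate t"
  shows "blows_up_in_finite_time psi k rho0 u0"
proof -
  define N where "N = {t. 0 \<le> t \<and> \<not> nondegenerate t}"
  have N: "N \<noteq> {}" "bdd_below N" using t by (auto simp: N_def)
  define \<tau> where "\<tau> = Inf N"
  obtain d0 where d0: "0 < d0" "nondegenerate d0" using nondegenerate_extend[OF order_refl nondegenerate_0] by auto
  have N_ge: "x \<le> t" if "nondegenerate x" "t \<in> N" for x t
    using nondegenerate_mono[OF that(1), of t] that(2) by (cases "t \<le> x") (auto simp: N_def)
  have "d0 \<le> \<tau>" unfolding \<tau>_def
    by (intro cInf_greatest N N_ge[OF d0(2)])
  then have \<tau>0: "0 < \<tau>" using d0 by simp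
  have nondegenerate_before: "nondegenerate s" if "0 \<le> s" "s < \<tau>" for s
    using cInf_lower[of s N] N that by (force simp: N_def \<tau>_def)
  have bad: "\<not> nondegenerate \<tau>"
  proof
    assume "nondegenerate \<tau>"
    then obtain d where d: "0 < d" "nondegenerate (\<tau> + d)" using nondegenerate_extend[of \<tau>] \<tau>0 by auto
    have "\<tau> + d \<le> Inf N" by (intro cInf_greatest N N_ge[OF d(2)])
    then show False using d by (simp add: \<tau>_def)
  qed
  interpret epa_pos k M B R0 C0 psi psi' Psi rho0 rho0' u0 u0' X "ereal \<tau>"
    by (rule epa_pos_I) (use \<tau>0 nondegenerate_before in \<open>auto simp: time_dom_def\<close>)
  have unb: "\<exists>t\<in>time_dom (ereal \<tau>). \<exists>x. rhoE t x > C \<or> \<bar>deriv (uE t) x\<bar> > C" for C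
  proof (rule ccontr)
    assume bdd: "\<not> (\<exists>t\<in>time_dom (ereal \<tau>). \<exists>x. rhoE t x > C \<or> \<bar>deriv (uE t) x\<bar> > C)"
    then have le: "\<bar>deriv (uE t) x\<bar> \<le> C" if "t \<in> time_dom (ereal \<tau>)" for t x
    proof -
      from bdd that have "\<not> C < \<bar>deriv (uE t) x\<bar>" by blast
      then show ?thesis by linarith
    qed
    have C0: "0 \<le> C" using le[OF zero_time, of 0] by linarith
    have Gle: "- C * G t a \<le> Gt t a" if t: "t \<in> time_dom (ereal \<tau>)" for t a
    proof -
      have "\<bar>Gt t a / G t a\<bar> \<le> C"
        using le[OF t, of "X t a"] DERIV_imp_deriv[OF deriv_uE[OF t, of "X t a"]] by (simp add: A_X[OF t])
      then have "- C \<le> Gt t a / G t a" by linarith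
      then show ?thesis using G_pos[OF t, of a] by (simp add: pos_le_divide_eq)
    qed
    have low: "exp (- (C * \<tau>)) \<le> G s a" if s: "s \<in> {0..\<tau>}" for s a
    proof -
      have "- (G s a * exp (C * s)) \<le> - (G 0 a * exp (C * 0))"
      proof (rule nonincreasing_between[where h="\<lambda>s. - (G s a * exp (C * s))" and h'="\<lambda>s. - ((Gt s a + C * G s a) * exp (C * s))"])
        fix r assume r: "r \<in> {0..s}"
        show "((\<lambda>s. - (G s a * exp (C * s))) has_real_derivative - ((Gt r a + C * G r a) * exp (C * r))) (at r within {0..})"
          by (rule derivative_eq_intros G_deriv_time refl | use r in force)+ (simp add: algebra_simps)
      next
        fix r assume "0 < r" "r < s"
        then have "r \<in> time_dom (ereal \<tau>)" using s by (auto simp: time_dom_def)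
        then show "- ((Gt r a + C * G r a) * exp (C * r)) \<le> 0" using Gle[of r a] by simp
      qed (use s in auto)
      then have "1 \<le> G s a * exp (C * s)" by simp
      then have "exp (- (C * s)) \<le> G s a" by (simp add: exp_minus field_simps)
      moreover have "exp (- (C * \<tau>)) \<le> exp (- (C * s))" using s C0 by (auto intro: mult_left_mono)
      ultimately show ?thesis by linarith
    qed
    have "nondegenerate \<tau>" unfolding nondegenerate_def using low by (intro exI[of _ "exp (- (C * \<tau>))"]) auto
    then show False using bad by blast
  qed
  have no: "\<not> classical_solution psi k rho0 u0 T rho u" if T: "ereal \<tau> < T" for T rho u
  proof
    assume "classical_solution psi k rho0 u0 T rho u"
    from classical_solution_lagrangian(3)[OF this, of \<tau>] have "nondegenerate \<tau>"
      using T \<tau>0 by (auto simp: nondegenerate_def time_dom_def)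
    then show False using bad by blast
  qed
  show ?thesis
    unfolding blows_up_in_finite_time_def using \<tau>0 unb no classical_solution_rhoE_uE[OF e] by blast
qed

section \<open>Blow-up: comparison with the undamped equation\<close>

lemma G_upper:
  assumes t: "0 \<le> t" "nondegenerate t"
  shows "G t a \<le> 1 + e0 a * t - k * rho0 a * t\<^sup>2 / 2"
proof -
  obtain c where c: "0 < c" "\<And>s a. s \<in> {0..t} \<Longrightarrow> c \<le> G s a" using t(2) unfolding nondegenerate_def by blast
  define h where "h s = G s a - (1 + e0 a * s - k * rho0 a * s\<^sup>2 / 2)" for s
  have "h t \<le> h 0"
  proof (rule nonincreasing_between[where h=h and h'="\<lambda>s. - (q s a * G s a)"])
    fix r assume r: "r \<in> {0..t}"
    show "(h has_real_derivative - (q r a * G r a)) (at r within {0..})"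
      unfolding h_def
      by (rule derivative_eq_intros G_deriv_time refl | use r in force)+ (simp add: Gt_def algebra_simps)
  next
    fix r assume "0 < r" "r < t"
    \<comment> \<open>Dropping the damping raises the right-hand side only while \<open>G\<close> is
      nonnegative; nondegeneracy up to \<open>t\<close> guarantees this.\<close>
    then show "- (q r a * G r a) \<le> 0" using q_bounds[of r a] c(1) c(2)[of r a] by auto
  qed (use t in auto)
  then show ?thesis by (simp add: h_def)
qed

lemma nondegenerate_positive: "nondegenerate t \<Longrightarrow> 0 \<le> t \<Longrightarrow> 0 < G t a"
  unfolding nondegenerate_def by (metis atLeastAtMost_iff less_le_trans order_refl)

text \<open>The term \<open>- k * rho0 a * t\<^sup>2 / 2\<close> wins at any label with
  \<open>rho0 a > 0\<close>, and such a label exists because the mass is 1.\<close>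

lemma attractive_degenerate:
  assumes k: "0 < k"
  shows "\<exists>t\<ge>0. \<not> nondegenerate t"
proof (rule ccontr)
  assume "\<not> (\<exists>t\<ge>0. \<not> nondegenerate t)"
  then have g: "nondegenerate t" if "0 \<le> t" for t using that by blast
  obtain a where a: "0 < rho0 a"
  proof (rule ccontr)
    assume "\<not> thesis"
    then have "rho0 = (\<lambda>_. 0)" using that rho0_nonneg by (metis less_eq_real_def ext)
    then show False using rho0_prob by (simp add: prob_density_def)
  qed
  define r where "r = k * rho0 a"
  have r: "0 < r" using a k by (simp add: r_def)
  \<comment> \<open>Ensures \<open>r * t / 2 \<ge> \<bar>e0 a\<bar> + 1\<close> and
    \<open>t \<ge> 1\<close>, so that the quadratic term outweighs
    \<open>1 + e0 a * t\<close>.\<close>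
  define t where "t = 2 * (\<bar>e0 a\<bar> + 1) / r + 1"
  have t: "1 \<le> t" "\<bar>e0 a\<bar> + 1 \<le> r * t / 2" using r by (auto simp: t_def field_simps)
  have "(\<bar>e0 a\<bar> + 1) * t \<le> (r * t / 2) * t" using t by (intro mult_right_mono) auto
  moreover have "e0 a * t \<le> \<bar>e0 a\<bar> * t" using t by (intro mult_right_mono) auto
  moreover have "(\<bar>e0 a\<bar> + 1) * t = \<bar>e0 a\<bar> * t + t" "(r * t / 2) * t = r * t\<^sup>2 / 2"
    by (simp_all add: algebra_simps power2_eq_square)
  ultimately have "1 + e0 a * t - r * t\<^sup>2 / 2 \<le> 0" using t by linarith
  then show False
    using G_upper[of t a] nondegenerate_positive[of t a] g[of t] t by (simp add: r_def)
qed

text \<open>With \<open>r = - k * rho0 a\<close> the upper bound for \<open>G\<close> is the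
  parabola \<open>1 + e0 t + r t\<^sup>2 / 2\<close>, whose minimum
  \<open>1 - e0\<^sup>2 / (2 r)\<close> at \<open>t = - e0 / r\<close> is negative for
  \<open>e0 < - sqrt (2 r)\<close>; this is the origin of \<open>sigma_minus\<close>. For
  \<open>rho0 a = 0\<close> it is a line with the zero \<open>- 1 / e0\<close>.\<close>

lemma supercritical_degenerate:
  assumes k: "k < 0" and e: "e0 a < sigma_minus k (rho0 a)"
  shows "\<exists>t\<ge>0. \<not> nondegenerate t"
proof (rule ccontr)
  assume "\<not> (\<exists>t\<ge>0. \<not> nondegenerate t)"
  then have g: "nondegenerate t" if "0 \<le> t" for t using that by blast
  have G_up: "0 < 1 + e0 a * t - k * rho0 a * t\<^sup>2 / 2" if "0 \<le> t" for t
    using G_upper[OF that g[OF that], of a] nondegenerate_positive[OF g[OF that] that, of a] by linarith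
  define r where "r = - k * rho0 a"
  have r0: "0 \<le> r" using k rho0_nonneg[of a] by (simp add: r_def mult_nonpos_nonneg)
  have e': "e0 a < - sqrt (2 * r)" using e by (simp add: sigma_minus_def r_def mult.assoc)
  then have neg: "e0 a < 0" using real_sqrt_ge_zero[of "2 * r"] r0 by linarith
  show False
  proof (cases "r = 0")
    case True
    then have "rho0 a = 0" using k by (simp add: r_def)
    then show False using G_up[of "- 1 / e0 a"] neg by (simp add: divide_nonpos_neg)
  next
    case False
    then have r: "0 < r" using r0 by simp
    have "2 * r < (e0 a)\<^sup>2"
    proof -
      have "sqrt (2 * r) < - e0 a" using e' by simp
      then have "(sqrt (2 * r))\<^sup>2 < (- e0 a)\<^sup>2" using r by (intro power_strict_mono) auto
      then show ?thesis using r by simp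
    qed
    moreover have "1 + e0 a * (- e0 a / r) + r * (- e0 a / r)\<^sup>2 / 2 = 1 - (e0 a)\<^sup>2 / (2 * r)"
      using r by (simp add: field_simps power2_eq_square)
    moreover have "0 < 1 + e0 a * (- e0 a / r) + r * (- e0 a / r)\<^sup>2 / 2"
    proof -
      have kr: "k * rho0 a = - r" by (simp add: r_def)
      have "0 \<le> - e0 a / r" using neg r by (intro divide_nonneg_pos) auto
      from G_up[OF this] show ?thesis unfolding kr by simp
    qed
    ultimately have "2 * r < (e0 a)\<^sup>2" "(e0 a)\<^sup>2 / (2 * r) < 1" by simp_all
    then show False using r by (simp add: pos_divide_less_eq)
  qed
qed

section \<open>Global existence: comparison with the fully damped equation\<close>

lemma qt_bounds: assumes "0 \<le> t" shows "0 \<le> qt t a" "qt t a \<le> M * t"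
proof -
  show "0 \<le> qt t a" unfolding qt_def
    using q_bounds(1) continuous_on_subset[OF q_cont_time, of "{0..t}" a]
    by (intro Henstock_Kurzweil_Integration.integral_nonneg integrable_continuous_interval) auto
  have "qt t a - M * t \<le> qt 0 a - M * 0"
    by (rule nonincreasing_between[where h="\<lambda>s. qt s a - M * s" and h'="\<lambda>s. q s a - M"])
      (use assms q_bounds(2) in \<open>auto intro!: derivative_eq_intros qt_deriv\<close>)
  then show "qt t a \<le> M * t" by simp
qed

text \<open>\<open>qt\<close> is nondecreasing in time, so its final value bounds the
  integrand.\<close>

lemma I1_bounds: assumes "0 \<le> t" shows "0 \<le> I1 t a" "I1 t a \<le> t * exp (qt t a)"
proof -
  show "0 \<le> I1 t a" unfolding I1_def
    using continuous_on_subset[OF qt_cont_time, of "{0..t}" a]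
    by (intro Henstock_Kurzweil_Integration.integral_nonneg integrable_continuous_interval continuous_intros) auto
  have "I1 t a - t * exp (qt t a) \<le> I1 0 a - 0 * exp (qt 0 a)"
  proof (rule nonincreasing_between[where h="\<lambda>s. I1 s a - s * exp (qt s a)" and h'="\<lambda>s. - (s * exp (qt s a) * q s a)"])
    fix r assume r: "r \<in> {0..t}"
    show "((\<lambda>s. I1 s a - s * exp (qt s a)) has_real_derivative - (r * exp (qt r a) * q r a)) (at r within {0..})"
      by (rule derivative_eq_intros I1_deriv qt_deriv refl | use r in force)+
  qed (use assms q_bounds(1) in auto)
  then show "I1 t a \<le> t * exp (qt t a)" by simp
qed

lemma I2_nonneg: assumes "0 \<le> t" shows "0 \<le> I2 t a"
  unfolding I2_def
  using continuous_on_subset[OF qt_cont_time, of "{0..t}" a]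
  by (intro Henstock_Kurzweil_Integration.integral_nonneg integrable_continuous_interval continuous_intros) auto

text \<open>Up to a positive factor \<open>G\<close> is \<open>P\<close>, with
  \<open>P' = (e0 + r s) exp qt\<close> and \<open>r = - k * rho0 a\<close>. For negative
  \<open>e0\<close> this is nonpositive until \<open>s0 = - e0 / r\<close>, the worst case being
  \<open>qt = M s\<close>, and nonnegative afterwards. So \<open>P\<close> stays positive if the
  worst case is positive at \<open>s0\<close>, which is the strict threshold inequality.\<close>

lemma subcritical_G_pos:
  assumes k: "k < 0" and t: "0 \<le> t"
    and sub: "e0 a < 0 \<Longrightarrow> 0 < rho0 a \<and>
      exp (M * e0 a / (k * rho0 a)) - M * e0 a / (k * rho0 a) < 1 - M\<^sup>2 / (k * rho0 a)"
  shows "0 < G t a"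
proof -
  define P where "P s = 1 + e0 a * I1 s a - k * rho0 a * I2 s a" for s
  have G: "G t a = exp (- qt t a) * P t" by (simp add: G_def P_def)
  have P': "(P has_real_derivative (e0 a - k * rho0 a * s) * exp (qt s a)) (at s within {0..})" if "0 \<le> s" for s
    unfolding P_def
    by (rule derivative_eq_intros I1_deriv[OF that] I2_deriv[OF that] refl)+ (simp add: algebra_simps)
  have "0 < P t"
  proof (cases "0 \<le> e0 a")
    case True
    have "0 \<le> e0 a * I1 t a" using True I1_bounds(1)[OF t] by simp
    moreover have "k * rho0 a * I2 t a \<le> 0"
      using k rho0_nonneg[of a] I2_nonneg[OF t] by (simp add: mult_nonpos_nonneg)
    ultimately show ?thesis by (simp add: P_def)
  next
    case False
    then have neg: "e0 a < 0" by simp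
    define r where "r = - k * rho0 a"
    have rho: "0 < rho0 a" using sub neg by blast
    then have r: "0 < r" using k by (simp add: r_def mult_neg_pos)
    define s0 where "s0 = - e0 a / r"
    have s0: "0 < s0" using neg r by (simp add: s0_def divide_neg_pos)
    \<comment> \<open>A primitive of \<open>(e0 a + r * s) * exp (M * s)\<close>, the derivative of
      \<open>P\<close> in the case \<open>q = M\<close>; the worst case is
      \<open>1 - H 0 + H s\<close>.\<close>
    define H where "H s = (e0 a + r * s) * exp (M * s) / M - r * exp (M * s) / M\<^sup>2" for s
    have H': "(H has_real_derivative (e0 a + r * s) * exp (M * s)) (at s within {0..})" for s
      unfolding H_def using M by (auto intro!: derivative_eq_intros simp: field_simps power2_eq_square)
    have lin: "e0 a + r * s \<le> 0" if "s \<le> s0" for s using that r by (simp add: s0_def field_simps)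
    have crit: "0 < 1 - H 0 + H s0"
    proof -
      have z: "M * e0 a / (k * rho0 a) = M * s0" "M\<^sup>2 / (k * rho0 a) = - (M\<^sup>2 / r)"
        using r k rho by (auto simp: s0_def r_def)
      have "exp (M * s0) - M * s0 < 1 + M\<^sup>2 / r" using sub[OF neg] by (simp add: z)
      then have "r / M\<^sup>2 * (exp (M * s0) - M * s0) < r / M\<^sup>2 * (1 + M\<^sup>2 / r)"
        using r M by (intro mult_strict_left_mono) auto
      moreover have "r / M\<^sup>2 * (1 + M\<^sup>2 / r) = r / M\<^sup>2 + 1" using r M by (simp add: field_simps)
      moreover have "r / M\<^sup>2 * (exp (M * s0) - M * s0) = r * exp (M * s0) / M\<^sup>2 + e0 a / M"
        using r M by (simp add: s0_def field_simps power2_eq_square)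
      moreover have "H s0 = - (r * exp (M * s0) / M\<^sup>2)" using r by (simp add: H_def s0_def)
      moreover have "H 0 = e0 a / M - r / M\<^sup>2" by (simp add: H_def)
      ultimately show ?thesis by linarith
    qed
    have upto: "0 < P s" if s: "0 \<le> s" "s \<le> s0" for s
    proof -
      have "H s - P s \<le> H 0 - P 0"
      proof (rule nonincreasing_between[where h="\<lambda>s. H s - P s" and h'="\<lambda>s. (e0 a + r * s) * (exp (M * s) - exp (qt s a))"])
        fix x assume "x \<in> {0..s}"
        then show "((\<lambda>s. H s - P s) has_real_derivative (e0 a + r * x) * (exp (M * x) - exp (qt x a))) (at x within {0..})"
          using DERIV_diff[OF H' P'[of x]] by (simp add: r_def algebra_simps)
      next
        fix x assume x: "0 < x" "x < s"
        show "(e0 a + r * x) * (exp (M * x) - exp (qt x a)) \<le> 0"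
          using lin[of x] qt_bounds(2)[of x a] x s by (intro mult_nonpos_nonneg) auto
      qed (use s in auto)
      \<comment> \<open>\<open>H\<close> decreases until \<open>s0\<close>, so its value there is
        the critical one.\<close>
      moreover have "H s0 \<le> H s"
        by (rule nonincreasing_between[OF H']) (use lin s in \<open>auto simp: mult_nonpos_nonneg\<close>)
      moreover have "P 0 = 1" by (simp add: P_def)
      ultimately show ?thesis using crit by linarith
    qed
    show ?thesis
    proof (cases "t \<le> s0")
      case False
      have "- P t \<le> - P s0"
      proof (rule nonincreasing_between[where h="\<lambda>s. - P s" and h'="\<lambda>s. - ((e0 a - k * rho0 a * s) * exp (qt s a))"])
        show "((\<lambda>s. - P s) has_real_derivative - ((e0 a - k * rho0 a * x) * exp (qt x a))) (at x within {0..})"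
          if "x \<in> {s0..t}" for x
          using that s0 by (intro DERIV_minus P') auto
        show "- ((e0 a - k * rho0 a * x) * exp (qt x a)) \<le> 0" if "s0 < x" "x < t" for x
        proof -
          have "- e0 a \<le> r * x" using that r by (simp add: s0_def field_simps)
          then show ?thesis by (simp add: r_def)
        qed
      qed (use False s0 in auto)
      then show ?thesis using upto[of s0] s0 by simp
    qed (use upto t in auto)
  qed
  then show ?thesis by (simp add: G)
qed

text \<open>
  With \<open>rho0\<close> vanishing at infinity, this bound controls \<open>e0\<close> from below far out, where compactness
  does not help to make the positivity of \<open>G\<close> uniform.
\<close>

lemma subcritical_e0_lower:
  assumes k: "k < 0" and e: "e0 a < 0" and rho: "0 < rho0 a"
    and sub: "exp (M * e0 a / (k * rho0 a)) - M * e0 a / (k * rho0 a) < 1 - M\<^sup>2 / (k * rho0 a)"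
  shows "(e0 a)\<^sup>2 < - 2 * k * rho0 a"
proof -
  define r where "r = - k * rho0 a"
  have r: "0 < r" using k rho by (simp add: r_def mult_neg_pos)
  define z where "z = - M * e0 a / r"
  have z: "0 \<le> z" using e r M by (simp add: z_def mult_nonneg_nonpos divide_nonpos_pos)
  have eq: "M * e0 a / (k * rho0 a) = z" "M\<^sup>2 / (k * rho0 a) = - (M\<^sup>2 / r)"
    using r k rho by (auto simp: z_def r_def)
  \<comment> \<open>The quadratic part of \<open>exp\<close> alone yields the claim, which also
    shows that the subcritical region lies above \<open>sigma_minus\<close>.\<close>
  have "1 + z + z\<^sup>2 / 2 \<le> exp z" by (rule exp_lower_Taylor_quadratic[OF z])
  then have "z\<^sup>2 < 2 * (M\<^sup>2 / r)" using sub by (simp add: eq)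
  then have "z\<^sup>2 * r\<^sup>2 < 2 * (M\<^sup>2 / r) * r\<^sup>2" using r by (intro mult_strict_right_mono) auto
  moreover have "z\<^sup>2 * r\<^sup>2 = M\<^sup>2 * (e0 a)\<^sup>2" using r by (simp add: z_def power_divide power_mult_distrib)
  moreover have "2 * (M\<^sup>2 / r) * r\<^sup>2 = M\<^sup>2 * (2 * r)" using r by (simp add: power2_eq_square)
  ultimately have "M\<^sup>2 * (e0 a)\<^sup>2 < M\<^sup>2 * (2 * r)" by simp
  then have "(e0 a)\<^sup>2 < 2 * r" using M by simp
  then show ?thesis by (simp add: r_def mult.assoc)
qed

text \<open>Labels with \<open>\<bar>a\<bar> \<le> b\<close> are handled by compactness and the
  positivity of the continuous \<open>G\<close>. Farther out \<open>rho0\<close> is small, so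
  \<open>e0 \<ge> - d\<close>, and \<open>G\<close> is at least
  \<open>exp (- (M * t)) - d * t\<close>.\<close>

lemma subcritical_nondegenerate:
  assumes k: "k < 0" and uc: "uniformly_continuous_on UNIV rho0"
    and sub: "\<And>a. e0 a < 0 \<Longrightarrow> 0 < rho0 a \<and>
      exp (M * e0 a / (k * rho0 a)) - M * e0 a / (k * rho0 a) < 1 - M\<^sup>2 / (k * rho0 a)"
    and t: "0 \<le> t"
  shows "nondegenerate t"
proof -
  \<comment> \<open>Small enough that the loss \<open>d * t\<close> takes at most half of the damped
    initial value \<open>exp (- (M * t))\<close>.\<close>
  define d where "d = exp (- (M * t)) / (2 * (t + 1))"
  have d: "0 < d" "d * t \<le> exp (- (M * t)) / 2"
    using t by (auto simp: d_def field_simps)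
  have "0 < d\<^sup>2 / (- 2 * k)" using d k by (intro divide_pos_pos) auto
  then obtain b where b: "\<And>x. b < \<bar>x\<bar> \<Longrightarrow> rho0 x < d\<^sup>2 / (- 2 * k)"
    using prob_density_vanishes_at_infinity[OF rho0_prob uc] by blast
  have far: "exp (- (M * t)) / 2 \<le> G s a" if s: "s \<in> {0..t}" and a: "b < \<bar>a\<bar>" for s a
  proof -
    have e: "- d \<le> e0 a"
    proof (cases "e0 a < 0")
      case True
      have "(e0 a)\<^sup>2 < - 2 * k * rho0 a" using subcritical_e0_lower[OF k True] sub[OF True] by blast
      also have "\<dots> \<le> d\<^sup>2" using b[OF a] k by (simp add: field_simps)
      finally have "\<bar>e0 a\<bar> < d" using power2_less_imp_less[of "\<bar>e0 a\<bar>" d] d by simp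
      then show ?thesis using d by linarith
    qed (use d in auto)
    have s0: "0 \<le> s" using s by simp
    have E: "0 \<le> exp (- qt s a) * I1 s a" "exp (- qt s a) * I1 s a \<le> t"
    proof -
      show "0 \<le> exp (- qt s a) * I1 s a" using I1_bounds(1)[OF s0] by simp
      have "exp (- qt s a) * I1 s a \<le> exp (- qt s a) * (s * exp (qt s a))"
        by (intro mult_left_mono I1_bounds(2)[OF s0]) auto
      also have "exp (- qt s a) * (s * exp (qt s a)) = s" by (simp add: exp_minus)
      finally show "exp (- qt s a) * I1 s a \<le> t" using s by simp
    qed
    have "exp (- (M * t)) \<le> exp (- qt s a)"
    proof -
      have "M * s \<le> M * t" using s M by (intro mult_left_mono) auto
      then show ?thesis using qt_bounds(2)[OF s0, of a] by simp
    qed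
    moreover have "- d * t \<le> e0 a * (exp (- qt s a) * I1 s a)"
    proof -
      have "- d * t \<le> - d * (exp (- qt s a) * I1 s a)" using E(2) d by simp
      also have "\<dots> \<le> e0 a * (exp (- qt s a) * I1 s a)" using e E(1) by (intro mult_right_mono) auto
      finally show ?thesis .
    qed
    moreover have "k * rho0 a * I2 s a * exp (- qt s a) \<le> 0"
      using k rho0_nonneg[of a] I2_nonneg[OF s0] by (simp add: mult_nonpos_nonneg)
    moreover have "G s a = exp (- qt s a) + e0 a * (exp (- qt s a) * I1 s a) - k * rho0 a * I2 s a * exp (- qt s a)"
      by (simp add: G_def algebra_simps)
    moreover have "- d * t = - (d * t)" by simp
    ultimately show ?thesis using d(2) by linarith
  qed
  obtain c where c: "0 < c" "\<And>s a. s \<in> {0..t} \<Longrightarrow> \<bar>a\<bar> \<le> b \<Longrightarrow> c \<le> G s a"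
  \<comment> \<open>For negative \<open>b\<close> there is no label with
    \<open>\<bar>a\<bar> \<le> b\<close>, and any positive \<open>c\<close> will do.\<close>
  proof (cases "0 \<le> b")
    case True
    have "\<exists>p\<in>{0..t} \<times> {-b..b}. \<forall>r\<in>{0..t} \<times> {-b..b}. (\<lambda>(s, a). G s a) p \<le> (\<lambda>(s, a). G s a) r"
    proof (rule continuous_attains_inf)
      show "compact ({0..t} \<times> {-b..b})" by (intro compact_Times) auto
      show "{0..t} \<times> {-b..b} \<noteq> {}" using t True by auto
      show "continuous_on ({0..t} \<times> {-b..b}) (\<lambda>(s, a). G s a)"
        by (rule continuous_on_subset[OF G_cont]) auto
    qed
    then obtain s1 a1 where s1: "s1 \<in> {0..t}" "\<forall>s\<in>{0..t}. \<forall>a\<in>{-b..b}. G s1 a1 \<le> G s a" by auto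
    moreover have "0 < G s1 a1" using subcritical_G_pos[OF k _ sub] s1(1) by auto
    ultimately show thesis using that[of "G s1 a1"] by (auto simp: abs_le_iff)
  qed (use that[of 1] in auto)
  have "min c (exp (- (M * t)) / 2) \<le> G s a" if "s \<in> {0..t}" for s a
    using far[OF that, of a] c(2)[OF that, of a] by (cases "b < \<bar>a\<bar>") auto
  then show ?thesis unfolding nondegenerate_def using c(1) by (intro exI[of _ "min c (exp (- (M * t)) / 2)"]) auto
qed

end

section \<open>From the hypotheses on the data to the Lagrangian setting\<close>

theorem theorem1p2:
  fixes k psi_m psi_M :: real
    and psi rho0 u0 :: "real \<Rightarrow> real"
  assumes "k \<noteq> 0"
    and "W1infty psi"
    and "0 \<le> psi_m"
    and "\<And>x. psi_m \<le> psi x"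
    and "\<And>x. psi x = psi (- x)"
    and "\<And>x. psi x \<le> psi_M"
    and "psi_M > 0"
    and "prob_density rho0"
    and "regular_data psi k rho0 u0"
  shows "(k > 0 \<longrightarrow> blows_up_in_finite_time psi k rho0 u0) \<and>
         (k < 0 \<longrightarrow>
            (\<forall>x. rho0 x > 0 \<longrightarrow> (\<exists>!s. threshold_root k psi_M (rho0 x) s)) \<and>
            ((\<forall>x. deriv u0 x > - conv psi rho0 x + sigma_plus k psi_M (rho0 x)) \<longrightarrow>
               global_classical_solution_exists psi k rho0 u0) \<and>
            ((\<exists>x. deriv u0 x < - conv psi rho0 x + sigma_minus k (rho0 x)) \<longrightarrow>
               blows_up_in_finite_time psi k rho0 u0))"
proof -
  obtain psi' where psi'_meas: "psi' \<in> borel_measurable borel" and psi'_bd: "bounded (range psi')"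
    and psi_diff: "\<And>a b. a \<le> b \<Longrightarrow> psi b - psi a = (LINT y:{a..b}|lborel. psi' y)"
    using \<open>W1infty psi\<close> unfolding W1infty_def by blast
  obtain B where B: "\<And>x. \<bar>psi' x\<bar> \<le> B" using psi'_bd by (auto simp: bounded_iff)
  have "continuous_on UNIV psi"
    by (rule lipschitz_on_continuous_on[of B])
      (use primitive_lipschitz[OF psi_diff B] B[of 0] in \<open>auto simp: lipschitz_on_def dist_real_def\<close>)
  then obtain Psi where Psi: "\<And>x. (Psi has_real_derivative psi x) (at x)" using antiderivative_exists by blast
  obtain T rho u where T: "0 < T" and sol: "classical_solution psi k rho0 u0 T rho u"
    and uc: "uniformly_continuous_on UNIV rho0"
    using \<open>regular_data psi k rho0 u0\<close> unfolding regular_data_def by blast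
  have zero: "0 \<in> time_dom T" using T by (simp add: time_dom_def zero_ereal_def)
  have init: "rho 0 = rho0" "u 0 = u0" and slabs: "C1_slab T rho" "C1_slab T u"
    and u0_int: "integrable lborel (\<lambda>y. u0 y * rho0 y)"
    using sol zero by (auto simp: classical_solution_def)
  obtain rx where rx: "continuous_strip (time_dom T) rx"
    "\<And>x. (rho0 has_real_derivative rx 0 x) (at x)"
    using slabs(1) zero unfolding C1_slab_def init(1)[symmetric] by blast
  obtain ux where ux: "continuous_strip (time_dom T) ux"
    "\<And>x. (u0 has_real_derivative ux 0 x) (at x)"
    using slabs(2) zero unfolding C1_slab_def init(2)[symmetric] by blast
  \<comment> \<open>The strip \<open>{0..0}\<close> extracts from the local solution one constant
    that bounds both \<open>rho0\<close> and the derivative of \<open>u0\<close>.\<close>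
  have "\<exists>C. \<forall>t\<in>{0..0}. (\<forall>x. rho t x \<le> C \<and> \<bar>deriv (u t) x\<bar> \<le> C) \<and> (LINT y|lborel. \<bar>u t y\<bar> * rho t y) \<le> C"
    using sol zero unfolding classical_solution_def by blast
  then obtain C where C: "\<And>x. rho0 x \<le> C" "\<And>x. \<bar>deriv u0 x\<bar> \<le> C" by (auto simp: init)
  have du0: "deriv u0 x = ux 0 x" for x by (rule DERIV_imp_deriv[OF ux(2)])
  interpret epa_data k psi_M B C C psi psi' Psi rho0 "rx 0" u0 "ux 0"
  proof
    show "0 \<le> psi x" for x using assms(3) assms(4)[of x] by linarith
    show "\<bar>ux 0 x\<bar> \<le> C" for x using C(2)[of x] by (simp add: du0)
  qed (use assms psi'_meas B psi_diff Psi rx(2) ux(2) C(1) u0_int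
      continuous_on_space_slice[OF rx(1) zero] continuous_on_space_slice[OF ux(1) zero] in auto)
  obtain X where "flow X" using flow_exists by blast
  then interpret epa_flow k psi_M B C C psi psi' Psi rho0 "rx 0" u0 "ux 0" X by unfold_locales
  \<comment> \<open>With this identity the two hypotheses become \<open>e0 > sigma_plus\<close>
    everywhere and \<open>e0 < sigma_minus\<close> somewhere.\<close>
  have e0: "e0 x = deriv u0 x + conv psi rho0 x" for x
    by (simp add: e0_def du0 conv_def integral_D mult.commute)
  note blowup = blowup_if_degenerate[OF WD_e0[OF sol T]]
  have "blows_up_in_finite_time psi k rho0 u0" if "0 < k"
    using attractive_degenerate[OF that] blowup by blast
  moreover have "blows_up_in_finite_time psi k rho0 u0"
    if "k < 0" "deriv u0 x < - conv psi rho0 x + sigma_minus k (rho0 x)" for x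
    using supercritical_degenerate[OF that(1), of x] blowup that(2) by (auto simp: e0)
  moreover have "global_classical_solution_exists psi k rho0 u0"
    if k: "k < 0" and sub: "\<And>x. deriv u0 x > - conv psi rho0 x + sigma_plus k psi_M (rho0 x)"
  proof (rule global_if_nondegenerate[OF WD_e0[OF sol T]], rule subcritical_nondegenerate[OF k uc])
    fix a assume neg: "e0 a < 0"
    have gt: "sigma_plus k psi_M (rho0 a) < e0 a" using sub[of a] by (simp add: e0)
    \<comment> \<open>Where \<open>rho0\<close> vanishes, \<open>sigma_plus\<close> is 0 and the
      hypothesis would read \<open>e0 a > 0\<close>.\<close>
    have "rho0 a \<noteq> 0" using gt neg by (auto simp: sigma_plus_def)
    then have pos: "0 < rho0 a" using rho0_nonneg[of a] by simp
    then show "0 < rho0 a \<and> exp (psi_M * e0 a / (k * rho0 a)) - psi_M * e0 a / (k * rho0 a) < 1 - psi_M\<^sup>2 / (k * rho0 a)"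
      using above_threshold[OF k \<open>psi_M > 0\<close> pos gt neg] by blast
  qed
  ultimately show ?thesis using threshold_root_unique \<open>psi_M > 0\<close> by blast
qed

end
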